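(* Let $q\in\mathbb{C}^*$ not be a root of unity. The category $\mathcal{A}$ of finite dimensional $U_q(\mathfrak{s})$-modules of type $1$ with zero action of $Z$ is equivalent to the category $\mathcal{B}$ of finite dimensional representations (over $\mathbb{C}$) of the infinite quiver $\mathbf{Q}_\infty$ with vertex set $\mathbb{Z}_{\ge 0}$ and arrows $a_i:i\to i+1$, $b_i:i+1\to i$ for each $i\in\mathbb{Z}_{\ge0}$, satisfying the relations $$b_0a_0=0,\qquad a_ib_i=b_{i+1}a_{i+1},\quad i\in\mathbb{Z}_{\ge0}.$$
   Context: $U_q(\mathfrak{s})$ (the quantum Schrödinger algebra) is the unital associative $\mathbb{C}$-algebra generated by $E,F,K,K^{-1},X,Y,Z$ with relations: $KK^{-1}=K^{-1}K=1$, $Z$ central, $EF-FE=\frac{K-K^{-1}}{q-q^{-1}}$, $KEK^{-1}=q^2E$, $KFK^{-1}=q^{-2}F$, $KXK^{-1}=qX$, $KYK^{-1}=q^{-1}Y$, $qYX-XY=Z$, $EX=qXE$, $EY=X+q^{-1}YE$, $FX=YK^{-1}+XF$, $FY=YF$. A $U_q(\mathfrak{s})$-module $V$ is a weight module if $V=\bigoplus_{\lambda\in\mathbb{C}^*}V_\lambda$ with $V_\lambda=\{v:Kv=\lambda v\}$; it is of type $1$ if it is a weight module with $\{\lambda: V_\lambda\ne0\}\subset q^{\mathbb{Z}}=\{q^n:n\in\mathbb{Z}\}$. $\mathcal{A}$ is the full subcategory of $U_q(\mathfrak{s})$-modules that are finite dimensional, of type $1$, and on which $Z$ acts by $0$.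 A representation of $\mathbf{Q}_\infty$ consists of vector spaces $V_i$ ($i\in\mathbb{Z}_{\ge0}$) and linear maps $V(a_i):V_i\to V_{i+1}$, $V(b_i):V_{i+1}\to V_i$; it is finite dimensional if $\bigoplus_iV_i$ is finite dimensional. Products of arrows denote composition of maps read right to left, so the relations mean $V(b_0)V(a_0)=0$ and $V(a_i)V(b_i)=V(b_{i+1})V(a_{i+1})$ for all $i\ge0$. Morphisms are families of linear maps commuting with all $V(a_i)$, $V(b_i)$. *)

theory Defs
  imports "HOL-Algebra.Algebraic_Closure_Type" "HOL-Library.Poly_Mapping"
begin

section \<open>Categories and equivalences of categories\<close>

text \<open>
  Morphism sets are indexed by source and target and need not be disjoint; composition and the
  morphism part of a functor therefore take the objects as arguments.
  \<open>Comp C A B D g f\<close> is the composite of \<open>f : A \<rightarrow> B\<close> followed by \<open>g : B \<rightarrow> D\<close>.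
\<close>

record ('o, 'm) cat =
  Obj :: "'o set"
  Mor :: "'o \<Rightarrow> 'o \<Rightarrow> 'm set"
  Idn :: "'o \<Rightarrow> 'm"
  Comp :: "'o \<Rightarrow> 'o \<Rightarrow> 'o \<Rightarrow> 'm \<Rightarrow> 'm \<Rightarrow> 'm"

locale category =
  fixes C :: "('o, 'm) cat"
  assumes Idn_in_Mor: "A \<in> Obj C \<Longrightarrow> Idn C A \<in> Mor C A A"
    and Comp_in_Mor: "\<lbrakk>A \<in> Obj C; B \<in> Obj C; D \<in> Obj C; f \<in> Mor C A B; g \<in> Mor C B D\<rbrakk>
      \<Longrightarrow> Comp C A B D g f \<in> Mor C A D"
    and Comp_Idn_right: "\<lbrakk>A \<in> Obj C; B \<in> Obj C; f \<in> Mor C A B\<rbrakk>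
      \<Longrightarrow> Comp C A A B f (Idn C A) = f"
    and Comp_Idn_left: "\<lbrakk>A \<in> Obj C; B \<in> Obj C; f \<in> Mor C A B\<rbrakk>
      \<Longrightarrow> Comp C A B B (Idn C B) f = f"
    and Comp_assoc: "\<lbrakk>A \<in> Obj C; B \<in> Obj C; D \<in> Obj C; E \<in> Obj C;
        f \<in> Mor C A B; g \<in> Mor C B D; h \<in> Mor C D E\<rbrakk>
      \<Longrightarrow> Comp C A D E h (Comp C A B D g f) = Comp C A B E (Comp C B D E h g) f"

definition full_subcategory :: "('o, 'm) cat \<Rightarrow> ('o \<Rightarrow> bool) \<Rightarrow> ('o, 'm) cat" where
  "full_subcategory C P = C\<lparr>Obj := {A \<in> Obj C. P A}\<rparr>"

record ('o, 'm, 'p, 'n) cat_map =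
  omap :: "'o \<Rightarrow> 'p"
  mmap :: "'o \<Rightarrow> 'o \<Rightarrow> 'm \<Rightarrow> 'n"

definition is_functor :: "('o, 'm) cat \<Rightarrow> ('p, 'n) cat \<Rightarrow> ('o, 'm, 'p, 'n) cat_map \<Rightarrow> bool" where
  "is_functor C D F \<longleftrightarrow>
     (\<forall>A\<in>Obj C. omap F A \<in> Obj D) \<and>
     (\<forall>A\<in>Obj C. \<forall>B\<in>Obj C. \<forall>f\<in>Mor C A B. mmap F A B f \<in> Mor D (omap F A) (omap F B)) \<and>
     (\<forall>A\<in>Obj C. mmap F A A (Idn C A) = Idn D (omap F A)) \<and>
     (\<forall>A\<in>Obj C. \<forall>B\<in>Obj C. \<forall>E\<in>Obj C. \<forall>f\<in>Mor C A B. \<forall>g\<in>Mor C B E.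
        mmap F A E (Comp C A B E g f) =
        Comp D (omap F A) (omap F B) (omap F E) (mmap F B E g) (mmap F A B f))"

definition id_functor :: "('o, 'm, 'o, 'm) cat_map" where
  "id_functor = \<lparr>omap = (\<lambda>A. A), mmap = (\<lambda>A B f. f)\<rparr>"

definition comp_functor ::
    "('p, 'n, 'r, 'k) cat_map \<Rightarrow> ('o, 'm, 'p, 'n) cat_map \<Rightarrow> ('o, 'm, 'r, 'k) cat_map" where
  "comp_functor G F =
     \<lparr>omap = (\<lambda>A. omap G (omap F A)),
      mmap = (\<lambda>A B f. mmap G (omap F A) (omap F B) (mmap F A B f))\<rparr>"

definition is_isomorphism :: "('o, 'm) cat \<Rightarrow> 'o \<Rightarrow> 'o \<Rightarrow> 'm \<Rightarrow> bool" where
  "is_isomorphism C A B f \<longleftrightarrow> f \<in> Mor C A B \<and>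
     (\<exists>g\<in>Mor C B A. Comp C A B A g f = Idn C A \<and> Comp C B A B f g = Idn C B)"

definition natural_isomorphism ::
    "('o, 'm) cat \<Rightarrow> ('p, 'n) cat \<Rightarrow> ('o, 'm, 'p, 'n) cat_map \<Rightarrow> ('o, 'm, 'p, 'n) cat_map
      \<Rightarrow> ('o \<Rightarrow> 'n) \<Rightarrow> bool" where
  "natural_isomorphism C D F G \<eta> \<longleftrightarrow>
     (\<forall>A\<in>Obj C. is_isomorphism D (omap F A) (omap G A) (\<eta> A)) \<and>
     (\<forall>A\<in>Obj C. \<forall>B\<in>Obj C. \<forall>f\<in>Mor C A B.
        Comp D (omap F A) (omap F B) (omap G B) (\<eta> B) (mmap F A B f) =
        Comp D (omap F A) (omap G A) (omap G B) (mmap G A B f) (\<eta> A))"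

definition equivalent_categories :: "('o, 'm) cat \<Rightarrow> ('p, 'n) cat \<Rightarrow> bool" where
  "equivalent_categories C D \<longleftrightarrow> category C \<and> category D \<and>
     (\<exists>F G \<eta> \<epsilon>. is_functor C D F \<and> is_functor D C G \<and>
        natural_isomorphism C C id_functor (comp_functor G F) \<eta> \<and>
        natural_isomorphism D D (comp_functor F G) id_functor \<epsilon>)"


section \<open>Modules over a not necessarily commutative ring\<close>

text \<open>
  The library locale \<open>module\<close> requires a commutative ring.  As there, the multiplicative fields
  \<open>mult\<close> and \<open>one\<close> of the record of a module carry no meaning.
\<close>

locale left_module = R?: ring R + M?: abelian_group M
  for R :: "('r, 'k) ring_scheme" (structure) and M :: "('r, 'a, 'm) module_scheme" (structure) +
  assumes smult_closed: "\<lbrakk>a \<in> carrier R; x \<in> carrier M\<rbrakk> \<Longrightarrow> a \<odot>\<^bsub>M\<^esub> x \<in> carrier M"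
    and smult_l_distr: "\<lbrakk>a \<in> carrier R; b \<in> carrier R; x \<in> carrier M\<rbrakk>
      \<Longrightarrow> (a \<oplus>\<^bsub>R\<^esub> b) \<odot>\<^bsub>M\<^esub> x = a \<odot>\<^bsub>M\<^esub> x \<oplus>\<^bsub>M\<^esub> b \<odot>\<^bsub>M\<^esub> x"
    and smult_r_distr: "\<lbrakk>a \<in> carrier R; x \<in> carrier M; y \<in> carrier M\<rbrakk>
      \<Longrightarrow> a \<odot>\<^bsub>M\<^esub> (x \<oplus>\<^bsub>M\<^esub> y) = a \<odot>\<^bsub>M\<^esub> x \<oplus>\<^bsub>M\<^esub> a \<odot>\<^bsub>M\<^esub> y"
    and smult_assoc: "\<lbrakk>a \<in> carrier R; b \<in> carrier R; x \<in> carrier M\<rbrakk>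
      \<Longrightarrow> (a \<otimes>\<^bsub>R\<^esub> b) \<odot>\<^bsub>M\<^esub> x = a \<odot>\<^bsub>M\<^esub> (b \<odot>\<^bsub>M\<^esub> x)"
    and smult_one: "x \<in> carrier M \<Longrightarrow> \<one>\<^bsub>R\<^esub> \<odot>\<^bsub>M\<^esub> x = x"

text \<open>
  Homomorphisms are extensional functions, so that equality of morphisms is equality on the carrier.
\<close>

definition module_hom ::
    "('r, 'k) ring_scheme \<Rightarrow> ('r, 'a, 'm) module_scheme \<Rightarrow> ('r, 'b, 'n) module_scheme \<Rightarrow> ('a \<Rightarrow> 'b) set"
  where "module_hom R M N = {f \<in> carrier M \<rightarrow>\<^sub>E carrier N.
     (\<forall>x\<in>carrier M. \<forall>y\<in>carrier M. f (x \<oplus>\<^bsub>M\<^esub> y) = f x \<oplus>\<^bsub>N\<^esub> f y) \<and>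
     (\<forall>a\<in>carrier R. \<forall>x\<in>carrier M. f (a \<odot>\<^bsub>M\<^esub> x) = a \<odot>\<^bsub>N\<^esub> f x)}"

text \<open>
  The objects are the modules whose carrier is a subset of a given type.  If the complex numbers
  inject into that type, then every finite dimensional complex vector space is isomorphic to one
  whose carrier is such a subset.
\<close>

definition left_module_cat :: "('r, 'k) ring_scheme \<Rightarrow> (('r, 'a) module, 'a \<Rightarrow> 'a) cat" where
  "left_module_cat R =
     \<lparr>Obj = {M. left_module R M},
      Mor = module_hom R,
      Idn = (\<lambda>M. \<lambda>x\<in>carrier M. x),
      Comp = (\<lambda>L M N g f. compose (carrier L) g f)\<rparr>"

definition restrict_scalars :: "('s \<Rightarrow> 'r) \<Rightarrow> ('r, 'a) module \<Rightarrow> ('s, 'a) module" where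
  "restrict_scalars \<phi> M =
     \<lparr>carrier = carrier M, monoid.mult = monoid.mult M, one = monoid.one M,
      ring.zero = ring.zero M, add = ring.add M,
      module.smult = (\<lambda>c x. \<phi> c \<odot>\<^bsub>M\<^esub> x)\<rparr>"

definition internal_direct_sum :: "('r, 'a, 'm) module_scheme \<Rightarrow> 'i set \<Rightarrow> ('i \<Rightarrow> 'a set) \<Rightarrow> bool" where
  "internal_direct_sum M I W \<longleftrightarrow>
     (\<forall>i\<in>I. W i \<subseteq> carrier M) \<and>
     (\<forall>v\<in>carrier M. \<exists>!w. w \<in> (\<Pi>\<^sub>E i\<in>I. W i) \<and> finite {i\<in>I. w i \<noteq> \<zero>\<^bsub>M\<^esub>} \<and>
        v = finsum M w {i\<in>I. w i \<noteq> \<zero>\<^bsub>M\<^esub>})"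

definition direct_sum :: "'i set \<Rightarrow> ('i \<Rightarrow> ('r, 'a) module) \<Rightarrow> ('r, 'i \<Rightarrow> 'a) module" where
  "direct_sum I V =
     \<lparr>carrier = {f \<in> (\<Pi>\<^sub>E i\<in>I. carrier (V i)). finite {i\<in>I. f i \<noteq> \<zero>\<^bsub>V i\<^esub>}},
      monoid.mult = undefined, one = undefined,
      ring.zero = (\<lambda>i\<in>I. \<zero>\<^bsub>V i\<^esub>),
      add = (\<lambda>f g. \<lambda>i\<in>I. f i \<oplus>\<^bsub>V i\<^esub> g i),
      module.smult = (\<lambda>c f. \<lambda>i\<in>I. c \<odot>\<^bsub>V i\<^esub> f i)\<rparr>"

abbreviation complex_field :: "complex ring" where
  "complex_field \<equiv> ring_of_type_algebra"

definition finite_dim :: "(complex, 'a, 'm) module_scheme \<Rightarrow> bool" where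
  "finite_dim V \<longleftrightarrow> (\<exists>S. finite S \<and> S \<subseteq> carrier V \<and>
     (\<forall>v\<in>carrier V. \<exists>c. v = finsum V (\<lambda>s. c s \<odot>\<^bsub>V\<^esub> s) S))"


section \<open>The quantum Schroedinger algebra\<close>

text \<open>
  The free algebra on a set of generators is the monoid algebra of the free monoid; \<open>Poly_Mapping\<close>
  needs the monoid to be written additively.
\<close>

datatype 'g word = Word "'g list"

instantiation word :: (type) monoid_add
begin

definition zero_word :: "'a word" where
  "0 = Word []"

fun plus_word :: "'a word \<Rightarrow> 'a word \<Rightarrow> 'a word" where
  "Word u + Word v = Word (u @ v)"

instance
proof
  fix a b c :: "'a word"
  show "a + b + c = a + (b + c)" by (cases a; cases b; cases c) simp
  show "0 + a = a" by (cases a) (simp add: zero_word_def)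
  show "a + 0 = a" by (cases a) (simp add: zero_word_def)
qed

end

datatype uq_gen = Gen_E | Gen_F | Gen_K | Gen_Kinv | Gen_X | Gen_Y | Gen_Z

type_synonym uq_free = "uq_gen word \<Rightarrow>\<^sub>0 complex"

definition gen :: "uq_gen \<Rightarrow> uq_free" where
  "gen g = Poly_Mapping.single (Word [g]) 1"

definition const :: "complex \<Rightarrow> uq_free" where
  "const c = Poly_Mapping.single 0 c"

text \<open>An element \<open>r\<close> of this set stands for the relation \<open>r = 0\<close>.\<close>

definition uq_relations :: "complex \<Rightarrow> uq_free set" where
  "uq_relations q =
    (let e = gen Gen_E; f = gen Gen_F; k = gen Gen_K; k' = gen Gen_Kinv;
         x = gen Gen_X; y = gen Gen_Y; z = gen Gen_Z
     in {k * k' - 1, k' * k - 1} \<union>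
        {z * gen g - gen g * z |g. True} \<union>
        {(e * f - f * e) - const (1 / (q - inverse q)) * (k - k'),
         k * e * k' - const (q^2) * e,
         k * f * k' - const (inverse (q^2)) * f,
         k * x * k' - const q * x,
         k * y * k' - const (inverse q) * y,
         (const q * y * x - x * y) - z,
         e * x - const q * x * e,
         e * y - (x + const (inverse q) * y * e),
         f * x - (y * k' + x * f),
         f * y - y * f})"

definition uq_ideal :: "complex \<Rightarrow> uq_free set" where
  "uq_ideal q = genideal ring_of_type_algebra (uq_relations q)"

definition Uq :: "complex \<Rightarrow> uq_free set ring" where
  "Uq q = ring_of_type_algebra Quot uq_ideal q"

definition uq_class :: "complex \<Rightarrow> uq_free \<Rightarrow> uq_free set" where
  "uq_class q p = uq_ideal q +>\<^bsub>ring_of_type_algebra\<^esub> p"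

definition underlying_space :: "complex \<Rightarrow> (uq_free set, 'a) module \<Rightarrow> (complex, 'a) module" where
  "underlying_space q M = restrict_scalars (\<lambda>c. uq_class q (const c)) M"

definition weight_space :: "complex \<Rightarrow> (uq_free set, 'a) module \<Rightarrow> complex \<Rightarrow> 'a set" where
  "weight_space q M \<mu> = {v \<in> carrier M.
     uq_class q (gen Gen_K) \<odot>\<^bsub>M\<^esub> v = \<mu> \<odot>\<^bsub>underlying_space q M\<^esub> v}"

definition weight_module :: "complex \<Rightarrow> (uq_free set, 'a) module \<Rightarrow> bool" where
  "weight_module q M \<longleftrightarrow> internal_direct_sum M (UNIV - {0}) (weight_space q M)"

definition type_one :: "complex \<Rightarrow> (uq_free set, 'a) module \<Rightarrow> bool" where
  "type_one q M \<longleftrightarrow> weight_module q M \<and>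
     {\<mu>. \<mu> \<noteq> 0 \<and> weight_space q M \<mu> \<noteq> {\<zero>\<^bsub>M\<^esub>}} \<subseteq> {q powi n |n :: int. True}"

definition schroedinger_cat :: "complex \<Rightarrow> ((uq_free set, 'a) module, 'a \<Rightarrow> 'a) cat" where
  "schroedinger_cat q = full_subcategory (left_module_cat (Uq q))
     (\<lambda>M. finite_dim (underlying_space q M) \<and> type_one q M \<and>
          (\<forall>v\<in>carrier M. uq_class q (gen Gen_Z) \<odot>\<^bsub>M\<^esub> v = \<zero>\<^bsub>M\<^esub>))"


section \<open>Representations of the infinite quiver\<close>

record 'b quiver_rep =
  space :: "nat \<Rightarrow> (complex, 'b) module"
  arr_a :: "nat \<Rightarrow> 'b \<Rightarrow> 'b"
  arr_b :: "nat \<Rightarrow> 'b \<Rightarrow> 'b"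

definition is_quiver_rep :: "'b quiver_rep \<Rightarrow> bool" where
  "is_quiver_rep V \<longleftrightarrow> (\<forall>i. module complex_field (space V i) \<and>
     arr_a V i \<in> module_hom complex_field (space V i) (space V (Suc i)) \<and>
     arr_b V i \<in> module_hom complex_field (space V (Suc i)) (space V i))"

definition satisfies_relations :: "'b quiver_rep \<Rightarrow> bool" where
  "satisfies_relations V \<longleftrightarrow>
     (\<forall>v\<in>carrier (space V 0). arr_b V 0 (arr_a V 0 v) = \<zero>\<^bsub>space V 0\<^esub>) \<and>
     (\<forall>i. \<forall>v\<in>carrier (space V (Suc i)).
        arr_a V i (arr_b V i v) = arr_b V (Suc i) (arr_a V (Suc i) v))"

definition rep_hom :: "'b quiver_rep \<Rightarrow> 'b quiver_rep \<Rightarrow> (nat \<Rightarrow> 'b \<Rightarrow> 'b) set" where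
  "rep_hom V W = {\<phi>. \<forall>i. \<phi> i \<in> module_hom complex_field (space V i) (space W i) \<and>
     (\<forall>v\<in>carrier (space V i). \<phi> (Suc i) (arr_a V i v) = arr_a W i (\<phi> i v)) \<and>
     (\<forall>v\<in>carrier (space V (Suc i)). \<phi> i (arr_b V i v) = arr_b W i (\<phi> (Suc i) v))}"

definition quiver_rep_cat :: "('b quiver_rep, nat \<Rightarrow> 'b \<Rightarrow> 'b) cat" where
  "quiver_rep_cat =
     \<lparr>Obj = {V. is_quiver_rep V \<and> satisfies_relations V \<and> finite_dim (direct_sum UNIV (space V))},
      Mor = rep_hom,
      Idn = (\<lambda>V i. \<lambda>v\<in>carrier (space V i). v),
      Comp = (\<lambda>U V W \<psi> \<phi> i. compose (carrier (space U i)) (\<psi> i) (\<phi> i))\<rparr>"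

end

theory Submission
  imports Defs "HOL-Library.Function_Algebras" "HOL-Library.Nat_Bijection"
begin

text \<open>
  On a module in \<open>\<A>\<close> the algebra generated by \<open>E\<close>, \<open>F\<close>, \<open>K\<close> acts semisimply, so the module is
  spanned, without redundancy, by the vectors \<open>F\<^sup>k v\<close> with \<open>v\<close> a highest weight vector of weight \<open>n\<close>
  and \<open>k \<le> n\<close>.  Let \<open>V\<^sub>n\<close> be the space of these \<open>v\<close>.  Since \<open>X\<close> and \<open>Y\<close> span a two-dimensional
  representation, they are determined by the maps \<open>a = X : V\<^sub>n \<rightarrow> V\<^sub>n\<^sub>+\<^sub>1\<close> and
  \<open>b = [n + 1] Y - q\<^sup>-\<^sup>1 X F : V\<^sub>n\<^sub>+\<^sub>1 \<rightarrow> V\<^sub>n\<close>, and for these \<open>q Y X = X Y\<close> says exactly that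
  \<open>b a = a b\<close> on \<open>V\<^sub>n\<close> for \<open>n > 0\<close> and \<open>b a = 0\<close> on \<open>V\<^sub>0\<close>.  Conversely a
  representation of the quiver yields a module, with \<open>X\<close> and \<open>Y\<close> given by the formulas
  \<open>[n + 1] Y F\<^sup>k v = q F\<^sup>k b v + F\<^sup>k\<^sup>+\<^sup>1 a v\<close> and
  \<open>[n + 1] X F\<^sup>k v = q\<^sup>k [n + 1 - k] F\<^sup>k a v - q\<^sup>k\<^sup>-\<^sup>n [k] F\<^sup>k\<^sup>-\<^sup>1 b v\<close>.

  All computations are done on finite dimensional subspaces of a fixed vector space, the functions
  from the natural numbers to the complex numbers.  The equivalence is the composite of three fully
  faithful, essentially surjective functors: modules to modules in coordinates, these to
  representations in coordinates, and these to representations on carriers of the given type.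
\<close>

section \<open>Fully faithful and essentially surjective functors\<close>

text \<open>The fractions in the formulas for X and Y are quantum Clebsch-Gordan coefficients. If
  L(n) denotes the simple module of dimension n + 1, the pair X, Y sees L(n) through L(1) tensor
  L(n), which splits into L(n + 1) and L(n - 1); the two summands account for the terms with
  \<open>a\<close> and with \<open>b\<close>, and the scaling of \<open>b\<close> removes all
  scalars from the relations. That q is not a root of unity enters in two ways. Different exponents
  give different powers of q, so vectors of different weights are independent; and [n] vanishes only
  for n = 0, so the coefficients met along a string of vectors F^k v can be divided by. The carriers
  of modules and of representations lie in two unrelated types, so neither side can be built
  directly from the other. Coordinate vectors are a neutral ground: both kinds of structure can be
  moved there by choosing bases, and moved back because the complex numbers inject into either
  type.\<close>

definition fully_faithful :: "('o, 'm) cat \<Rightarrow> ('p, 'n) cat \<Rightarrow> ('o, 'm, 'p, 'n) cat_map \<Rightarrow> bool" where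
  "fully_faithful C D F \<longleftrightarrow>
     (\<forall>A\<in>Obj C. \<forall>B\<in>Obj C. bij_betw (mmap F A B) (Mor C A B) (Mor D (omap F A) (omap F B)))"

definition ess_surj :: "('o, 'm) cat \<Rightarrow> ('p, 'n) cat \<Rightarrow> ('o, 'm, 'p, 'n) cat_map \<Rightarrow> bool" where
  "ess_surj C D F \<longleftrightarrow> (\<forall>B\<in>Obj D. \<exists>A\<in>Obj C. \<exists>f. is_isomorphism D (omap F A) B f)"

definition weak_equivalence ::
    "('o, 'm) cat \<Rightarrow> ('p, 'n) cat \<Rightarrow> ('o, 'm, 'p, 'n) cat_map \<Rightarrow> bool" where
  "weak_equivalence C D F \<longleftrightarrow> category C \<and> category D \<and> is_functor C D F \<and>
     fully_faithful C D F \<and> ess_surj C D F"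

lemma weak_equivalenceI:
  assumes "category C" "category D" "is_functor C D F"
    and "\<And>A B. \<lbrakk>A \<in> Obj C; B \<in> Obj C\<rbrakk> \<Longrightarrow> inj_on (mmap F A B) (Mor C A B)"
    and "\<And>A B g. \<lbrakk>A \<in> Obj C; B \<in> Obj C; g \<in> Mor D (omap F A) (omap F B)\<rbrakk>
      \<Longrightarrow> \<exists>f\<in>Mor C A B. mmap F A B f = g"
    and "\<And>B. B \<in> Obj D \<Longrightarrow> \<exists>A\<in>Obj C. \<exists>f. is_isomorphism D (omap F A) B f"
  shows "weak_equivalence C D F"
proof -
  have "mmap F A B ` Mor C A B = Mor D (omap F A) (omap F B)" if "A \<in> Obj C" "B \<in> Obj C" for A B
    using assms(3) assms(5)[OF that] that unfolding is_functor_def by blast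
  then show ?thesis
    using assms unfolding weak_equivalence_def fully_faithful_def ess_surj_def bij_betw_def by blast
qed

lemma (in category) is_isomorphism_comp:
  assumes "A \<in> Obj C" "B \<in> Obj C" "D \<in> Obj C" "is_isomorphism C A B f" "is_isomorphism C B D g"
  shows "is_isomorphism C A D (Comp C A B D g f)"
proof -
  obtain f' where f': "f' \<in> Mor C B A" "Comp C A B A f' f = Idn C A" "Comp C B A B f f' = Idn C B"
    and f: "f \<in> Mor C A B" using assms(4) unfolding is_isomorphism_def by blast
  obtain g' where g': "g' \<in> Mor C D B" "Comp C B D B g' g = Idn C B" "Comp C D B D g g' = Idn C D"
    and g: "g \<in> Mor C B D" using assms(5) unfolding is_isomorphism_def by blast
  let ?gf = "Comp C A B D g f" and ?fg' = "Comp C D B A f' g'"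
  have gf: "?gf \<in> Mor C A D" and fg': "?fg' \<in> Mor C D A"
    using f g f' g' assms Comp_in_Mor by blast+
  have "Comp C A D A ?fg' ?gf = Comp C A B A f' (Comp C A D B g' ?gf)"
    using Comp_assoc[OF assms(1,3,2,1) gf g'(1) f'(1)] by simp
  also have "Comp C A D B g' ?gf = f"
    using Comp_assoc[OF assms(1,2,3,2) f g g'(1)] g' f assms Comp_Idn_left by simp
  finally have 1: "Comp C A D A ?fg' ?gf = Idn C A" using f' by simp
  have "Comp C D A D ?gf ?fg' = Comp C D B D g (Comp C D A B f ?fg')"
    using Comp_assoc[OF assms(3,1,2,3) fg' f g] by simp
  also have "Comp C D A B f ?fg' = g'"
    using Comp_assoc[OF assms(3,2,1,2) g'(1) f'(1) f] g' f' assms Comp_Idn_left by simp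
  finally show ?thesis using 1 gf fg' g' unfolding is_isomorphism_def by auto
qed

lemma functor_is_isomorphism:
  assumes F: "is_functor C D F" and A: "A \<in> Obj C" "B \<in> Obj C" and f: "is_isomorphism C A B f"
  shows "is_isomorphism D (omap F A) (omap F B) (mmap F A B f)"
proof -
  obtain f' where f': "f' \<in> Mor C B A" "Comp C A B A f' f = Idn C A" "Comp C B A B f f' = Idn C B"
    and f: "f \<in> Mor C A B" using f unfolding is_isomorphism_def by blast
  show ?thesis unfolding is_isomorphism_def
    using F A f f' unfolding is_functor_def by (intro conjI bexI[of _ "mmap F B A f'"]) metis+
qed

text \<open>Weak equivalences compose without choices, whereas composing quasi-inverses would mean
  carrying units and counits along. A quasi-inverse is therefore constructed only once, for the
  whole composite. For essential surjectivity an isomorphism of the middle category is sent through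
  \<open>G\<close> and composed with one of the last category.\<close>

lemma weak_equivalence_comp:
  assumes F: "weak_equivalence C D F" and G: "weak_equivalence D E G"
  shows "weak_equivalence C E (comp_functor G F)"
proof (rule weak_equivalenceI)
  have fF: "is_functor C D F" and fG: "is_functor D E G"
    and esF: "ess_surj C D F" and esG: "ess_surj D E G"
    using F G unfolding weak_equivalence_def by auto
  show catC: "category C" and catE: "category E"
    using F G unfolding weak_equivalence_def by auto
  show "is_functor C E (comp_functor G F)"
    using fF fG unfolding is_functor_def comp_functor_def by simp
  show "inj_on (mmap (comp_functor G F) A B) (Mor C A B)" if "A \<in> Obj C" "B \<in> Obj C" for A B
  proof -
    have "inj_on (mmap F A B) (Mor C A B)" "mmap F A B ` Mor C A B = Mor D (omap F A) (omap F B)"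
      using F that unfolding weak_equivalence_def fully_faithful_def bij_betw_def by auto
    moreover have "inj_on (mmap G (omap F A) (omap F B)) (Mor D (omap F A) (omap F B))"
      using F G that unfolding weak_equivalence_def fully_faithful_def bij_betw_def is_functor_def
      by auto
    ultimately have "inj_on (mmap G (omap F A) (omap F B) \<circ> mmap F A B) (Mor C A B)"
      by (metis comp_inj_on)
    then show ?thesis
      by (simp add: comp_functor_def comp_def)
  qed
  show "\<exists>f\<in>Mor C A B. mmap (comp_functor G F) A B f = g"
    if "A \<in> Obj C" "B \<in> Obj C" "g \<in> Mor E (omap (comp_functor G F) A) (omap (comp_functor G F) B)"
    for A B g
  proof -
    have 1: "mmap F A B ` Mor C A B = Mor D (omap F A) (omap F B)"
      using F that unfolding weak_equivalence_def fully_faithful_def bij_betw_def by auto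
    have 2: "mmap G (omap F A) (omap F B) ` Mor D (omap F A) (omap F B) =
      Mor E (omap G (omap F A)) (omap G (omap F B))"
      using F G that unfolding weak_equivalence_def fully_faithful_def bij_betw_def is_functor_def
      by auto
    have "g \<in> mmap G (omap F A) (omap F B) ` Mor D (omap F A) (omap F B)"
      using that(3) unfolding 2 by (simp add: comp_functor_def)
    then obtain h where h: "h \<in> Mor D (omap F A) (omap F B)" "g = mmap G (omap F A) (omap F B) h"
      by blast
    obtain k where "k \<in> Mor C A B" "h = mmap F A B k"
      using h(1) unfolding 1[symmetric] by blast
    then show ?thesis using h by (auto simp: comp_functor_def)
  qed
  show "\<exists>A\<in>Obj C. \<exists>f. is_isomorphism E (omap (comp_functor G F) A) B f" if B: "B \<in> Obj E" for B
  proof -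
    obtain A' g where A': "A' \<in> Obj D" and g: "is_isomorphism E (omap G A') B g"
      using bspec[OF esG[unfolded ess_surj_def] B] by blast
    obtain A f where A: "A \<in> Obj C" and f: "is_isomorphism D (omap F A) A' f"
      using bspec[OF esF[unfolded ess_surj_def] A'] by blast
    have FA: "omap F A \<in> Obj D" using fF A unfolding is_functor_def by auto
    have "is_isomorphism E (omap G (omap F A)) (omap G A') (mmap G (omap F A) A' f)"
      by (rule functor_is_isomorphism[OF fG FA A' f])
    moreover have "omap G (omap F A) \<in> Obj E" "omap G A' \<in> Obj E"
      using fG FA A' unfolding is_functor_def by auto
    ultimately have "is_isomorphism E (omap G (omap F A)) B
      (Comp E (omap G (omap F A)) (omap G A') B g (mmap G (omap F A) A' f))"
      using category.is_isomorphism_comp[OF catE] g that by simp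
    then show ?thesis using A by (auto simp: comp_functor_def)
  qed
qed

text \<open>The quasi-inverse sends \<open>B\<close> to a chosen preimage \<open>g0 B\<close> with
  an isomorphism \<open>e B\<close> onto \<open>B\<close>, and a morphism to the lift of its
  conjugate under these isomorphisms. Equations in \<open>C\<close> are checked after applying the
  faithful \<open>F\<close>.\<close>

lemma weak_equivalence_imp_equivalent:
  assumes "weak_equivalence C D F"
  shows "equivalent_categories C D"
proof -
  have catC: "category C" and catD: "category D" and F: "is_functor C D F"
    and ff: "\<And>A B. \<lbrakk>A \<in> Obj C; B \<in> Obj C\<rbrakk> \<Longrightarrow>
      bij_betw (mmap F A B) (Mor C A B) (Mor D (omap F A) (omap F B))"
    and es: "\<forall>B\<in>Obj D. \<exists>A f. A \<in> Obj C \<and> is_isomorphism D (omap F A) B f"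
    using assms unfolding weak_equivalence_def fully_faithful_def ess_surj_def by blast+
  interpret C: category C by (rule catC)
  interpret D: category D by (rule catD)
  obtain g0 where "\<forall>B\<in>Obj D. \<exists>f. g0 B \<in> Obj C \<and> is_isomorphism D (omap F (g0 B)) B f"
    using bchoice[OF es] by blast
  then obtain e where g0: "\<And>B. B \<in> Obj D \<Longrightarrow> g0 B \<in> Obj C"
    and e: "\<And>B. B \<in> Obj D \<Longrightarrow> is_isomorphism D (omap F (g0 B)) B (e B)"
    by metis
  have "\<forall>B\<in>Obj D. \<exists>e'. e' \<in> Mor D B (omap F (g0 B)) \<and>
      Comp D (omap F (g0 B)) B (omap F (g0 B)) e' (e B) = Idn D (omap F (g0 B)) \<and>
      Comp D B (omap F (g0 B)) B (e B) e' = Idn D B"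
    using e unfolding is_isomorphism_def by blast
  then obtain e' where e': "\<And>B. B \<in> Obj D \<Longrightarrow> e' B \<in> Mor D B (omap F (g0 B))"
    and e'e: "\<And>B. B \<in> Obj D \<Longrightarrow>
      Comp D (omap F (g0 B)) B (omap F (g0 B)) (e' B) (e B) = Idn D (omap F (g0 B))"
    and ee': "\<And>B. B \<in> Obj D \<Longrightarrow> Comp D B (omap F (g0 B)) B (e B) (e' B) = Idn D B"
    by metis
  have eM: "\<And>B. B \<in> Obj D \<Longrightarrow> e B \<in> Mor D (omap F (g0 B)) B"
    using e unfolding is_isomorphism_def by blast
  have Fo: "\<And>A. A \<in> Obj C \<Longrightarrow> omap F A \<in> Obj D"
    and Fm: "\<And>A B f. \<lbrakk>A \<in> Obj C; B \<in> Obj C; f \<in> Mor C A B\<rbrakk>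
      \<Longrightarrow> mmap F A B f \<in> Mor D (omap F A) (omap F B)"
    and FI: "\<And>A. A \<in> Obj C \<Longrightarrow> mmap F A A (Idn C A) = Idn D (omap F A)"
    and FC: "\<And>A B E f g. \<lbrakk>A \<in> Obj C; B \<in> Obj C; E \<in> Obj C; f \<in> Mor C A B; g \<in> Mor C B E\<rbrakk> \<Longrightarrow>
      mmap F A E (Comp C A B E g f) =
        Comp D (omap F A) (omap F B) (omap F E) (mmap F B E g) (mmap F A B f)"
    using F unfolding is_functor_def by auto
  define lift where "lift A B = inv_into (Mor C A B) (mmap F A B)" for A B
  have lift: "lift A B h \<in> Mor C A B" "mmap F A B (lift A B h) = h"
    if "A \<in> Obj C" "B \<in> Obj C" "h \<in> Mor D (omap F A) (omap F B)" for A B h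
    using ff[OF that(1,2)] that(3) unfolding lift_def bij_betw_def
    by (metis inv_into_into, metis f_inv_into_f)
  have eqI: "f = g" if "A \<in> Obj C" "B \<in> Obj C" "f \<in> Mor C A B" "g \<in> Mor C A B"
    "mmap F A B f = mmap F A B g" for A B f g
    using ff[OF that(1,2)] that(3-) unfolding bij_betw_def inj_on_def by blast
  \<comment> \<open>Naturality of \<open>e\<close> leaves no other choice for this
    conjugate.\<close>
  define gm where "gm A B h =
      Comp D (omap F (g0 A)) B (omap F (g0 B)) (e' B) (Comp D (omap F (g0 A)) A B h (e A))" for A
        B h
  have gm: "gm A B h \<in> Mor D (omap F (g0 A)) (omap F (g0 B))"
    if "A \<in> Obj D" "B \<in> Obj D" "h \<in> Mor D A B" for A B h
    unfolding gm_def using that g0 Fo eM e' D.Comp_in_Mor by simp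
  have e_gm: "Comp D (omap F (g0 A)) (omap F (g0 B)) B (e B) (gm A B h) =
      Comp D (omap F (g0 A)) A B h (e A)"
    if "A \<in> Obj D" "B \<in> Obj D" "h \<in> Mor D A B" for A B h
    unfolding gm_def using that g0 Fo eM e' D.Comp_in_Mor ee' D.Comp_Idn_left
    by (subst D.Comp_assoc) auto
  \<comment> \<open>Each \<open>e B\<close> is an isomorphism and can be cancelled; compatibility of
    \<open>gm\<close> with composition is verified after composing with \<open>e\<close>.\<close>
  have e_cancel: "u = v" if "A \<in> Obj D" "B \<in> Obj D" "u \<in> Mor D A (omap F (g0 B))"
    "v \<in> Mor D A (omap F (g0 B))"
    "Comp D A (omap F (g0 B)) B (e B) u = Comp D A (omap F (g0 B)) B (e B) v" for A B u v
  proof -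
    have "Comp D A B (omap F (g0 B)) (e' B) (Comp D A (omap F (g0 B)) B (e B) w) = w"
      if w: "w \<in> Mor D A (omap F (g0 B))" for w
      using that \<open>A \<in> Obj D\<close> \<open>B \<in> Obj D\<close> g0 Fo eM e' e'e D.Comp_Idn_left
      by (subst D.Comp_assoc) auto
    then show ?thesis using that by metis
  qed
  define G where "G = \<lparr>omap = g0, mmap = (\<lambda>A B h. lift (g0 A) (g0 B) (gm A B h))\<rparr>"
  have G: "is_functor D C G"
    unfolding is_functor_def G_def cat_map.simps
  proof (intro conjI ballI)
    fix A assume A: "A \<in> Obj D"
    show "g0 A \<in> Obj C" using g0 A by blast
    have "gm A A (Idn D A) = Idn D (omap F (g0 A))"
      unfolding gm_def using A g0 Fo eM e' e'e D.Comp_Idn_left D.Idn_in_Mor by simp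
    then have "gm A A (Idn D A) = mmap F (g0 A) (g0 A) (Idn C (g0 A))" using FI g0 A by simp
    then show "lift (g0 A) (g0 A) (gm A A (Idn D A)) = Idn C (g0 A)"
      using lift(1,2)[OF g0[OF A] g0[OF A] gm[OF A A D.Idn_in_Mor[OF A]]]
        eqI[OF g0[OF A] g0[OF A] _ C.Idn_in_Mor[OF g0[OF A]]] by metis
  next
    fix A B h assume "A \<in> Obj D" "B \<in> Obj D" "h \<in> Mor D A B"
    then show "lift (g0 A) (g0 B) (gm A B h) \<in> Mor C (g0 A) (g0 B)"
      using lift(1)[OF g0 g0 gm] by simp
  next
    fix A B E f g assume A: "A \<in> Obj D" "B \<in> Obj D" "E \<in> Obj D" "f \<in> Mor D A B" "g \<in> Mor D B E"
    have gf: "Comp D A B E g f \<in> Mor D A E" using A D.Comp_in_Mor by blast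
    let ?A = "omap F (g0 A)" and ?B = "omap F (g0 B)" and ?E = "omap F (g0 E)"
    have FO: "?A \<in> Obj D" "?B \<in> Obj D" "?E \<in> Obj D" using A g0 Fo by auto
    have "gm A E (Comp D A B E g f) = Comp D ?A ?B ?E (gm B E g) (gm A B f)"
    proof (rule e_cancel[of ?A E])
      have "Comp D ?A ?E E (e E) (Comp D ?A ?B ?E (gm B E g) (gm A B f)) =
         Comp D ?A ?B E (Comp D ?B B E g (e B)) (gm A B f)"
        using D.Comp_assoc[OF FO(1,2,3) A(3) gm gm eM] e_gm A by simp
      also have "\<dots> = Comp D ?A B E g (Comp D ?A A B f (e A))"
        using D.Comp_assoc[OF FO(1,2) A(2,3) gm eM A(5)] e_gm A by simp
      also have "\<dots> = Comp D ?A ?E E (e E) (gm A E (Comp D A B E g f))"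
        using D.Comp_assoc[OF FO(1) A(1,2,3) eM A(4,5)] e_gm A gf by simp
      finally show "Comp D ?A ?E E (e E) (gm A E (Comp D A B E g f)) =
        Comp D ?A ?E E (e E) (Comp D ?A ?B ?E (gm B E g) (gm A B f))" by simp
    qed (use A FO gm gf D.Comp_in_Mor in auto)
    note gmE = this
    have GO: "g0 A \<in> Obj C" "g0 B \<in> Obj C" "g0 E \<in> Obj C" using A g0 by auto
    note lAB = lift[OF GO(1,2) gm[OF A(1,2,4)]] and lBE = lift[OF GO(2,3) gm[OF A(2,3,5)]]
      and lAE = lift[OF GO(1,3) gm[OF A(1,3) gf]]
    show "lift (g0 A) (g0 E) (gm A E (Comp D A B E g f)) =
        Comp C (g0 A) (g0 B) (g0 E) (lift (g0 B) (g0 E) (gm B E g)) (lift (g0 A) (g0 B) (gm A B f))"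
      by (rule eqI[OF GO(1,3) lAE(1) C.Comp_in_Mor[OF GO lAB(1) lBE(1)]])
        (simp only: FC[OF GO lAB(1) lBE(1)] lAB(2) lBE(2) lAE(2)[unfolded gmE] gmE)
  qed
  \<comment> \<open>The unit is the lift of the inverse of \<open>e\<close>, and its own inverse
    \<open>\<theta>\<close> below is the lift of \<open>e\<close>.\<close>
  define \<eta> where "\<eta> A = lift A (g0 (omap F A)) (e' (omap F A))" for A
  have \<eta>: "\<eta> A \<in> Mor C A (g0 (omap F A))" "mmap F A (g0 (omap F A)) (\<eta> A) = e' (omap F A)"
    if "A \<in> Obj C" for A
    unfolding \<eta>_def by (rule lift[OF that g0[OF Fo[OF that]] e'[OF Fo[OF that]]])+
  have "natural_isomorphism C C id_functor (comp_functor G F) \<eta>"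
    unfolding natural_isomorphism_def id_functor_def comp_functor_def G_def cat_map.simps
  proof (intro conjI ballI)
    fix A assume A: "A \<in> Obj C"
    let ?A = "g0 (omap F A)"
    have A': "?A \<in> Obj C" "omap F A \<in> Obj D" using A Fo g0 by auto
    define \<theta> where "\<theta> = lift ?A A (e (omap F A))"
    have \<theta>: "\<theta> \<in> Mor C ?A A" "mmap F ?A A \<theta> = e (omap F A)"
      unfolding \<theta>_def by (rule lift[OF A'(1) A eM[OF A'(2)]])+
    note \<eta>A = \<eta>[OF A]
    have "Comp C A ?A A \<theta> (\<eta> A) = Idn C A"
      by (rule eqI[OF A A C.Comp_in_Mor[OF A A'(1) A \<eta>A(1) \<theta>(1)] C.Idn_in_Mor[OF A]])
        (simp only: FC[OF A A'(1) A \<eta>A(1) \<theta>(1)] \<theta>(2) \<eta>A(2) ee'[OF A'(2)] FI[OF A])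
    moreover have "Comp C ?A A ?A (\<eta> A) \<theta> = Idn C ?A"
      by (rule eqI[OF A'(1) A'(1) C.Comp_in_Mor[OF A'(1) A A'(1) \<theta>(1) \<eta>A(1)] C.Idn_in_Mor[OF
        A'(1)]])
        (simp only: FC[OF A'(1) A A'(1) \<theta>(1) \<eta>A(1)] \<theta>(2) \<eta>A(2) e'e[OF A'(2)] FI[OF A'(1)])
    ultimately show "is_isomorphism C A ?A (\<eta> A)"
      unfolding is_isomorphism_def using \<eta> \<theta> A by blast
  next
    fix A B f assume A: "A \<in> Obj C" "B \<in> Obj C" and f: "f \<in> Mor C A B"
    let ?A = "g0 (omap F A)" and ?B = "g0 (omap F B)" and ?f = "mmap F A B f"
    have O: "?A \<in> Obj C" "?B \<in> Obj C" "omap F A \<in> Obj D" "omap F B \<in> Obj D"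
      "omap F ?A \<in> Obj D" "omap F ?B \<in> Obj D" using A Fo g0 by auto
    have Ff: "?f \<in> Mor D (omap F A) (omap F B)" using Fm A f by blast
    have l: "lift ?A ?B (gm (omap F A) (omap F B) ?f) \<in> Mor C ?A ?B"
      "mmap F ?A ?B (lift ?A ?B (gm (omap F A) (omap F B) ?f)) = gm (omap F A) (omap F B) ?f"
      by (rule lift[OF O(1,2) gm[OF O(3,4) Ff]])+
    have "Comp D (omap F A) (omap F ?A) (omap F ?B) (gm (omap F A) (omap F B) ?f) (e' (omap F A))
        = Comp D (omap F A) (omap F B) (omap F ?B) (e' (omap F B))
          (Comp D (omap F A) (omap F ?A) (omap F B)
            (Comp D (omap F ?A) (omap F A) (omap F B) ?f (e (omap F A))) (e' (omap F A)))"
      unfolding gm_def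
      using D.Comp_assoc[OF O(3,5,4,6) e' D.Comp_in_Mor[OF O(5,3,4) eM Ff] e'] O by simp
    also have "\<dots> = Comp D (omap F A) (omap F B) (omap F ?B) (e' (omap F B)) ?f"
      using D.Comp_assoc[OF O(3,5,3,4) e' eM Ff] O ee' D.Comp_Idn_right Ff by simp
    finally show "Comp C A B ?B (\<eta> B) f =
       Comp C A ?A ?B (lift ?A ?B (gm (omap F A) (omap F B) ?f)) (\<eta> A)"
      using eqI[OF A(1) O(2) C.Comp_in_Mor[OF A O(2) f \<eta>(1)[OF A(2)]]
          C.Comp_in_Mor[OF A(1) O(1,2) \<eta>(1)[OF A(1)] l(1)]]
      unfolding FC[OF A O(2) f \<eta>(1)[OF A(2)]] FC[OF A(1) O(1,2) \<eta>(1)[OF A(1)] l(1)]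
        l(2) \<eta>(2)[OF A(1)] \<eta>(2)[OF A(2)] by simp
  qed
  note nat1 = this
  have nat2: "natural_isomorphism D D (comp_functor F G) id_functor e"
    unfolding natural_isomorphism_def id_functor_def comp_functor_def G_def cat_map.simps
  proof (intro conjI ballI)
    fix A B h assume A: "A \<in> Obj D" "B \<in> Obj D" "h \<in> Mor D A B"
    show "Comp D (omap F (g0 A)) (omap F (g0 B)) B (e B)
        (mmap F (g0 A) (g0 B) (lift (g0 A) (g0 B) (gm A B h))) = Comp D (omap F (g0 A)) A B h (e A)"
      unfolding lift(2)[OF g0[OF A(1)] g0[OF A(2)] gm[OF A]] by (rule e_gm[OF A])
  qed (rule e)
  show ?thesis
    unfolding equivalent_categories_def
    by (intro conjI exI) (rule catC catD F G nat1 nat2)+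
qed

unbundle cardinal_syntax

section \<open>Coordinate vectors\<close>

type_synonym coords = "nat \<Rightarrow> complex"

definition scl :: "complex \<Rightarrow> coords \<Rightarrow> coords" where
  "scl c x = (\<lambda>i. c * x i)"

lemma scl_apply: "scl c x i = c * x i"
  by (simp add: scl_def)

text \<open>Sums and differences of functions should stay vector expressions under simplification;
  they are evaluated pointwise only on request, through \<open>coords_apply\<close>.\<close>

declare plus_fun_apply [simp del] zero_fun_apply [simp del] fun_diff_def [simp del]

lemma fun_minus_apply: "(- f) x = - f x" for f :: "'i \<Rightarrow> 'c::uminus"
  by (simp add: fun_Compl_def)

lemmas coords_apply = plus_fun_apply zero_fun_apply fun_minus_apply minus_apply scl_apply

interpretation cs: vector_space scl
  by unfold_locales (auto simp: fun_eq_iff coords_apply algebra_simps)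

abbreviation lin :: "(coords \<Rightarrow> coords) \<Rightarrow> bool" where
  "lin \<equiv> Vector_Spaces.linear scl scl"

lemma linI:
  assumes "\<And>x y. f (x + y) = f x + f y" "\<And>c x. f (scl c x) = scl c (f x)"
  shows "lin f"
  using assms by (simp add: Vector_Spaces.linear_iff cs.vector_space_axioms)

lemma lin_add: "lin f \<Longrightarrow> f (x + y) = f x + f y"
  and lin_scale: "lin f \<Longrightarrow> f (scl c x) = scl c (f x)"
  by (simp_all add: Vector_Spaces.linear_iff)

lemma lin_zero: "lin f \<Longrightarrow> f 0 = 0"
  using lin_scale[of f 0 0] by simp

lemma lin_neg: "lin f \<Longrightarrow> f (- x) = - f x"
  using lin_scale[of f "-1" x] by simp

lemma lin_diff: "lin f \<Longrightarrow> f (x - y) = f x - f y"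
  using lin_add[of f x "- y"] lin_neg[of f y] by simp

lemma lin_sum: "lin f \<Longrightarrow> f (sum g I) = (\<Sum>i\<in>I. f (g i))"
  by (induction I rule: infinite_finite_induct) (auto simp: lin_zero lin_add)

lemma lin_pow: "lin f \<Longrightarrow> lin (f ^^ k)"
  by (induction k) (auto intro!: linI simp: lin_add lin_scale)

text \<open>Applying T minus the eigenvalue \<open>\<mu> j\<close> to the relation removes the term
  \<open>j\<close> and multiplies every other term by a nonzero number, which leaves a shorter
  relation.\<close>

lemma eigen_indep:
  assumes T: "lin T" and "finite I" "inj_on \<mu> I" "\<And>i. i \<in> I \<Longrightarrow> T (v i) = scl (\<mu> i) (v i)"
    and "(\<Sum>i\<in>I. v i) = 0"
  shows "\<forall>i\<in>I. v i = 0"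
  using assms(2-)
proof (induction I arbitrary: v rule: finite_induct)
  case (insert j I)
  define w where "w i = scl (\<mu> i - \<mu> j) (v i)" for i
  have Tv: "T (\<Sum>i\<in>insert j I. v i) = (\<Sum>i\<in>insert j I. scl (\<mu> i) (v i))"
    unfolding lin_sum[OF T] by (rule sum.cong) (use insert.prems(2) in auto)
  have "(\<Sum>i\<in>insert j I. w i) = T (\<Sum>i\<in>insert j I. v i) - scl (\<mu> j) (\<Sum>i\<in>insert j I. v i)"
    unfolding Tv by (simp only: w_def cs.scale_left_diff_distrib sum_subtractf cs.scale_sum_right)
  also have "\<dots> = 0" using insert.prems(3) by (simp add: lin_zero[OF T])
  finally have "(\<Sum>i\<in>I. w i) = 0" using insert.hyps by (simp add: w_def)
  then have "\<forall>i\<in>I. w i = 0"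
    by (intro insert.IH) (use insert.prems in \<open>auto simp: w_def lin_scale[OF T] mult.commute\<close>)
  then have I: "\<forall>i\<in>I. v i = 0"
    using insert.hyps insert.prems(1) by (auto simp: w_def cs.scale_eq_0_iff image_iff) metis
  then show ?case using insert.prems(3) insert.hyps by simp
qed simp

section \<open>Finite dimensional subspaces\<close>

definition coord_space :: "nat \<Rightarrow> coords set" where
  "coord_space d = {x. \<forall>i\<ge>d. x i = 0}"

text \<open>Bounded support implies finite dimension and places every such space in the single set
  \<open>bounded_coords\<close>. That set is a countable union of finite powers of the complex
  numbers, so it injects into any type that receives the complex numbers.\<close>

definition fd_space :: "coords set \<Rightarrow> bool" where
  "fd_space S \<longleftrightarrow> cs.subspace S \<and> (\<exists>d. S \<subseteq> coord_space d)"

lemma subspace_coord_space: "cs.subspace (coord_space d)"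
  by (auto simp: cs.subspace_def coord_space_def coords_apply)

lemma fd_coord_space: "fd_space (coord_space d)"
  using subspace_coord_space by (auto simp: fd_space_def)

definition unit :: "nat \<Rightarrow> coords" where
  "unit i = (\<lambda>j. if j = i then 1 else 0)"

lemma sum_fun_apply: "(sum f I) x = (\<Sum>i\<in>I. f i x)"
  by (induction I rule: infinite_finite_induct) (auto simp: coords_apply)

lemma unit_sum: "x \<in> coord_space d \<Longrightarrow> x = (\<Sum>i<d. scl (x i) (unit i))"
  by (auto simp: fun_eq_iff sum_fun_apply coords_apply unit_def coord_space_def if_distrib cong:
    if_cong)

lemma coord_space_span: "coord_space d = cs.span (unit ` {..<d})"
proof
  show "coord_space d \<subseteq> cs.span (unit ` {..<d})"
  proof
    fix x assume "x \<in> coord_space d"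
    then have "x = (\<Sum>i<d. scl (x i) (unit i))" by (rule unit_sum)
    also have "\<dots> \<in> cs.span (unit ` {..<d})"
      by (intro cs.span_sum cs.span_scale cs.span_base) auto
    finally show "x \<in> cs.span (unit ` {..<d})" .
  qed
  show "cs.span (unit ` {..<d}) \<subseteq> coord_space d"
    by (rule cs.span_minimal[OF _ subspace_coord_space]) (auto simp: coord_space_def unit_def)
qed

text \<open>A maximal independent subset is finite because it lies in the span of finitely many unit
  vectors.\<close>

lemma fd_space_basis:
  assumes "fd_space S"
  obtains B where "finite B" "B \<subseteq> S" "S = cs.span B"
proof -
  obtain d where S: "cs.subspace S" "S \<subseteq> coord_space d" using assms by (auto simp: fd_space_def)
  obtain B where B: "B \<subseteq> S" "cs.independent B" "S \<subseteq> cs.span B"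
    using cs.maximal_independent_subset by blast
  have "finite B"
    using cs.independent_span_bound[of "unit ` {..<d}" B] B S unfolding coord_space_span by auto
  moreover have "S = cs.span B" using B S(1) cs.span_minimal by blast
  ultimately show ?thesis using that B by blast
qed

definition bounded_coords :: "coords set" where
  "bounded_coords = (\<Union>d. coord_space d)"

lemma fd_space_bounded: "fd_space S \<Longrightarrow> S \<subseteq> bounded_coords"
  by (auto simp: fd_space_def bounded_coords_def)

lemma coords_injection:
  assumes "\<exists>f :: complex \<Rightarrow> 'b. inj f"
  obtains h :: "coords \<Rightarrow> 'b" where "inj_on h bounded_coords"
proof -
  have inf: "infinite (UNIV :: complex set)" by (rule infinite_UNIV_char_0)
  have 1: "|coord_space d| \<le>o |UNIV :: complex set|" for d
  proof (induction d)
    case 0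
    have "coord_space 0 = {0}" by (auto simp: coord_space_def fun_eq_iff coords_apply)
    moreover have "|{0 :: coords}| \<le>o |UNIV :: complex set|"
      by (rule card_of_ordLeqI[of "\<lambda>_. 0"]) auto
    ultimately show ?case by simp
  next
    case (Suc d)
    \<comment> \<open>Splitting off coordinate \<open>d\<close> embeds the space into a product with
      the complex numbers, and an infinite set has the cardinality of its square.\<close>
    have "|coord_space (Suc d)| \<le>o |coord_space d \<times> (UNIV :: complex set)|"
    proof (rule card_of_ordLeqI[of "\<lambda>x. (x(d := 0), x d)"])
      show "inj_on (\<lambda>x. (x(d := 0), x d)) (coord_space (Suc d))"
      proof (rule inj_onI)
        fix x y :: coords assume a: "(x(d := 0), x d) = (y(d := 0), y d)"
        show "x = y"
        proof
          fix i show "x i = y i" using a by (cases "i = d") (auto dest: fun_cong[of _ _ i])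
        qed
      qed
    qed (auto simp: coord_space_def)
    also have "|coord_space d \<times> (UNIV :: complex set)| \<le>o |(UNIV :: complex set) \<times> (UNIV ::
      complex set)|"
      by (rule card_of_Times_mono1[OF Suc])
    also have "|(UNIV :: complex set) \<times> (UNIV :: complex set)| =o |UNIV :: complex set|"
      by (rule card_of_Times_same_infinite[OF inf])
    finally show ?case .
  qed
  have "|bounded_coords| \<le>o |UNIV :: complex set|"
    unfolding bounded_coords_def
  proof (rule card_of_UNION_ordLeq_infinite[OF inf])
    show "|UNIV :: nat set| \<le>o |UNIV :: complex set|"
      by (rule card_of_ordLeqI[of of_nat]) (auto simp: inj_on_def)
  qed (use 1 in auto)
  then obtain g :: "coords \<Rightarrow> complex" where g: "inj_on g bounded_coords"
    unfolding card_of_ordLeq[symmetric] by auto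
  obtain f :: "complex \<Rightarrow> 'b" where "inj f" using assms by blast
  then have "inj_on (f \<circ> g) bounded_coords"
    using g by (intro comp_inj_on) (auto intro: inj_on_subset)
  then show ?thesis by (rule that)
qed

section \<open>Vector spaces over the complex field in coordinates\<close>

lemma complex_field_simps [simp]:
  "carrier complex_field = UNIV" "x \<oplus>\<^bsub>complex_field\<^esub> y = x + y" "x \<otimes>\<^bsub>complex_field\<^esub> y = x * y"
  "\<one>\<^bsub>complex_field\<^esub> = 1" "\<zero>\<^bsub>complex_field\<^esub> = 0"
  by (simp_all add: ring_of_type_algebra_def)

text \<open>\<open>V\<close> is not assumed to be a group, so the image of zero has to be
  prescribed; the axioms of a vector space are then transported along \<open>\<psi>\<close>.\<close>

definition vec_iso :: "coords set \<Rightarrow> (complex, 'a, 'm) module_scheme \<Rightarrow> (coords \<Rightarrow> 'a) \<Rightarrow> bool" where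
  "vec_iso S V \<psi> \<longleftrightarrow> bij_betw \<psi> S (carrier V) \<and> \<psi> 0 = \<zero>\<^bsub>V\<^esub> \<and>
     (\<forall>x\<in>S. \<forall>y\<in>S. \<psi> (x + y) = \<psi> x \<oplus>\<^bsub>V\<^esub> \<psi> y) \<and>
     (\<forall>c. \<forall>x\<in>S. \<psi> (scl c x) = c \<odot>\<^bsub>V\<^esub> \<psi> x)"

text \<open>This concerns the additive structure alone, so that it serves complex vector spaces and
  modules over the quantum algebra alike.\<close>

lemma abelian_group_transport:
  fixes V :: "('a, 'm) ring_scheme"
  assumes S: "cs.subspace S" and bij: "bij_betw \<psi> S (carrier V)" and z: "\<psi> 0 = \<zero>\<^bsub>V\<^esub>"
    and add: "\<And>x y. \<lbrakk>x \<in> S; y \<in> S\<rbrakk> \<Longrightarrow> \<psi> (x + y) = \<psi> x \<oplus>\<^bsub>V\<^esub> \<psi> y"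
  shows "abelian_group V"
proof (rule abelian_groupI)
  have im: "carrier V = \<psi> ` S" using bij by (simp add: bij_betw_def)
  note Sa = cs.subspace_add[OF S] and S0 = cs.subspace_0[OF S]
  show "\<zero>\<^bsub>V\<^esub> \<in> carrier V" unfolding z[symmetric] im using S0 by (rule imageI)
  fix x y w assume "x \<in> carrier V" "y \<in> carrier V" "w \<in> carrier V"
  then obtain x' y' w' where *: "x' \<in> S" "y' \<in> S" "w' \<in> S" "x = \<psi> x'" "y = \<psi> y'" "w = \<psi> w'"
    unfolding im by blast
  show "x \<oplus>\<^bsub>V\<^esub> y \<in> carrier V" using * Sa add im by (metis image_eqI)
  show "(x \<oplus>\<^bsub>V\<^esub> y) \<oplus>\<^bsub>V\<^esub> w = x \<oplus>\<^bsub>V\<^esub> (y \<oplus>\<^bsub>V\<^esub> w)" using * Sa add by (metis add.assoc)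
  show "x \<oplus>\<^bsub>V\<^esub> y = y \<oplus>\<^bsub>V\<^esub> x" using * add by (metis add.commute)
  show "\<zero>\<^bsub>V\<^esub> \<oplus>\<^bsub>V\<^esub> x = x" using * add[OF S0] z by (metis add_0)
  have "- x' \<in> S" using cs.subspace_neg[OF S] * by blast
  then have "\<psi> (- x') \<in> carrier V" "\<psi> (- x') \<oplus>\<^bsub>V\<^esub> x = \<zero>\<^bsub>V\<^esub>"
    using im * add[of "- x'" x'] z by auto
  then show "\<exists>y\<in>carrier V. y \<oplus>\<^bsub>V\<^esub> x = \<zero>\<^bsub>V\<^esub>" by blast
qed

lemma vec_iso_abelian_group:
  fixes V :: "(complex, 'a, 'm) module_scheme"
  assumes "cs.subspace S" "vec_iso S V \<psi>"
  shows "abelian_group V"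
  using assms unfolding vec_iso_def by (intro abelian_group_transport[of S \<psi> V]) auto

lemma vec_iso_module:
  fixes V :: "(complex, 'a, 'm) module_scheme"
  assumes S: "cs.subspace S" and iso: "vec_iso S V \<psi>"
  shows "Module.module complex_field V"
proof (rule Module.moduleI)
  show "abelian_group V" by (rule vec_iso_abelian_group[OF assms])
  show "cring complex_field" by (rule cring_from_type_algebra)
  have im: "carrier V = \<psi> ` S" and add: "\<And>x y. \<lbrakk>x \<in> S; y \<in> S\<rbrakk> \<Longrightarrow> \<psi> x \<oplus>\<^bsub>V\<^esub> \<psi> y = \<psi> (x + y)"
    and sc: "\<And>c x. x \<in> S \<Longrightarrow> c \<odot>\<^bsub>V\<^esub> \<psi> x = \<psi> (scl c x)"
    using iso by (auto simp: vec_iso_def bij_betw_def)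
  note Sa = cs.subspace_add[OF S] and Ss = cs.subspace_scale[OF S]
  fix a b x y assume "x \<in> carrier V" "y \<in> carrier V"
  then obtain x' y' where *: "x' \<in> S" "y' \<in> S" "x = \<psi> x'" "y = \<psi> y'"
    unfolding im by blast
  show "a \<odot>\<^bsub>V\<^esub> x \<in> carrier V" using * Ss by (auto simp: sc im)
  show "(a \<oplus>\<^bsub>complex_field\<^esub> b) \<odot>\<^bsub>V\<^esub> x = a \<odot>\<^bsub>V\<^esub> x \<oplus>\<^bsub>V\<^esub> b \<odot>\<^bsub>V\<^esub> x"
    using * Ss by (simp add: sc add cs.scale_left_distrib)
  show "a \<odot>\<^bsub>V\<^esub> (x \<oplus>\<^bsub>V\<^esub> y) = a \<odot>\<^bsub>V\<^esub> x \<oplus>\<^bsub>V\<^esub> a \<odot>\<^bsub>V\<^esub> y"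
    using * Ss Sa by (simp add: sc add cs.scale_right_distrib)
  show "(a \<otimes>\<^bsub>complex_field\<^esub> b) \<odot>\<^bsub>V\<^esub> x = a \<odot>\<^bsub>V\<^esub> (b \<odot>\<^bsub>V\<^esub> x)"
    using * Ss by (simp add: sc)
  show "\<one>\<^bsub>complex_field\<^esub> \<odot>\<^bsub>V\<^esub> x = x"
    using * by (simp add: sc)
qed

lemma vec_iso_finsum:
  fixes V :: "('a, 'm) ring_scheme"
  assumes V: "abelian_group V" and S: "cs.subspace S"
    and z: "\<psi> 0 = \<zero>\<^bsub>V\<^esub>" and im: "\<psi> ` S \<subseteq> carrier V"
    and add: "\<And>x y. \<lbrakk>x \<in> S; y \<in> S\<rbrakk> \<Longrightarrow> \<psi> (x + y) = \<psi> x \<oplus>\<^bsub>V\<^esub> \<psi> y"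
    and "finite I" "\<And>i. i \<in> I \<Longrightarrow> f i \<in> S"
  shows "\<psi> (\<Sum>i\<in>I. f i) = finsum V (\<lambda>i. \<psi> (f i)) I"
proof -
  interpret V: abelian_group V by (rule V)
  show ?thesis using assms(6,7)
  proof (induction I rule: finite_induct)
    case (insert i I)
    have "sum f I \<in> S" by (rule cs.subspace_sum[OF S]) (use insert in auto)
    moreover have "finsum V (\<lambda>i. \<psi> (f i)) (insert i I) = \<psi> (f i) \<oplus>\<^bsub>V\<^esub> finsum V (\<lambda>i. \<psi> (f i)) I"
      by (rule V.finsum_insert) (use insert im in auto)
    ultimately show ?case using insert add by simp
  qed (simp add: z)
qed

lemma vec_iso_finite_dim:
  fixes V :: "(complex, 'a, 'm) module_scheme"
  assumes S: "fd_space S" and iso: "vec_iso S V \<psi>"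
  shows "finite_dim V"
proof -
  have sub: "cs.subspace S" using S by (simp add: fd_space_def)
  obtain B where B: "finite B" "B \<subseteq> S" "S = cs.span B" by (rule fd_space_basis[OF S])
  have bij: "bij_betw \<psi> S (carrier V)" using iso by (simp add: vec_iso_def)
  interpret V: abelian_group V by (rule vec_iso_abelian_group[OF sub iso])
  show ?thesis unfolding finite_dim_def
  proof (intro exI[of _ "\<psi> ` B"] conjI ballI)
    show "finite (\<psi> ` B)" using B by simp
    show BV: "\<psi> ` B \<subseteq> carrier V" using B bij by (auto simp: bij_betw_def)
    have injB: "inj_on \<psi> B" using B(2) bij by (auto simp: bij_betw_def intro: inj_on_subset)
    fix v assume "v \<in> carrier V"
    then obtain x where x: "x \<in> S" "v = \<psi> x" using bij by (auto simp: bij_betw_def)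
    obtain c where c: "x = (\<Sum>b\<in>B. scl (c b) b)"
      using x(1) unfolding B(3) cs.span_finite[OF B(1)] by auto
    have \<psi>B: "\<psi> (scl (c b) b) = c b \<odot>\<^bsub>V\<^esub> \<psi> b" "\<psi> (scl (c b) b) \<in> carrier V" if "b \<in> B" for b
    proof -
      have "b \<in> S" "scl (c b) b \<in> S" using that B(2) cs.subspace_scale[OF sub] by auto
      then show "\<psi> (scl (c b) b) = c b \<odot>\<^bsub>V\<^esub> \<psi> b" "\<psi> (scl (c b) b) \<in> carrier V"
        using iso unfolding vec_iso_def bij_betw_def by (blast, metis imageI)
    qed
    have "v = finsum V (\<lambda>b. \<psi> (scl (c b) b)) B"
      unfolding x(2) c
    proof (rule vec_iso_finsum[OF V.abelian_group_axioms sub])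
      show "\<psi> 0 = \<zero>\<^bsub>V\<^esub>" "\<psi> ` S \<subseteq> carrier V"
        "\<And>x y. \<lbrakk>x \<in> S; y \<in> S\<rbrakk> \<Longrightarrow> \<psi> (x + y) = \<psi> x \<oplus>\<^bsub>V\<^esub> \<psi> y"
        using iso unfolding vec_iso_def bij_betw_def by blast+
      show "scl (c b) b \<in> S" if "b \<in> B" for b
        using that B(2) cs.subspace_scale[OF sub] by blast
    qed (rule B(1))
    \<comment> \<open>The coefficients are indexed by \<open>b\<close> but have to be indexed by the
      image of \<open>b\<close>; injectivity of \<open>\<psi>\<close> on \<open>B\<close> allows the
      change.\<close>
    also have "\<dots> = finsum V (\<lambda>b. c (inv_into B \<psi> (\<psi> b)) \<odot>\<^bsub>V\<^esub> \<psi> b) B"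
      by (rule V.finsum_cong') (use \<psi>B injB in \<open>auto simp: inv_into_f_f\<close>)
    also have "\<dots> = finsum V (\<lambda>s. c (inv_into B \<psi> s) \<odot>\<^bsub>V\<^esub> s) (\<psi> ` B)"
      by (rule V.finsum_reindex[OF _ injB, symmetric])
        (use \<psi>B injB in \<open>auto simp: inv_into_f_f\<close>)
    finally show "\<exists>c. v = finsum V (\<lambda>s. c s \<odot>\<^bsub>V\<^esub> s) (\<psi> ` B)" by (intro exI)
  qed
qed

text \<open>\<open>\<psi>\<close> is linear on all coordinate vectors, not only on
  \<open>coord_space d\<close>. An operator conjugated by \<open>\<phi>\<close> and
  \<open>\<psi>\<close> is then linear on the whole space, as the models below require.\<close>

definition coordinates ::
    "(complex, 'a, 'm) module_scheme \<Rightarrow> nat \<Rightarrow> ('a \<Rightarrow> coords) \<Rightarrow> (coords \<Rightarrow> 'a) \<Rightarrow> bool" where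
  "coordinates V d \<phi> \<psi> \<longleftrightarrow>
     (\<forall>x. \<psi> x \<in> carrier V) \<and> (\<forall>x y. \<psi> (x + y) = \<psi> x \<oplus>\<^bsub>V\<^esub> \<psi> y) \<and>
     (\<forall>c x. \<psi> (scl c x) = c \<odot>\<^bsub>V\<^esub> \<psi> x) \<and>
     (\<forall>v\<in>carrier V. \<phi> v \<in> coord_space d \<and> \<psi> (\<phi> v) = v) \<and> (\<forall>x\<in>coord_space d. \<phi> (\<psi> x) = x)"

text \<open>A spanning family of least size is linearly independent, and its coefficients serve as
  coordinates. The family is indexed by \<open>T\<close> because at a vertex of a quiver it consists
  of components of vectors of the direct sum, and these may coincide.\<close>

lemma coordinates_exist:
  fixes V :: "(complex, 'a, 'm) module_scheme"
  assumes V: "Module.module complex_field V" and T: "finite T" "g \<in> T \<rightarrow> carrier V"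
    and span: "\<And>v. v \<in> carrier V \<Longrightarrow> \<exists>c. v = finsum V (\<lambda>t. c t \<odot>\<^bsub>V\<^esub> g t) T"
  shows "\<exists>d \<phi> \<psi>. coordinates V d \<phi> \<psi>"
proof -
  interpret V: Module.module complex_field V by (rule V)
  define L where "L S c = finsum V (\<lambda>t. c t \<odot>\<^bsub>V\<^esub> g t) S" for S c
  define spans where "spans S \<longleftrightarrow> S \<subseteq> T \<and> (\<forall>v\<in>carrier V. \<exists>c. v = L S c)" for S
  have "spans T" using span by (auto simp: spans_def L_def)
  then obtain S where S: "spans S" and min: "\<And>S'. spans S' \<Longrightarrow> card S \<le> card S'"
    using ex_has_least_nat[of spans T card] by blast
  have gS: "\<And>t. t \<in> S \<Longrightarrow> g t \<in> carrier V" and fin: "finite S"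
    using S T finite_subset by (auto simp: spans_def)
  have Lc: "L S c \<in> carrier V" for c
    unfolding L_def by (rule V.finsum_closed) (use gS in auto)
  have Ladd: "L S (\<lambda>t. c t + d t) = L S c \<oplus>\<^bsub>V\<^esub> L S d" for c d
  proof -
    have "L S (\<lambda>t. c t + d t) = finsum V (\<lambda>t. c t \<odot>\<^bsub>V\<^esub> g t \<oplus>\<^bsub>V\<^esub> d t \<odot>\<^bsub>V\<^esub> g t) S"
      unfolding L_def by (rule V.finsum_cong') (use gS V.smult_l_distr in auto)
    then show ?thesis unfolding L_def by (subst (asm) V.finsum_addf) (use gS in auto)
  qed
  have Lscale: "L S (\<lambda>t. k * c t) = k \<odot>\<^bsub>V\<^esub> L S c" for c k
  proof -
    have "L S (\<lambda>t. k * c t) = finsum V (\<lambda>t. k \<odot>\<^bsub>V\<^esub> (c t \<odot>\<^bsub>V\<^esub> g t)) S"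
      unfolding L_def by (rule V.finsum_cong') (use gS V.smult_assoc1 in auto)
    then show ?thesis unfolding L_def by (subst V.finsum_smult_ldistr) (use gS fin in auto)
  qed
  have indep: "c t = 0" if c: "L S c = \<zero>\<^bsub>V\<^esub>" and t: "t \<in> S" for c t
  proof (rule ccontr)
    assume nz: "c t \<noteq> 0"
    have "spans (S - {t})" unfolding spans_def
    proof (intro conjI ballI)
      show "S - {t} \<subseteq> T" using S by (auto simp: spans_def)
      fix v assume "v \<in> carrier V"
      then obtain d where d: "v = L S d" using S by (auto simp: spans_def)
      \<comment> \<open>Subtracting this multiple of the relation cancels the coefficient at
        \<open>t\<close>, so \<open>t\<close> could be dropped, against minimality.\<close>
      define e where "e s = d s + (- d t / c t) * c s" for s
      have "v = L S e"
        unfolding e_def Ladd Lscale c d using Lc by simp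
      also have "\<dots> = L (S - {t}) e"
      proof -
        have "e t = 0" using nz by (simp add: e_def)
        moreover have "L S e = e t \<odot>\<^bsub>V\<^esub> g t \<oplus>\<^bsub>V\<^esub> L (S - {t}) e"
          unfolding L_def using V.finsum_insert[of "S - {t}" t "\<lambda>t. e t \<odot>\<^bsub>V\<^esub> g t"] t fin gS
          by (auto simp: insert_absorb)
        moreover have "L (S - {t}) e \<in> carrier V"
          unfolding L_def by (rule V.finsum_closed) (use gS in auto)
        moreover have "0 \<odot>\<^bsub>V\<^esub> g t = \<zero>\<^bsub>V\<^esub>"
          using V.smult_l_null[OF gS[OF t]] by simp
        ultimately show ?thesis by simp
      qed
      finally show "\<exists>c. v = L (S - {t}) c" by blast
    qed
    then show False using min fin t by (meson card_Diff1_less not_less)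
  qed
  define d where "d = card S"
  obtain idx where idx: "bij_betw idx S {..<d}"
    using ex_bij_betw_finite_nat[OF fin] by (auto simp: d_def atLeast0LessThan)
  define \<psi> where "\<psi> x = L S (\<lambda>t. x (idx t))" for x
  define co where "co v = (SOME c. v = L S c)" for v
  define \<phi> where "\<phi> v = (\<lambda>i. if i < d then co v (inv_into S idx i) else 0)" for v
  have co: "L S (co v) = v" if "v \<in> carrier V" for v
    using S that unfolding co_def spans_def by (metis (mono_tags, lifting) someI_ex)
  have Lcong: "L S c = L S c'" if "\<And>t. t \<in> S \<Longrightarrow> c t = c' t" for c c'
    unfolding L_def by (rule V.finsum_cong') (use that gS in auto)
  have \<psi>\<phi>: "\<psi> (\<phi> v) = v" if "v \<in> carrier V" for v
  proof -
    have "\<psi> (\<phi> v) = L S (co v)" unfolding \<psi>_def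
      by (rule Lcong) (use idx in \<open>auto simp: \<phi>_def bij_betw_def\<close>)
    then show ?thesis using co that by simp
  qed
  have \<phi>\<psi>: "\<phi> (\<psi> x) = x" if "x \<in> coord_space d" for x
  proof
    fix i
    \<comment> \<open>The chosen and the given coefficients represent the same vector, so their
      difference is a relation and vanishes.\<close>
    have "L S (\<lambda>t. co (\<psi> x) t + (- 1) * x (idx t)) = \<zero>\<^bsub>V\<^esub>"
    proof -
      have \<psi>x: "\<psi> x \<in> carrier V" by (simp add: \<psi>_def Lc)
      have "L S (\<lambda>t. co (\<psi> x) t + (- 1) * x (idx t)) = \<psi> x \<oplus>\<^bsub>V\<^esub> (- 1) \<odot>\<^bsub>V\<^esub> \<psi> x"
        unfolding Ladd Lscale co[OF \<psi>x] by (simp only: \<psi>_def)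
      also have "\<dots> = (1 + - 1) \<odot>\<^bsub>V\<^esub> \<psi> x"
        using V.smult_l_distr[of 1 "-1" "\<psi> x"] V.smult_one[OF \<psi>x] \<psi>x by simp
      also have "\<dots> = \<zero>\<^bsub>V\<^esub>" using V.smult_l_null[OF \<psi>x] by simp
      finally show ?thesis .
    qed
    from indep[OF this] have co_eq: "co (\<psi> x) t = x (idx t)" if "t \<in> S" for t
      using that by simp
    have "inv_into S idx i \<in> S" "idx (inv_into S idx i) = i" if "i < d"
      using idx that unfolding bij_betw_def
      by (metis inv_into_into lessThan_iff, metis f_inv_into_f lessThan_iff)
    then show "\<phi> (\<psi> x) i = x i"
      using that co_eq by (auto simp: \<phi>_def coord_space_def)
  qed
  have "coordinates V d \<phi> \<psi>" unfolding coordinates_def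
  proof (intro conjI allI ballI)
    show "\<psi> x \<in> carrier V" for x by (simp add: \<psi>_def Lc)
    show "\<psi> (x + y) = \<psi> x \<oplus>\<^bsub>V\<^esub> \<psi> y" for x y by (simp add: \<psi>_def Ladd coords_apply)
    show "\<psi> (scl c x) = c \<odot>\<^bsub>V\<^esub> \<psi> x" for c x by (simp add: \<psi>_def Lscale coords_apply)
    show "\<phi> v \<in> coord_space d" for v by (simp add: \<phi>_def coord_space_def)
  qed (use \<psi>\<phi> \<phi>\<psi> in auto)
  then show ?thesis by blast
qed

lemma coordinates_add:
  assumes "coordinates V d \<phi> \<psi>" "u \<in> carrier V" "v \<in> carrier V"
  shows "\<phi> (u \<oplus>\<^bsub>V\<^esub> v) = \<phi> u + \<phi> v"
proof -
  have "\<phi> u + \<phi> v \<in> coord_space d"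
    using assms cs.subspace_add[OF subspace_coord_space] unfolding coordinates_def by blast
  then have "\<phi> (\<psi> (\<phi> u + \<phi> v)) = \<phi> u + \<phi> v" using assms unfolding coordinates_def by blast
  moreover have "\<psi> (\<phi> u + \<phi> v) = u \<oplus>\<^bsub>V\<^esub> v" using assms unfolding coordinates_def by simp
  ultimately show ?thesis by simp
qed

lemma coordinates_scale:
  assumes "coordinates V d \<phi> \<psi>" "v \<in> carrier V"
  shows "\<phi> (c \<odot>\<^bsub>V\<^esub> v) = scl c (\<phi> v)"
proof -
  have "scl c (\<phi> v) \<in> coord_space d"
    using assms cs.subspace_scale[OF subspace_coord_space] unfolding coordinates_def by blast
  then have "\<phi> (\<psi> (scl c (\<phi> v))) = scl c (\<phi> v)" using assms unfolding coordinates_def by blast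
  moreover have "\<psi> (scl c (\<phi> v)) = c \<odot>\<^bsub>V\<^esub> v" using assms unfolding coordinates_def by simp
  ultimately show ?thesis by simp
qed

lemma coordinates_vec_iso:
  assumes "coordinates V d \<phi> \<psi>" "Module.module complex_field V"
  shows "vec_iso (coord_space d) V \<psi>"
proof -
  interpret V: Module.module complex_field V by (rule assms)
  have "\<psi> 0 = \<psi> (scl 0 0)" by simp
  also have "\<dots> = 0 \<odot>\<^bsub>V\<^esub> \<psi> 0" using assms(1) unfolding coordinates_def by blast
  also have "\<dots> = \<zero>\<^bsub>V\<^esub>" using V.smult_l_null[of "\<psi> 0"] assms(1) by (simp add: coordinates_def)
  finally have "\<psi> 0 = \<zero>\<^bsub>V\<^esub>" .
  moreover have "bij_betw \<psi> (coord_space d) (carrier V)"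
    by (rule bij_betw_byWitness[of _ \<phi>]) (use assms in \<open>auto simp: coordinates_def\<close>)
  ultimately show ?thesis using assms(1) by (simp add: vec_iso_def coordinates_def)
qed

section \<open>The action of the free algebra\<close>

lemma poly_mapping_sum_single: "p = (\<Sum>w\<in>Poly_Mapping.keys p. Poly_Mapping.single w
  (Poly_Mapping.lookup p w))"
proof (rule poly_mapping_eqI)
  fix k
  show "Poly_Mapping.lookup p k =
    Poly_Mapping.lookup (\<Sum>w\<in>Poly_Mapping.keys p. Poly_Mapping.single w (Poly_Mapping.lookup p w)) k"
    by (auto simp: lookup_sum lookup_single when_def in_keys_iff)
qed

lemma single_Word_Cons:
  "Poly_Mapping.single (Word (g # gs)) c = gen g * Poly_Mapping.single (Word gs) c"
  by (simp add: gen_def mult_single)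

text \<open>A word is a product of generators and an element is a finite sum of scaled words; the
  empty word and the empty sum are constants.\<close>

lemma uq_free_induct [case_names const gen add mult]:
  assumes c: "\<And>c. P (const c)" and g: "\<And>g. P (gen g)"
    and add: "\<And>p p'. \<lbrakk>P p; P p'\<rbrakk> \<Longrightarrow> P (p + p')" and mult: "\<And>p p'. \<lbrakk>P p; P p'\<rbrakk> \<Longrightarrow> P (p * p')"
  shows "P p"
proof -
  have single: "P (Poly_Mapping.single (Word gs) c)" for gs c
  proof (induction gs)
    case Nil
    then show ?case using c[of c] by (simp add: const_def zero_word_def)
  next
    case (Cons a gs)
    then show ?case by (simp add: single_Word_Cons g mult)
  qed
  have "P (\<Sum>w\<in>W. Poly_Mapping.single w (Poly_Mapping.lookup p w))" if "finite W" for W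
    using that
  proof (induction W rule: finite_induct)
    case empty
    then show ?case using c[of 0] by (simp add: const_def)
  next
    case (insert w W)
    then show ?case using single by (cases w) (simp add: add)
  qed
  then show ?thesis by (subst poly_mapping_sum_single) simp
qed

fun word_act :: "(uq_gen \<Rightarrow> coords \<Rightarrow> coords) \<Rightarrow> uq_gen word \<Rightarrow> coords \<Rightarrow> coords" where
  "word_act op (Word gs) x = foldr op gs x"

definition act :: "(uq_gen \<Rightarrow> coords \<Rightarrow> coords) \<Rightarrow> uq_free \<Rightarrow> coords \<Rightarrow> coords" where
  "act op p x = (\<Sum>w\<in>Poly_Mapping.keys p. scl (Poly_Mapping.lookup p w) (word_act op w x))"

lemma act_superset:
  assumes "finite W" "Poly_Mapping.keys p \<subseteq> W"
  shows "act op p x = (\<Sum>w\<in>W. scl (Poly_Mapping.lookup p w) (word_act op w x))"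
  unfolding act_def by (rule sum.mono_neutral_left) (use assms in \<open>auto simp: in_keys_iff\<close>)

lemma act_single: "act op (Poly_Mapping.single w c) x = scl c (word_act op w x)"
  by (subst act_superset[of "{w}"]) auto

lemma act_const [simp]: "act op (const c) x = scl c x"
  by (simp add: const_def act_single zero_word_def)

lemma act_gen [simp]: "act op (gen g) x = op g x"
  by (simp add: gen_def act_single)

lemma act_zero [simp]: "act op 0 x = 0"
  by (simp add: act_def)

lemma act_one [simp]: "act op 1 x = x"
  using act_const[of op 1 x] by (simp add: const_def)

lemma act_add [simp]: "act op (p + p') x = act op p x + act op p' x"
proof -
  let ?W = "Poly_Mapping.keys p \<union> Poly_Mapping.keys p'"
  have "act op (p + p') x = (\<Sum>w\<in>?W. scl (Poly_Mapping.lookup (p + p') w) (word_act op w x))"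
    by (rule act_superset) (use keys_add[of p p'] in auto)
  moreover have "act op p x = (\<Sum>w\<in>?W. scl (Poly_Mapping.lookup p w) (word_act op w x))"
    "act op p' x = (\<Sum>w\<in>?W. scl (Poly_Mapping.lookup p' w) (word_act op w x))"
    by (rule act_superset; auto)+
  ultimately show ?thesis by (simp add: lookup_add cs.scale_left_distrib sum.distrib)
qed

lemma act_uminus [simp]: "act op (- p) x = - act op p x"
  using act_add[of op p "- p" x] by (simp add: eq_neg_iff_add_eq_0 add.commute)

lemma act_diff [simp]: "act op (p - p') x = act op p x - act op p' x"
  using act_add[of op p "- p'" x] by simp

lemma act_sum: "act op (sum f I) x = (\<Sum>i\<in>I. act op (f i) x)"
  by (induction I rule: infinite_finite_induct) auto

lemma lin_word_act: "(\<And>g. lin (op g)) \<Longrightarrow> lin (word_act op w)"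
proof (cases w)
  case (Word gs)
  assume l: "\<And>g. lin (op g)"
  have "lin (foldr op gs)"
  proof (induction gs)
    case (Cons g gs)
    then show ?case using l[of g] by (auto intro!: linI simp: lin_add lin_scale)
  qed (auto intro!: linI)
  moreover have "word_act op w = foldr op gs" using Word by (simp add: fun_eq_iff)
  ultimately show ?thesis by simp
qed

lemma lin_act:
  assumes "\<And>g. lin (op g)"
  shows "lin (act op p)"
proof (rule linI)
  note l = lin_word_act[of op, OF assms]
  show "act op p (x + y) = act op p x + act op p y" for x y
    by (simp add: act_def lin_add[OF l] cs.scale_right_distrib sum.distrib)
  show "act op p (scl c x) = scl c (act op p x)" for c x
    by (simp add: act_def lin_scale[OF l] cs.scale_sum_right mult.commute)
qed

text \<open>The product expands into products of scaled words, where concatenation acts as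
  composition. Linearity of the operators lets the coefficients of \<open>p'\<close> pass through
  the words of \<open>p\<close>.\<close>

lemma act_mult:
  assumes "\<And>g. lin (op g)"
  shows "act op (p * p') x = act op p (act op p' x)"
proof -
  note l = lin_word_act[of op, OF assms] and la = lin_act[of op, OF assms]
  have w: "word_act op (u + v) x = word_act op u (word_act op v x)" for u v x
    by (cases u; cases v) simp
  have 1: "act op (Poly_Mapping.single u c * Poly_Mapping.single v d) x =
      act op (Poly_Mapping.single u c) (act op (Poly_Mapping.single v d) x)" for u c v d
    by (simp add: mult_single act_single w lin_scale[OF l])
  have "p * p' = (\<Sum>u\<in>Poly_Mapping.keys p. \<Sum>v\<in>Poly_Mapping.keys p'.
      Poly_Mapping.single u (Poly_Mapping.lookup p u) * Poly_Mapping.single v (Poly_Mapping.lookup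
        p' v))"
    by (subst (1) poly_mapping_sum_single[of p], subst (1) poly_mapping_sum_single[of p'])
      (rule sum_product)
  then have "act op (p * p') x = (\<Sum>u\<in>Poly_Mapping.keys p. act op (Poly_Mapping.single u
    (Poly_Mapping.lookup p u))
      (\<Sum>v\<in>Poly_Mapping.keys p'. act op (Poly_Mapping.single v (Poly_Mapping.lookup p' v)) x))"
    by (simp only: act_sum 1 lin_sum[OF la])
  also have "\<dots> = act op p (act op p' x)"
    by (simp only: act_sum[symmetric] poly_mapping_sum_single[symmetric])
  finally show ?thesis .
qed

lemma act_closed:
  assumes S: "cs.subspace S" and "\<And>g x. x \<in> S \<Longrightarrow> op g x \<in> S" "x \<in> S" and l: "\<And>g. lin (op g)"
  shows "act op p x \<in> S"
  using assms(3)
proof (induction p arbitrary: x rule: uq_free_induct)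
  case (mult p p')
  then show ?case by (simp add: act_mult[of op, OF l])
qed (use assms cs.subspace_add[OF S] cs.subspace_scale[OF S] in auto)

text \<open>Compatibility with a map is inherited by sums and products, so a homomorphism has to be
  tested on generators only.\<close>

lemma act_commute:
  assumes S: "cs.subspace S" and cl: "\<And>g x. x \<in> S \<Longrightarrow> op g x \<in> S"
    and l: "\<And>g. lin (op g)" "\<And>g. lin (op' g)" and x: "x \<in> S"
    and f: "\<And>x y. \<lbrakk>x \<in> S; y \<in> S\<rbrakk> \<Longrightarrow> f (x + y) = f x + f y" "\<And>c x. x \<in> S \<Longrightarrow> f (scl c x) = scl c (f x)"
      "\<And>g x. x \<in> S \<Longrightarrow> f (op g x) = op' g (f x)"
  shows "f (act op p x) = act op' p (f x)"
  using x
proof (induction p arbitrary: x rule: uq_free_induct)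
  case (add p p')
  then show ?case using f act_closed[OF S cl _ l(1)] by simp
next
  case (mult p p')
  then show ?case
    using act_closed[OF S cl _ l(1)] by (simp add: act_mult[of op, OF l(1)] act_mult[of op', OF
      l(2)])
qed (use f in auto)

section \<open>The algebra as a quotient\<close>

lemma free_simps [simp]:
  "carrier (ring_of_type_algebra :: 'a::ring_1 ring) = UNIV"
  "x \<oplus>\<^bsub>ring_of_type_algebra\<^esub> y = (x + y :: 'a::ring_1)"
  "x \<otimes>\<^bsub>ring_of_type_algebra\<^esub> y = (x * y :: 'a)"
  "\<one>\<^bsub>ring_of_type_algebra\<^esub> = (1 :: 'a)" "\<zero>\<^bsub>ring_of_type_algebra\<^esub> = (0 :: 'a)"
  by (simp_all add: ring_of_type_algebra_def)

lemma ring_of_type_algebra_ring: "ring (ring_of_type_algebra :: 'a::ring_1 ring)"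
proof -
  have "\<exists>y. x + y = 0" for x :: 'a
    using add.right_inverse by blast
  thus ?thesis
    unfolding ring_of_type_algebra_def using add.right_inverse
    by unfold_locales (auto simp:algebra_simps Units_def)
qed

interpretation free: ring "ring_of_type_algebra :: uq_free ring"
  by (rule ring_of_type_algebra_ring)

lemma uq_ideal: "ideal (uq_ideal q) ring_of_type_algebra"
  unfolding uq_ideal_def by (rule free.genideal_ideal) simp

lemma Uq_ring: "ring (Uq q)"
  unfolding Uq_def by (rule ideal.quotient_is_ring[OF uq_ideal])

lemma uq_class_hom: "uq_class q \<in> ring_hom ring_of_type_algebra (Uq q)"
  using ideal.rcos_ring_hom[OF uq_ideal[of q]] unfolding Uq_def uq_class_def .

lemma uq_class_simps:
  "uq_class q p \<in> carrier (Uq q)"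
  "uq_class q (p + p') = uq_class q p \<oplus>\<^bsub>Uq q\<^esub> uq_class q p'"
  "uq_class q (p * p') = uq_class q p \<otimes>\<^bsub>Uq q\<^esub> uq_class q p'"
  "uq_class q 1 = \<one>\<^bsub>Uq q\<^esub>"
  using uq_class_hom[of q] by (auto simp: ring_hom_def)

lemma uq_class_surj: "A \<in> carrier (Uq q) \<Longrightarrow> \<exists>p. A = uq_class q p"
  by (auto simp: Uq_def FactRing_def A_RCOSETS_def' uq_class_def)

lemma uq_class_eq: "uq_class q p = uq_class q p' \<Longrightarrow> p - p' \<in> uq_ideal q"
proof -
  interpret I: ideal "uq_ideal q" "ring_of_type_algebra :: uq_free ring" by (rule uq_ideal)
  assume *: "uq_class q p = uq_class q p'"
  have "p \<in> uq_class q p" unfolding uq_class_def by (rule I.a_rcos_self) simp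
  then have "p \<in> uq_class q p'" by (simp only: *)
  then obtain i where "i \<in> uq_ideal q" "p = i + p'"
    unfolding uq_class_def a_r_coset_def' by auto
  then show ?thesis by simp
qed

lemma uq_class_relation:
  assumes "r \<in> uq_relations q"
  shows "uq_class q r = uq_class q 0"
proof -
  interpret I: ideal "uq_ideal q" "ring_of_type_algebra :: uq_free ring" by (rule uq_ideal)
  have "r \<in> uq_ideal q" unfolding uq_ideal_def using free.genideal_self[of "uq_relations q"] assms
    by auto
  then show ?thesis unfolding uq_class_def
    using I.a_rcos_const[of r] I.a_rcos_const[of 0] I.zero_closed by simp
qed

text \<open>The elements that kill \<open>S\<close> form a two-sided ideal; for right multiples this
  holds because \<open>S\<close> is stable under the operators. The ideal contains the relations and
  hence everything they generate.\<close>

lemma uq_ideal_act: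
  assumes S: "cs.subspace S" and cl: "\<And>g x. x \<in> S \<Longrightarrow> op g x \<in> S"
    and l: "\<And>g. lin (op g)" and rel: "\<And>r x. \<lbrakk>r \<in> uq_relations q; x \<in> S\<rbrakk> \<Longrightarrow> act op r x = 0"
    and p: "p \<in> uq_ideal q" and x: "x \<in> S"
  shows "act op p x = 0"
proof -
  let ?I = "{p. \<forall>x\<in>S. act op p x = 0}"
  have "ideal ?I (ring_of_type_algebra :: uq_free ring)"
  proof (rule idealI[OF ring_of_type_algebra_ring])
    show "subgroup ?I (add_monoid (ring_of_type_algebra :: uq_free ring))"
    proof (rule group.subgroupI[OF free.a_group])
      fix a assume a: "a \<in> ?I"
      have "inv\<^bsub>add_monoid (ring_of_type_algebra :: uq_free ring)\<^esub> a = - a"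
        using free.minus_equality[of "- a" a] by (simp add: a_inv_def)
      then show "inv\<^bsub>add_monoid (ring_of_type_algebra :: uq_free ring)\<^esub> a \<in> ?I" using a by simp
    qed (auto intro: exI[of _ 0])
  qed (auto simp: act_mult[of op, OF l] lin_zero[OF lin_act[of op, OF l]] act_closed[OF S cl _ l])
  then have "uq_ideal q \<subseteq> ?I"
    unfolding uq_ideal_def by (rule free.genideal_minimal) (use rel in auto)
  then show ?thesis using p x by blast
qed

section \<open>Categories of modules and of representations in coordinates\<close>

definition lin_maps :: "coords set \<Rightarrow> coords set \<Rightarrow> (coords \<Rightarrow> coords) set" where
  "lin_maps S T = {f \<in> S \<rightarrow>\<^sub>E T. (\<forall>x\<in>S. \<forall>y\<in>S. f (x + y) = f x + f y)
    \<and> (\<forall>c. \<forall>x\<in>S. f (scl c x) = scl c (f x))}"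

lemma lin_maps_id: "cs.subspace S \<Longrightarrow> (\<lambda>x\<in>S. x) \<in> lin_maps S S"
  by (auto simp: lin_maps_def cs.subspace_add cs.subspace_scale)

lemma lin_maps_compose:
  assumes "cs.subspace S" "f \<in> lin_maps S T" "g \<in> lin_maps T U"
  shows "compose S g f \<in> lin_maps S U"
  using assms by (auto simp: lin_maps_def compose_def cs.subspace_add cs.subspace_scale PiE_iff)

lemma lin_maps_mem: "f \<in> lin_maps S T \<Longrightarrow> x \<in> S \<Longrightarrow> f x \<in> T"
  by (auto simp: lin_maps_def)

lemma lin_maps_ext: "\<lbrakk>f \<in> lin_maps S T; g \<in> lin_maps S T; \<And>x. x \<in> S \<Longrightarrow> f x = g x\<rbrakk> \<Longrightarrow> f = g"
  unfolding lin_maps_def by (auto intro: PiE_ext)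

text \<open>
  The operators are linear maps of the whole space of coordinate vectors, so that linearity needs no
  side condition; only their values on \<open>sp\<close> matter.
\<close>

record sch_model =
  sp :: "coords set"
  op :: "uq_gen \<Rightarrow> coords \<Rightarrow> coords"

text \<open>Weights enter through their exponents, which builds type 1 into the definition and
  replaces the direct sum by a sum over an interval. Uniqueness of the components comes later, from
  the independence of eigenvectors.\<close>

definition weight_decomposable :: "complex \<Rightarrow> (coords \<Rightarrow> coords) \<Rightarrow> coords set \<Rightarrow> nat \<Rightarrow> coords set"
  where
  "weight_decomposable q k S N = {v. \<exists>w :: int \<Rightarrow> coords. (\<forall>n. w n \<in> S
    \<and> k (w n) = scl (q powi n) (w n)) \<and>
     v = (\<Sum>n = - int N..int N. w n)}"

definition is_sch_model :: "complex \<Rightarrow> sch_model \<Rightarrow> bool" where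
  "is_sch_model q A \<longleftrightarrow> fd_space (sp A) \<and> (\<forall>g. lin (op A g)) \<and>
     (\<forall>g. \<forall>v\<in>sp A. op A g v \<in> sp A) \<and>
     (\<forall>r\<in>uq_relations q. \<forall>v\<in>sp A. act (op A) r v = 0) \<and> (\<forall>v\<in>sp A. op A Gen_Z v = 0) \<and>
     (\<forall>v\<in>sp A. \<exists>N. v \<in> weight_decomposable q (op A Gen_K) (sp A) N)"

definition sch_model_cat :: "complex \<Rightarrow> (sch_model, coords \<Rightarrow> coords) cat" where
  "sch_model_cat q =
     \<lparr>Obj = {A. is_sch_model q A},
      Mor = (\<lambda>A B. {f \<in> lin_maps (sp A) (sp B). \<forall>g. \<forall>v\<in>sp A. f (op A g v) = op B g (f v)}),
      Idn = (\<lambda>A. \<lambda>x\<in>sp A. x),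
      Comp = (\<lambda>A B D g f. compose (sp A) g f)\<rparr>"

lemma compose_extensional_id:
  "f \<in> S \<rightarrow>\<^sub>E T \<Longrightarrow> compose S f (\<lambda>x\<in>S. x) = f" "f \<in> S \<rightarrow>\<^sub>E T \<Longrightarrow> compose S (\<lambda>x\<in>T. x) f = f"
  by (auto simp: compose_def fun_eq_iff PiE_iff extensional_def)

lemma compose_assoc':
  "f \<in> S \<rightarrow>\<^sub>E T \<Longrightarrow> compose S h (compose S g f) = compose S (compose T h g) f"
  by (auto simp: compose_def fun_eq_iff PiE_iff)

lemma lin_maps_extensional: "f \<in> lin_maps S T \<Longrightarrow> f \<in> S \<rightarrow>\<^sub>E T"
  by (simp add: lin_maps_def)

lemma category_sch_model_cat: "category (sch_model_cat q)"
proof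
  fix A assume "A \<in> Obj (sch_model_cat q)"
  then show "Idn (sch_model_cat q) A \<in> Mor (sch_model_cat q) A A"
    by (auto simp: sch_model_cat_def is_sch_model_def fd_space_def lin_maps_id)
next
  fix A B D f g
  assume "A \<in> Obj (sch_model_cat q)" "f \<in> Mor (sch_model_cat q) A B" "g \<in> Mor (sch_model_cat q) B D"
  then show "Comp (sch_model_cat q) A B D g f \<in> Mor (sch_model_cat q) A D"
    by (auto simp: sch_model_cat_def is_sch_model_def fd_space_def lin_maps_compose compose_eq
      lin_maps_mem)
next
  fix A B D E f g h
  assume "f \<in> Mor (sch_model_cat q) A B"
  then show "Comp (sch_model_cat q) A D E h (Comp (sch_model_cat q) A B D g f) =
    Comp (sch_model_cat q) A B E (Comp (sch_model_cat q) B D E h g) f"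
    unfolding sch_model_cat_def cat.simps
    by (intro compose_assoc'[where T = "sp B"] lin_maps_extensional) simp
next
  fix A B f assume "f \<in> Mor (sch_model_cat q) A B"
  then have "f \<in> sp A \<rightarrow>\<^sub>E sp B"
    by (auto simp: sch_model_cat_def intro!: lin_maps_extensional)
  then show "Comp (sch_model_cat q) A A B f (Idn (sch_model_cat q) A) = f"
    "Comp (sch_model_cat q) A B B (Idn (sch_model_cat q) B) f = f"
    by (simp_all add: sch_model_cat_def compose_extensional_id)
qed

record quiver_model =
  qsp :: "nat \<Rightarrow> coords set"
  qa :: "nat \<Rightarrow> coords \<Rightarrow> coords"
  qb :: "nat \<Rightarrow> coords \<Rightarrow> coords"

text \<open>The finite dimension of every space and the vanishing of almost all of them together
  express that the direct sum is finite dimensional.\<close>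

definition is_quiver_model :: "quiver_model \<Rightarrow> bool" where
  "is_quiver_model W \<longleftrightarrow>
     (\<forall>i. fd_space (qsp W i) \<and> lin (qa W i) \<and> lin (qb W i) \<and>
       (\<forall>v\<in>qsp W i. qa W i v \<in> qsp W (Suc i)) \<and> (\<forall>v\<in>qsp W (Suc i). qb W i v \<in> qsp W i)) \<and>
     (\<forall>v\<in>qsp W 0. qb W 0 (qa W 0 v) = 0) \<and>
     (\<forall>i. \<forall>v\<in>qsp W (Suc i). qa W i (qb W i v) = qb W (Suc i) (qa W (Suc i) v)) \<and>
     (\<exists>N. \<forall>i\<ge>N. qsp W i = {0})"

definition quiver_model_cat :: "(quiver_model, nat \<Rightarrow> coords \<Rightarrow> coords) cat" where
  "quiver_model_cat =
     \<lparr>Obj = {W. is_quiver_model W},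
      Mor = (\<lambda>V W. {f. \<forall>i. f i \<in> lin_maps (qsp V i) (qsp W i) \<and>
        (\<forall>v\<in>qsp V i. f (Suc i) (qa V i v) = qa W i (f i v)) \<and>
        (\<forall>v\<in>qsp V (Suc i). f i (qb V i v) = qb W i (f (Suc i) v))}),
      Idn = (\<lambda>V i. \<lambda>v\<in>qsp V i. v),
      Comp = (\<lambda>U V W g f i. compose (qsp U i) (g i) (f i))\<rparr>"

lemma category_quiver_model_cat: "category quiver_model_cat"
proof
  fix A assume "A \<in> Obj quiver_model_cat"
  then show "Idn quiver_model_cat A \<in> Mor quiver_model_cat A A"
    by (auto simp: quiver_model_cat_def is_quiver_model_def fd_space_def lin_maps_id)
next
  fix A B D f g
  assume "A \<in> Obj quiver_model_cat" "f \<in> Mor quiver_model_cat A B" "g \<in> Mor quiver_model_cat B D"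
  moreover from this have "v \<in> qsp A i \<Longrightarrow> f i v \<in> qsp B i" for v i
    by (auto simp: quiver_model_cat_def intro: lin_maps_mem)
  ultimately show "Comp quiver_model_cat A B D g f \<in> Mor quiver_model_cat A D"
    by (auto simp: quiver_model_cat_def is_quiver_model_def fd_space_def compose_eq
      intro: lin_maps_compose)
next
  fix A B D E f g h
  assume "f \<in> Mor quiver_model_cat A B"
  then show "Comp quiver_model_cat A D E h (Comp quiver_model_cat A B D g f) =
    Comp quiver_model_cat A B E (Comp quiver_model_cat B D E h g) f"
    unfolding quiver_model_cat_def cat.simps
    by (intro ext compose_assoc'[where T = "qsp B _"] lin_maps_extensional) simp
next
  fix A B f assume "f \<in> Mor quiver_model_cat A B"
  then have *: "f i \<in> qsp A i \<rightarrow>\<^sub>E qsp B i" for i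
    by (auto simp: quiver_model_cat_def intro!: lin_maps_extensional)
  show "Comp quiver_model_cat A A B f (Idn quiver_model_cat A) = f"
    "Comp quiver_model_cat A B B (Idn quiver_model_cat B) f = f"
    by (simp_all add: quiver_model_cat_def compose_extensional_id[OF *])
qed

section \<open>Quantum integers\<close>

locale generic_q =
  fixes q :: complex
  assumes q_nonzero: "q \<noteq> 0" and not_root_of_unity: "\<forall>n::nat. n > 0 \<longrightarrow> q ^ n \<noteq> 1"
begin

definition qn :: "int \<Rightarrow> complex" where
  "qn n = (q powi n - q powi (- n)) / (q - inverse q)"

lemma powi_eq_1_iff: "q powi n = 1 \<longleftrightarrow> n = 0"
proof
  assume *: "q powi n = 1"
  have "q ^ nat \<bar>n\<bar> = 1"
  proof (cases "n \<ge> 0")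
    case False
    then have "q powi (- n) = 1" using * by (simp add: power_int_minus)
    then show ?thesis using False by (simp add: power_int_def)
  qed (use * in \<open>simp add: power_int_def\<close>)
  then show "n = 0" using not_root_of_unity[rule_format, of "nat \<bar>n\<bar>"] by auto
qed simp

lemma powi_eq_iff: "q powi m = q powi n \<longleftrightarrow> m = n"
proof
  assume "q powi m = q powi n"
  then have "q powi (m - n) = 1" using q_nonzero by (simp add: power_int_diff)
  then show "m = n" by (simp add: powi_eq_1_iff)
qed simp

lemma q_sq: "q * q \<noteq> 1"
  using not_root_of_unity[rule_format, of 2] by (simp add: power2_eq_square)

lemma q_diff: "q - inverse q \<noteq> 0"
  using q_sq q_nonzero by (simp add: field_simps)

lemma qn_eq_0_iff: "qn n = 0 \<longleftrightarrow> n = 0"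
  using q_diff powi_eq_iff[of n "- n"] by (auto simp: qn_def)

lemma qn_0 [simp]: "qn 0 = 0" and qn_1 [simp]: "qn 1 = 1"
  using q_diff by (simp_all add: qn_def)

lemma qn_minus: "qn (- n) = - qn n"
  by (simp add: qn_def minus_divide_left)

lemma qn_alt: "qn n = q * (q powi n - inverse (q powi n)) / (q * q - 1)"
  using q_nonzero q_sq q_diff by (simp add: qn_def power_int_minus field_simps)

lemma qn_plus_1: "qn (n + 1) = q * qn n + q powi (- n)"
  using q_nonzero q_sq power_int_not_zero[of q n] 
  by (simp add: qn_alt power_int_add power_int_minus field_simps)

text \<open>This is the induction step for moving E past powers of F: [n - 2k] is the contribution
  of a vector of weight n - 2k.\<close>

lemma qn_commutator: "qn k * qn (n - k + 1) + qn (n - 2 * k) = qn (k + 1) * qn (n - k)"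
proof -
  define a b a' b' where "a = q powi n" "b = q powi k" "a' = q powi (- n)" "b' = q powi (- k)"
  define t q' where "t = inverse (q - inverse q)" "q' = inverse q"
  have h: "t * (q - q') = 1"
    using q_diff by (simp add: t_q'_def)
  have qn: "qn m = t * (q powi m - q powi (- m))" for m
    by (simp add: qn_def t_q'_def divide_inverse)
  have "q powi (n - k + 1) = a * b' * q" "q powi (- (n - k + 1)) = a' * b * q'"
    "q powi (k + 1) = b * q" "q powi (- (k + 1)) = b' * q'"
    "q powi (n - k) = a * b'" "q powi (- (n - k)) = a' * b"
    using q_nonzero
    by (simp_all add: a_b_a'_b'_def t_q'_def power_int_add power_int_diff power_int_minus
      divide_inverse)
  moreover have "q powi (n - 2 * k) = a * b' * b'" "q powi (- (n - 2 * k)) = a' * b * b"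
  proof -
    have "n - 2 * k = n + - k + - k" "- (n - 2 * k) = - n + k + k" by simp_all
    then show "q powi (n - 2 * k) = a * b' * b'" "q powi (- (n - 2 * k)) = a' * b * b"
      unfolding a_b_a'_b'_def by (simp_all only: power_int_add[OF disjI1[OF q_nonzero]])
  qed
  moreover have "t * (b - b') * (t * (a * b' * q - a' * b * q')) + t * (a * b' * b' - a' * b * b) =
      t * (b * q - b' * q') * (t * (a * b' - a' * b))"
  proof -
    \<comment> \<open>Once the powers are named, the difference of the two sides is a multiple of
      \<open>t * (q - q') - 1\<close>, which vanishes by \<open>h\<close>.\<close>
    have "t * (b - b') * (t * (a * b' * q - a' * b * q')) + t * (a * b' * b' - a' * b * b) -
        t * (b * q - b' * q') * (t * (a * b' - a' * b)) =
        t * (t * (q - q') - 1) * (a' * b * b - a * b' * b')"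
      by (simp add: algebra_simps)
    then show ?thesis using h by simp
  qed
  ultimately show ?thesis
    by (simp only: qn) (simp only: a_b_a'_b'_def[symmetric])
qed

end

section \<open>Complete reducibility for the subalgebra generated by E, F and K\<close>

text \<open>The action of K enters only through the predicate \<open>wt\<close>. This makes the
  assumptions symmetric under the exchange of E and F with reversal of the weights, which
  \<open>swapped\<close> exploits.\<close>

locale sl2_space = generic_q +
  fixes E F :: "coords \<Rightarrow> coords" and wt :: "int \<Rightarrow> coords \<Rightarrow> bool" and N :: nat
  assumes lin_E: "lin E" and lin_F: "lin F"
    and wt_E: "wt n v \<Longrightarrow> wt (n + 2) (E v)" and wt_F: "wt n v \<Longrightarrow> wt (n - 2) (F v)"
    and wt_subspace: "cs.subspace {v. wt n v}"
    and E_F: "wt n v \<Longrightarrow> E (F v) = F (E v) + scl (qn n) v"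
    and wt_indep: "\<lbrakk>finite I; \<And>n. n \<in> I \<Longrightarrow> wt n (w n); (\<Sum>n\<in>I. w n) = 0\<rbrakk> \<Longrightarrow> \<forall>n\<in>I. w n = 0"
    and wt_bound: "\<lbrakk>wt n v; \<bar>n\<bar> > int N\<rbrakk> \<Longrightarrow> v = 0"
begin

definition hw :: "int \<Rightarrow> coords \<Rightarrow> bool" where
  "hw n v \<longleftrightarrow> wt n v \<and> E v = 0"

lemma hw_subspace: "cs.subspace {v. hw n v}"
  using wt_subspace[of n]
  by (auto simp: hw_def cs.subspace_def lin_zero[OF lin_E] lin_add[OF lin_E] lin_scale[OF lin_E])

lemma hw_0: "hw n 0"
  using cs.subspace_0[OF hw_subspace[of n]] by simp

lemma lin_Fpow: "lin (F ^^ k)" and lin_Epow: "lin (E ^^ k)"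
  using lin_pow lin_E lin_F by auto

lemma wt_Fpow: "wt n v \<Longrightarrow> wt (n - 2 * int k) ((F ^^ k) v)"
proof (induction k)
  case (Suc k)
  then have "wt (n - 2 * int k - 2) (F ((F ^^ k) v))" by (intro wt_F) auto
  then show ?case by (simp add: algebra_simps)
qed simp

text \<open>Moving E past the powers of F collects [n] + [n - 2] + ... + [n - 2k], which
  \<open>qn_commutator\<close> sums to the product.\<close>

lemma E_Fpow:
  assumes "hw n v"
  shows "E ((F ^^ Suc k) v) = scl (qn (int k + 1) * qn (n - int k)) ((F ^^ k) v)"
proof (induction k)
  case 0
  then show ?case using E_F[of n v] assms by (simp add: hw_def lin_zero[OF lin_F])
next
  case (Suc k)
  have "wt (n - 2 * int (Suc k)) ((F ^^ Suc k) v)" using assms wt_Fpow unfolding hw_def by blast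
  then have "E ((F ^^ Suc (Suc k)) v) =
      F (E ((F ^^ Suc k) v)) + scl (qn (n - 2 * int (Suc k))) ((F ^^ Suc k) v)"
    using E_F by simp
  also have "\<dots> = scl (qn (int k + 1) * qn (n - int k) + qn (n - 2 * int (Suc k))) ((F ^^ Suc k) v)"
    unfolding Suc lin_scale[OF lin_F] by (simp add: cs.scale_left_distrib)
  also have "qn (int k + 1) * qn (n - int k) + qn (n - 2 * int (Suc k)) =
      qn (int (Suc k) + 1) * qn (n - int (Suc k))"
    using qn_commutator[of "int (Suc k)" n] by (simp add: algebra_simps)
  finally show ?case .
qed

text \<open>For n < 0 no coefficient [k + 1] [n - k] vanishes, so F^(k+1) v = 0 forces F^k v = 0.
  Weights are bounded, so some power of F kills v, and descending from it gives v = 0.\<close>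

lemma hw_neg:
  assumes v: "hw n v" and n: "n < 0"
  shows "v = 0"
proof -
  have step: "(F ^^ k) v = 0" if "(F ^^ Suc k) v = 0" for k
  proof -
    have "scl (qn (int k + 1) * qn (n - int k)) ((F ^^ k) v) = 0"
      using E_Fpow[OF v, of k] that lin_zero[OF lin_E] by simp
    moreover have "qn (int k + 1) * qn (n - int k) \<noteq> 0" using n by (simp add: qn_eq_0_iff)
    ultimately show ?thesis by simp
  qed
  have "(F ^^ k) v = 0 \<Longrightarrow> v = 0" for k
    by (induction k) (use step in auto)
  \<comment> \<open>\<open>N\<close> applications are enough: since n < 0, the weight n - 2N lies
    below -N.\<close>
  moreover have "(F ^^ N) v = 0"
    using wt_bound[OF wt_Fpow] v n unfolding hw_def by auto
  ultimately show ?thesis by blast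
qed

text \<open>E kills F^(n+1) v, because the coefficient [n + 1] [0] is zero, and the weight -n - 2 of
  this vector is negative, so \<open>hw_neg\<close> applies to it.\<close>

lemma Fpow_zero:
  assumes v: "hw n v" and k: "n < int k"
  shows "(F ^^ k) v = 0"
proof (cases "n < 0")
  case True
  then show ?thesis using hw_neg[OF v] lin_zero[OF lin_Fpow] by simp
next
  case False
  define m where "m = nat n"
  have n: "n = int m" using False by (simp add: m_def)
  have "E ((F ^^ Suc m) v) = 0" using E_Fpow[OF v, of m] n by simp
  moreover have "wt (n - 2 * int (Suc m)) ((F ^^ Suc m) v)"
    using v wt_Fpow unfolding hw_def by blast
  ultimately have "(F ^^ Suc m) v = 0"
    using hw_neg[of "n - 2 * int (Suc m)" "(F ^^ Suc m) v"] n unfolding hw_def by simp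
  moreover obtain j where "k = j + Suc m" using k n
    by (metis add.commute le_Suc_ex Suc_leI of_nat_less_iff)
  ultimately show ?thesis by (simp only: funpow_add o_apply lin_zero[OF lin_Fpow])
qed

text \<open>Every application of E contributes a coefficient from \<open>E_Fpow\<close>, and none of
  them vanishes because k is at most n.\<close>

lemma Epow_Fpow:
  assumes v: "hw n v" and "j \<le> k" "int k \<le> n"
  shows "\<exists>c. c \<noteq> 0 \<and> (E ^^ j) ((F ^^ k) v) = scl c ((F ^^ (k - j)) v)"
  using assms(2)
proof (induction j)
  case (Suc j)
  then obtain c where c: "c \<noteq> 0" "(E ^^ j) ((F ^^ k) v) = scl c ((F ^^ (k - j)) v)" by auto
  have kj: "k - j = Suc (k - Suc j)" using Suc.prems by simp
  let ?d = "qn (int (k - Suc j) + 1) * qn (n - int (k - Suc j))"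
  have "(E ^^ Suc j) ((F ^^ k) v) = E (scl c ((F ^^ (k - j)) v))"
    using c(2) by simp
  also have "\<dots> = scl c (E ((F ^^ Suc (k - Suc j)) v))"
    unfolding lin_scale[OF lin_E] kj ..
  also have "\<dots> = scl (c * ?d) ((F ^^ (k - Suc j)) v)"
    unfolding E_Fpow[OF v] by simp
  finally show ?case using c(1) assms(3) Suc.prems
    by (intro exI[of _ "c * ?d"]) (auto simp: qn_eq_0_iff)
qed (auto intro: exI[of _ 1])

text \<open>
  For \<open>m \<ge> -1\<close> no coefficient \<open>[k + 1] [m + 2 + k]\<close> vanishes, so \<open>E\<close> maps the span of the
  \<open>F\<^sup>k v\<close> of weight \<open>m\<close> onto the one of weight \<open>m + 2\<close>; descending induction on \<open>m\<close> then shows that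
  the span is the whole weight space.  Negative weights follow by exchanging \<open>E\<close> and \<open>F\<close>.
\<close>

definition level_span :: "int \<Rightarrow> coords set" where
  "level_span m = cs.span {(F ^^ k) v |k v. hw (m + 2 * int k) v}"

lemma level_span_wt: "level_span m \<subseteq> {v. wt m v}"
  unfolding level_span_def
proof (rule cs.span_minimal[OF _ wt_subspace], safe)
  fix k v assume "hw (m + 2 * int k) v"
  then show "wt m ((F ^^ k) v)" using wt_Fpow[of "m + 2 * int k" v k] by (simp add: hw_def)
qed

lemma E_level_span:
  assumes "m \<ge> - 1"
  shows "level_span (m + 2) \<subseteq> E ` level_span m"
  unfolding level_span_def[of "m + 2"]
proof (rule cs.span_minimal)
  show "cs.subspace (E ` level_span m)"
    unfolding level_span_def by (rule Modules.module_hom.subspace_image[OF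
      Vector_Spaces.linear.axioms(3)[OF lin_E] cs.subspace_span])
  show "{(F ^^ k) v |k v. hw (m + 2 + 2 * int k) v} \<subseteq> E ` level_span m"
  proof safe
    fix k v assume v: "hw (m + 2 + 2 * int k) v"
    let ?c = "qn (int k + 1) * qn (m + 2 + 2 * int k - int k)"
    have c: "?c \<noteq> 0" using assms by (simp add: qn_eq_0_iff)
    have "hw (m + 2 * int (Suc k)) v" using v by (simp add: algebra_simps)
    then have "(F ^^ Suc k) v \<in> level_span m"
      unfolding level_span_def by (intro cs.span_base) blast
    then have "scl (1 / ?c) ((F ^^ Suc k) v) \<in> level_span m"
      unfolding level_span_def by (rule cs.span_scale)
    moreover have "E (scl (1 / ?c) ((F ^^ Suc k) v)) = (F ^^ k) v"
      unfolding lin_scale[OF lin_E] E_Fpow[OF v] using c by simp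
    ultimately show "(F ^^ k) v \<in> E ` level_span m" by (metis image_eqI)
  qed
qed

lemma wt_level_span:
  assumes "m \<ge> - 1" "wt m v"
  shows "v \<in> level_span m"
  using assms
proof (induction "nat (int N + 1 - m)" arbitrary: m v rule: less_induct)
  case less
  show ?case
  proof (cases "m > int N")
    case True
    then have "v = 0" using wt_bound less.prems by auto
    then show ?thesis by (simp add: level_span_def cs.span_zero)
  next
    case False
    have "E v \<in> level_span (m + 2)"
      by (rule less.hyps) (use False less.prems wt_E in auto)
    then obtain z where z: "z \<in> level_span m" "E v = E z"
      using E_level_span[OF less.prems(1)] by blast
    \<comment> \<open>\<open>v\<close> and \<open>z\<close> have the same image under E, so they
      differ by a highest weight vector of weight \<open>m\<close>; this is the case k = 0 of the
      spanning set.\<close>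
    have "wt m (v - z)"
      using z(1) level_span_wt less.prems(2) cs.subspace_diff[OF wt_subspace[of m], of v z] by auto
    then have "hw (m + 2 * int 0) (v - z)"
      using z(2) by (simp add: hw_def lin_diff[OF lin_E])
    then have "(F ^^ 0) (v - z) \<in> level_span m"
      unfolding level_span_def by (intro cs.span_base) blast
    then have "(v - z) + z \<in> level_span m"
      using z(1) unfolding level_span_def by (intro cs.span_add) auto
    then show ?thesis by simp
  qed
qed

definition hw_span :: "coords set" where
  "hw_span = cs.span {(F ^^ k) v |n k v. hw n v}"

lemma hw_span_base: "hw n v \<Longrightarrow> (F ^^ k) v \<in> hw_span"
  unfolding hw_span_def by (intro cs.span_base) blast

text \<open>The commutation rule survives the exchange because \<open>qn\<close> is odd.\<close>

lemma swapped: "sl2_space q F E (\<lambda>n. wt (- n)) N"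
proof unfold_locales
  show "wt (- (n + 2)) (F v)" if "wt (- n) v" for n v
    using wt_F[OF that] by (simp add: algebra_simps)
  show "wt (- (n - 2)) (E v)" if "wt (- n) v" for n v
    using wt_E[OF that] by (simp add: algebra_simps)
  show "F (E v) = E (F v) + scl (qn n) v" if "wt (- n) v" for n v
    using E_F[OF that] by (simp add: qn_minus)
  show "\<forall>n\<in>I. w n = 0"
    if "finite I" "\<And>n. n \<in> I \<Longrightarrow> wt (- n) (w n)" "(\<Sum>n\<in>I. w n) = 0" for I w
  proof -
    have "\<forall>n\<in>uminus ` I. w (- n) = 0"
      by (rule wt_indep) (use that in \<open>auto simp: sum.reindex\<close>)
    then show ?thesis by auto
  qed
  show "v = 0" if "wt (- n) v" "\<bar>n\<bar> > int N" for n v using wt_bound[OF that(1)] that(2) by simp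
qed (simp_all add: lin_add[OF lin_E] lin_add[OF lin_F] lin_scale[OF lin_E] lin_scale[OF lin_F]
  wt_subspace)

text \<open>For a negative weight the swapped structure yields vectors E^k w with w killed by F. The
  string through w also has a top, u = E^l w, and up to nonzero scalars w is F^l u; so E^k w is a
  multiple of F^(l-k) u.\<close>

lemma wt_hw_span:
  assumes v: "wt m v"
  shows "v \<in> hw_span"
proof (cases "m \<ge> 0")
  case True
  then have "v \<in> level_span m" using wt_level_span v by simp
  also have "level_span m \<subseteq> hw_span"
    unfolding level_span_def hw_span_def by (rule cs.span_mono) blast
  finally show ?thesis .
next
  case False
  interpret sw: sl2_space q F E "\<lambda>n. wt (- n)" N by (rule swapped)
  have "v \<in> sw.level_span (- m)" by (rule sw.wt_level_span) (use False v in auto)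
  also have "sw.level_span (- m) \<subseteq> hw_span"
    unfolding sw.level_span_def
  proof (rule cs.span_minimal, safe)
    fix k w assume w: "sw.hw (- m + 2 * int k) w"
    \<comment> \<open>\<open>w\<close> is killed by F and has weight -l, so E^l leads from the
      bottom of its string to the top.\<close>
    define l where "l = nat (- m + 2 * int k)"
    have l: "int l = - m + 2 * int k" using False by (simp add: l_def)
    have wl: "sw.hw (int l) w" using w l by simp
    obtain c where c: "c \<noteq> 0" "(F ^^ l) ((E ^^ l) w) = scl c w"
      using sw.Epow_Fpow[OF wl, of l l] by auto
    define u where "u = (E ^^ l) w"
    have "(E ^^ Suc l) w = 0" by (rule sw.Fpow_zero[OF wl]) simp
    moreover have "wt (int l) u"
      using sw.wt_Fpow[of "int l" w l] wl unfolding sw.hw_def u_def by simp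
    ultimately have u: "hw (int l) u" unfolding hw_def u_def by simp
    obtain d where d: "(E ^^ k) ((F ^^ l) u) = scl d ((F ^^ (l - k)) u)"
      using Epow_Fpow[OF u, of k l] l False by auto
    have "(E ^^ k) w = scl (1 / c) ((E ^^ k) (scl c w))"
      using c(1) by (simp add: lin_scale[OF lin_Epow])
    also have "\<dots> = scl (1 / c * d) ((F ^^ (l - k)) u)"
      using d c(2) unfolding u_def by simp
    also have "\<dots> \<in> hw_span"
      using hw_span_base[OF u] unfolding hw_span_def by (rule cs.span_scale)
    finally show "(E ^^ k) w \<in> hw_span" .
  qed (simp add: hw_span_def)
  finally show ?thesis .
qed

section \<open>Existence and uniqueness of the decomposition into vectors F^k v\<close>

definition admissible :: "(nat \<Rightarrow> nat \<Rightarrow> coords) \<Rightarrow> bool" where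
  "admissible c \<longleftrightarrow> (\<forall>n k. hw (int n) (c n k)) \<and> (\<forall>n k. \<not> (k \<le> n \<and> n \<le> N) \<longrightarrow> c n k = 0)"

text \<open>For an admissible \<open>c\<close> this is a normal form, with \<open>c n k\<close> as
  the coefficient of F^k. Entries with k > n would be killed by F^k and thus be invisible in the
  sum; making them zero is what gives uniqueness.\<close>

definition comb :: "(nat \<Rightarrow> nat \<Rightarrow> coords) \<Rightarrow> coords" where
  "comb c = (\<Sum>n\<le>N. \<Sum>k\<le>N. (F ^^ k) (c n k))"

lemma comb_add: "comb (\<lambda>n k. c n k + d n k) = comb c + comb d"
  by (simp add: comb_def lin_add[OF lin_Fpow] sum.distrib)

lemma comb_scale: "comb (\<lambda>n k. scl a (c n k)) = scl a (comb c)"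
  by (simp add: comb_def lin_scale[OF lin_Fpow] cs.scale_sum_right)

lemma admissible_add: "\<lbrakk>admissible c; admissible d\<rbrakk> \<Longrightarrow> admissible (\<lambda>n k. c n k + d n k)"
  using cs.subspace_add[OF hw_subspace] by (auto simp: admissible_def)

lemma admissible_scale: "admissible c \<Longrightarrow> admissible (\<lambda>n k. scl a (c n k))"
  using cs.subspace_scale[OF hw_subspace] by (auto simp: admissible_def)

lemma admissible_single:
  assumes "hw (int n) v" "k \<le> n" "n \<le> N"
  shows "admissible (\<lambda>n' k'. if n' = n \<and> k' = k then v else 0)"
    "comb (\<lambda>n' k'. if n' = n \<and> k' = k then v else 0) = (F ^^ k) v"
proof -
  show "admissible (\<lambda>n' k'. if n' = n \<and> k' = k then v else 0)"
    using assms hw_0 by (auto simp: admissible_def)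
  have "(\<Sum>k'\<le>N. (F ^^ k') (if n' = n \<and> k' = k then v else 0)) = (if n' =
    n then (F ^^ k) v else 0)" for n'
  proof -
    have "(F ^^ k') (if n' = n \<and> k' = k then v else 0) = (if k' = k then
      if n' = n then (F ^^ k) v else 0 else 0)" for k'
      by (simp add: lin_zero[OF lin_Fpow])
    then show ?thesis using assms by simp
  qed
  then show "comb (\<lambda>n' k'. if n' = n \<and> k' = k then v else 0) = (F ^^ k) v"
    using assms unfolding comb_def by simp
qed

lemma admissible_zero: "admissible (\<lambda>n k. 0)" "comb (\<lambda>n k. 0) = 0"
  by (simp_all add: admissible_def hw_0 comb_def lin_zero[OF lin_Fpow])

text \<open>There are three ways of leaving the admissible range, n < 0, k > n and n > N, and each
  of them forces the vector to be zero.\<close>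

lemma hw_Fpow_cases:
  assumes "hw n v"
  obtains "(F ^^ k) v = 0" | n' where "n = int n'" "k \<le> n'" "n' \<le> N"
proof (cases "0 \<le> n \<and> int k \<le> n \<and> n \<le> int N")
  case True
  then show ?thesis using that(2)[of "nat n"] by (simp add: le_nat_iff nat_le_iff)
next
  case False
  then have "n < 0 \<or> n < int k \<or> \<bar>n\<bar> > int N" by linarith
  then consider "n < 0" | "n < int k" | "\<bar>n\<bar> > int N" by blast
  then have "(F ^^ k) v = 0"
  proof cases
    case 1 then show ?thesis using hw_neg[OF assms] lin_zero[OF lin_Fpow] by simp
  next
    case 2 then show ?thesis using Fpow_zero[OF assms] by simp
  next
    case 3 then show ?thesis using wt_bound[of n v] assms lin_zero[OF lin_Fpow]
      by (simp add: hw_def)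
  qed
  then show ?thesis by (rule that(1))
qed

lemma comb_exists:
  assumes "v \<in> hw_span"
  shows "\<exists>c. admissible c \<and> v = comb c"
proof -
  let ?D = "{v. \<exists>c. admissible c \<and> v = comb c}"
  have "hw_span \<subseteq> ?D"
    unfolding hw_span_def
  proof (rule cs.span_minimal)
    show "cs.subspace ?D" unfolding cs.subspace_def
    proof (intro conjI ballI allI)
      show "0 \<in> ?D" using admissible_zero(1) admissible_zero(2)[symmetric] by blast
      show "x + y \<in> ?D" if "x \<in> ?D" "y \<in> ?D" for x y
        using that admissible_add comb_add[symmetric] by blast
      show "scl a x \<in> ?D" if "x \<in> ?D" for a x
        using that admissible_scale comb_scale[symmetric] by blast
    qed
    show "{(F ^^ k) v |n k v. hw n v} \<subseteq> ?D"
    proof safe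
      fix n k v assume v: "hw n v"
      show "\<exists>c. admissible c \<and> (F ^^ k) v = comb c"
        using v
      proof (cases rule: hw_Fpow_cases[where k = k])
        case 1 then show ?thesis using admissible_zero(1) admissible_zero(2)[symmetric] by metis
      next
        case (2 n') then show ?thesis using admissible_single[of n' v k] v by metis
      qed
    qed
  qed
  then show ?thesis using assms by blast
qed

text \<open>
  Let \<open>M\<close> be the largest \<open>k\<close> that occurs.  Then \<open>E\<^sup>M\<close> kills the terms with smaller \<open>k\<close> and maps the
  remaining ones to nonzero multiples of highest weight vectors of distinct weights.
\<close>

lemma comb_eq_0:
  assumes c: "admissible c" and z: "comb c = 0"
  shows "c n k = 0"
proof (rule ccontr)
  assume "c n k \<noteq> 0"
  let ?Q = "\<lambda>k. \<exists>n. c n k \<noteq> 0"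
  have bd: "k \<le> N" if "?Q k" for k using that c unfolding admissible_def by (meson le_trans)
  define M where "M = (GREATEST k. ?Q k)"
  have M: "?Q M" unfolding M_def by (rule GreatestI_nat[of ?Q k N]) (use \<open>c n k \<noteq> 0\<close> bd in auto)
  have M_max: "c n k = 0" if "k > M" for n k
    using Greatest_le_nat[of ?Q k N] that bd unfolding M_def by force
  have hwc: "hw (int n) (c n k)" for n k using c by (simp add: admissible_def)
  \<comment> \<open>E^k brings the term back to a multiple of the highest weight vector, and one
    more E kills it.\<close>
  have small: "(E ^^ M) ((F ^^ k) (c n k)) = 0" if "k < M" for n k
  proof (cases "k \<le> n")
    case True
    obtain d where "(E ^^ k) ((F ^^ k) (c n k)) = scl d (c n k)"
      using Epow_Fpow[OF hwc, of k k n k] True by auto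
    then have "(E ^^ Suc k) ((F ^^ k) (c n k)) = 0"
      using hwc[of n k] by (simp add: hw_def lin_scale[OF lin_E])
    moreover have "M = (M - Suc k) + Suc k" using that by simp
    then obtain j where "M = j + Suc k" by blast
    ultimately show ?thesis by (simp only: funpow_add o_apply lin_zero[OF lin_Epow])
  next
    case False
    then have "c n k = 0" using c by (simp add: admissible_def)
    then show ?thesis by (simp add: lin_zero[OF lin_Epow] lin_zero[OF lin_Fpow])
  qed
  define u where "u n = (E ^^ M) ((F ^^ M) (c n M))" for n
  have "(E ^^ M) (comb c) = (\<Sum>n\<le>N. \<Sum>k\<le>N. (E ^^ M) ((F ^^ k) (c n k)))"
    by (simp add: comb_def lin_sum[OF lin_Epow])
  also have "\<dots> = (\<Sum>n\<le>N. u n)"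
  proof (rule sum.cong)
    fix n
    have "(E ^^ M) ((F ^^ k) (c n k)) = (if k = M then u n else 0)" for k
      using small[of k n] M_max[of k n]
      by (cases k M rule: linorder_cases)
        (auto simp: u_def lin_zero[OF lin_Epow] lin_zero[OF lin_Fpow])
    then show "(\<Sum>k\<le>N. (E ^^ M) ((F ^^ k) (c n k))) = u n"
      using bd[OF M] by simp
  qed simp
  finally have "(\<Sum>n\<le>N. u n) = 0" using z lin_zero[OF lin_Epow] by simp
  have u: "\<exists>d. d \<noteq> 0 \<and> u n = scl d (c n M)" for n
  proof (cases "M \<le> n")
    case True
    then show ?thesis using Epow_Fpow[OF hwc, of M M n M] by (simp add: u_def)
  next
    case False
    then have "c n M = 0" using c by (simp add: admissible_def)
    then show ?thesis
      by (intro exI[of _ 1]) (simp add: u_def lin_zero[OF lin_Epow] lin_zero[OF lin_Fpow])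
  qed
  have "\<forall>i\<in>int ` {..N}. u (nat i) = 0"
  proof (rule wt_indep)
    fix i assume "i \<in> int ` {..N}"
    then obtain n where n: "i = int n" by auto
    obtain d where "u n = scl d (c n M)" using u by blast
    then show "wt i (u (nat i))"
      using hwc[of n M] cs.subspace_scale[OF wt_subspace[of i]] n by (simp add: hw_def)
  qed (use \<open>(\<Sum>n\<le>N. u n) = 0\<close> in \<open>auto simp: sum.reindex\<close>)
  moreover obtain n where n: "c n M \<noteq> 0" using M by blast
  moreover have "n \<le> N" using n c unfolding admissible_def by blast
  ultimately have "u n = 0" by force
  then show False using u[of n] n by auto
qed

lemma comb_unique:
  assumes "admissible c" "admissible d" "comb c = comb d"
  shows "c = d"
proof -
  have "admissible (\<lambda>n k. c n k + scl (- 1) (d n k))"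
    using assms admissible_add admissible_scale by blast
  moreover have "comb (\<lambda>n k. c n k + scl (- 1) (d n k)) = 0"
    using assms(3) comb_add[of c "\<lambda>n k. scl (- 1) (d n k)"] comb_scale[of "- 1" d] by simp
  ultimately have "c n k + scl (- 1) (d n k) = 0" for n k
    using comb_eq_0[of "\<lambda>n k. c n k + scl (- 1) (d n k)"] by simp
  then show ?thesis by (auto simp: fun_eq_iff coords_apply)
qed

end

section \<open>Highest weight vectors\<close>

locale sch_object = generic_q +
  fixes A :: sch_model
  assumes model: "is_sch_model q A"
begin

abbreviation "S \<equiv> sp A"
abbreviation "E \<equiv> op A Gen_E"
abbreviation "F \<equiv> op A Gen_F"
abbreviation "K \<equiv> op A Gen_K"
abbreviation "K' \<equiv> op A Gen_Kinv"
abbreviation "XX \<equiv> op A Gen_X"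
abbreviation "YY \<equiv> op A Gen_Y"
abbreviation "ZZ \<equiv> op A Gen_Z"

definition wt :: "int \<Rightarrow> coords \<Rightarrow> bool" where
  "wt n v \<longleftrightarrow> v \<in> S \<and> K v = scl (q powi n) v"

lemma lin_op: "lin (op A g)" and op_closed: "v \<in> S \<Longrightarrow> op A g v \<in> S"
  and fd_S: "fd_space S" and sub_S: "cs.subspace S" and op_Z: "v \<in> S \<Longrightarrow> ZZ v = 0"
  using model by (auto simp: is_sch_model_def fd_space_def)

lemmas op_add = lin_add[OF lin_op] and op_scale = lin_scale[OF lin_op]
  and op_zero = lin_zero[OF lin_op] and op_diff = lin_diff[OF lin_op]

lemma relation: "r \<in> uq_relations q \<Longrightarrow> v \<in> S \<Longrightarrow> act (op A) r v = 0"
  using model by (simp add: is_sch_model_def)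

lemmas act_op_mult = act_mult[of "op A", OF lin_op]

lemma relations:
  assumes v: "v \<in> S"
  shows "K (K' v) = v" "K' (K v) = v"
    "E (F v) = F (E v) + scl (1 / (q - inverse q)) (K v - K' v)"
    "K (E (K' v)) = scl (q^2) (E v)" "K (F (K' v)) = scl (inverse (q^2)) (F v)"
    "K (XX (K' v)) = scl q (XX v)" "K (YY (K' v)) = scl (inverse q) (YY v)"
    "XX (YY v) = scl q (YY (XX v))" "E (XX v) = scl q (XX (E v))"
    "E (YY v) = XX v + scl (inverse q) (YY (E v))" "F (XX v) = YY (K' v) + XX (F v)"
    "F (YY v) = YY (F v)"
proof -
  let ?e = "gen Gen_E" and ?f = "gen Gen_F" and ?k = "gen Gen_K" and ?k' = "gen Gen_Kinv"
    and ?x = "gen Gen_X" and ?y = "gen Gen_Y" and ?z = "gen Gen_Z"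
  note R = relation[OF _ v]
  have "act (op A) (?k * ?k' - 1) v = 0" "act (op A) (?k' * ?k - 1) v = 0"
    by (rule R; simp add: uq_relations_def Let_def)+
  then show "K (K' v) = v" "K' (K v) = v" by (simp_all add: act_op_mult)
  have "act (op A) ((?e * ?f - ?f * ?e) - const (1 / (q - inverse q)) * (?k - ?k')) v = 0"
    by (rule R; simp add: uq_relations_def Let_def)
  then show "E (F v) = F (E v) + scl (1 / (q - inverse q)) (K v - K' v)"
    by (simp add: act_op_mult algebra_simps)
  have "act (op A) (?k * ?e * ?k' - const (q^2) * ?e) v = 0"
    by (rule R; simp add: uq_relations_def Let_def)
  then show "K (E (K' v)) = scl (q^2) (E v)" by (simp add: act_op_mult)
  have "act (op A) (?k * ?f * ?k' - const (inverse (q^2)) * ?f) v = 0"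
    by (rule R; simp add: uq_relations_def Let_def)
  then show "K (F (K' v)) = scl (inverse (q^2)) (F v)" by (simp add: act_op_mult)
  have "act (op A) (?k * ?x * ?k' - const q * ?x) v = 0"
    by (rule R; simp add: uq_relations_def Let_def)
  then show "K (XX (K' v)) = scl q (XX v)" by (simp add: act_op_mult)
  have "act (op A) (?k * ?y * ?k' - const (inverse q) * ?y) v = 0"
    by (rule R; simp add: uq_relations_def Let_def)
  then show "K (YY (K' v)) = scl (inverse q) (YY v)" by (simp add: act_op_mult)
  have "act (op A) ((const q * ?y * ?x - ?x * ?y) - ?z) v = 0"
    by (rule R; simp add: uq_relations_def Let_def)
  then show "XX (YY v) = scl q (YY (XX v))" using op_Z[OF v] by (simp add: act_op_mult)
  have "act (op A) (?e * ?x - const q * ?x * ?e) v = 0"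
    by (rule R; simp add: uq_relations_def Let_def)
  then show "E (XX v) = scl q (XX (E v))" by (simp add: act_op_mult)
  have "act (op A) (?e * ?y - (?x + const (inverse q) * ?y * ?e)) v = 0"
    by (rule R; simp add: uq_relations_def Let_def)
  then show "E (YY v) = XX v + scl (inverse q) (YY (E v))" by (simp add: act_op_mult)
  have "act (op A) (?f * ?x - (?y * ?k' + ?x * ?f)) v = 0"
    by (rule R; simp add: uq_relations_def Let_def)
  then show "F (XX v) = YY (K' v) + XX (F v)" by (simp add: act_op_mult)
  have "act (op A) (?f * ?y - ?y * ?f) v = 0"
    by (rule R; simp add: uq_relations_def Let_def)
  then show "F (YY v) = YY (F v)" by (simp add: act_op_mult)
qed

section \<open>Weights and their bound\<close>

lemma wt_S: "wt n v \<Longrightarrow> v \<in> S"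
  by (simp add: wt_def)

lemma wt_K': "wt n v \<Longrightarrow> K' v = scl (q powi (- n)) v"
proof -
  assume v: "wt n v"
  have "K' (scl (q powi n) v) = v" using relations(2)[OF wt_S[OF v]] v by (simp add: wt_def)
  then have "scl (q powi n) (K' v) = v" by (simp add: op_scale)
  then have "scl (q powi (- n)) (scl (q powi n) (K' v)) = scl (q powi (- n)) v" by simp
  then show ?thesis using q_nonzero by (simp add: power_int_minus)
qed

text \<open>The conjugation relation is evaluated at K v instead of v, so that K' cancels and the
  eigenvalue of v comes out.\<close>

lemma wt_shift:
  assumes v: "wt n v" and g: "\<And>v. v \<in> S \<Longrightarrow> K (op A g (K' v)) = scl (q powi m) (op A g v)"
  shows "wt (n + m) (op A g v)"
proof -
  have vS: "v \<in> S" using v by (rule wt_S)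
  have "K (op A g (K' (K v))) = scl (q powi m) (op A g (K v))" using g vS op_closed by blast
  also have "\<dots> = scl (q powi (n + m)) (op A g v)"
    using v q_nonzero by (simp add: wt_def op_scale power_int_add mult.commute)
  finally show ?thesis using vS op_closed by (simp add: relations(2) wt_def)
qed

lemma wt_E: "wt n v \<Longrightarrow> wt (n + 2) (E v)"
  by (rule wt_shift) (simp_all add: relations)

lemma wt_F: "wt n v \<Longrightarrow> wt (n - 2) (F v)"
  using wt_shift[of n v Gen_F "- 2"] by (simp add: relations power_int_minus)

lemma wt_X: "wt n v \<Longrightarrow> wt (n + 1) (XX v)"
  by (rule wt_shift) (simp_all add: relations)

lemma wt_Y: "wt n v \<Longrightarrow> wt (n - 1) (YY v)"
  using wt_shift[of n v Gen_Y "- 1"] by (simp add: relations power_int_minus)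

lemma wt_subspace: "cs.subspace {v. wt n v}"
  using sub_S by (auto simp: cs.subspace_def wt_def op_zero op_add op_scale cs.scale_right_distrib
    mult.commute)

lemma E_F: "wt n v \<Longrightarrow> E (F v) = F (E v) + scl (qn n) v"
proof -
  assume v: "wt n v"
  have "K v - K' v = scl (q powi n - q powi (- n)) v"
    using v wt_K'[OF v] by (simp add: wt_def cs.scale_left_diff_distrib)
  then show ?thesis using relations(3)[OF wt_S[OF v]] by (simp add: qn_def)
qed

lemma wt_indep:
  assumes "finite I" "\<And>n. n \<in> I \<Longrightarrow> wt n (w n)" "(\<Sum>n\<in>I. w n) = 0"
  shows "\<forall>n\<in>I. w n = 0"
  by (rule eigen_indep[OF lin_op, of I "\<lambda>n. q powi n" Gen_K])
    (use assms powi_eq_iff in \<open>auto simp: inj_on_def wt_def\<close>)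

lemma weight_decomposable_mono:
  assumes "M \<le> N" "v \<in> weight_decomposable q K S M"
  shows "v \<in> weight_decomposable q K S N"
proof -
  obtain w where w: "\<And>n. w n \<in> S \<and> K (w n) = scl (q powi n) (w n)" "v = (\<Sum>n = - int M..int M. w n)"
    using assms(2) by (auto simp: weight_decomposable_def)
  let ?w = "\<lambda>n. if \<bar>n\<bar> \<le> int M then w n else 0"
  have "v = (\<Sum>n = - int N..int N. ?w n)"
    unfolding w(2) by (rule sum.mono_neutral_cong_left) (use assms(1) in auto)
  moreover have "?w n \<in> S \<and> K (?w n) = scl (q powi n) (?w n)" for n
    using w(1) cs.subspace_0[OF sub_S] by (simp add: op_zero)
  ultimately show ?thesis
    unfolding weight_decomposable_def by (intro CollectI exI[of _ ?w] conjI allI) auto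
qed

lemma weight_decomposable_subspace: "cs.subspace (weight_decomposable q K S N)"
  unfolding cs.subspace_def
proof (intro conjI ballI allI)
  show "0 \<in> weight_decomposable q K S N"
    using cs.subspace_0[OF sub_S] unfolding weight_decomposable_def
    by (auto intro!: exI[of _ "\<lambda>_. 0"] simp: op_zero)
next
  fix x y assume "x \<in> weight_decomposable q K S N" "y \<in> weight_decomposable q K S N"
  then obtain w w' where "\<And>n. w n \<in> S \<and> K (w n) = scl (q powi n) (w n)" "x = (\<Sum>n =
    - int N..int N. w n)"
    "\<And>n. w' n \<in> S \<and> K (w' n) = scl (q powi n) (w' n)" "y = (\<Sum>n = - int N..int N. w' n)"
    by (auto simp: weight_decomposable_def)
  then show "x + y \<in> weight_decomposable q K S N"
    using cs.subspace_add[OF sub_S] unfolding weight_decomposable_def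
    by (auto intro!: exI[of _ "\<lambda>n. w n + w' n"] simp: op_add cs.scale_right_distrib sum.distrib)
next
  fix c x assume "x \<in> weight_decomposable q K S N"
  then obtain w where "\<And>n. w n \<in> S \<and> K (w n) = scl (q powi n) (w n)" "x = (\<Sum>n =
    - int N..int N. w n)"
    by (auto simp: weight_decomposable_def)
  then show "scl c x \<in> weight_decomposable q K S N"
    using cs.subspace_scale[OF sub_S] unfolding weight_decomposable_def
    by (auto intro!: exI[of _ "\<lambda>n. scl c (w n)"] simp: op_scale cs.scale_sum_right mult.commute)
qed

lemma decomposition_bound: "\<exists>N. S \<subseteq> weight_decomposable q K S N"
proof -
  obtain B where B: "finite B" "B \<subseteq> S" "S = cs.span B" by (rule fd_space_basis[OF fd_S])
  have "\<forall>v\<in>B. \<exists>N. v \<in> weight_decomposable q K S N"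
    using model B(2) by (auto simp: is_sch_model_def)
  then obtain N where N: "\<forall>v\<in>B. v \<in> weight_decomposable q K S (N v)" by metis
  \<comment> \<open>The sum of the bounds of the basis vectors serves as a common bound.\<close>
  have "B \<subseteq> weight_decomposable q K S (\<Sum>v\<in>B. N v)"
  proof
    fix v assume v: "v \<in> B"
    then have "N v \<le> (\<Sum>v\<in>B. N v)" using B(1) by (simp add: member_le_sum)
    then show "v \<in> weight_decomposable q K S (\<Sum>v\<in>B. N v)"
      using N v weight_decomposable_mono by blast
  qed
  then have "cs.span B \<subseteq> weight_decomposable q K S (\<Sum>v\<in>B. N v)"
    using cs.span_minimal weight_decomposable_subspace by blast
  then show ?thesis using B(3) by blast
qed

definition weight_bound :: "nat \<Rightarrow> bool" where
  "weight_bound N \<longleftrightarrow> (\<forall>n v. wt n v \<longrightarrow> \<bar>n\<bar> > int N \<longrightarrow> v = 0)"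

lemma weight_bound_exists: "\<exists>N. weight_bound N"
proof -
  obtain N where N: "S \<subseteq> weight_decomposable q K S N" using decomposition_bound by blast
  have "v = 0" if v: "wt n v" and n: "\<bar>n\<bar> > int N" for n v
  proof -
    obtain w where w: "\<And>n. wt n (w n)" "v = (\<Sum>n = - int N..int N. w n)"
      using N wt_S[OF v] by (auto simp: weight_decomposable_def wt_def)
    \<comment> \<open>A weight outside the interval is a new index: adjoining -v at \<open>n\<close>
      turns the decomposition of v into a vanishing sum of vectors of distinct weights.\<close>
    let ?w = "\<lambda>m. if m = n then - v else w m" and ?I = "insert n {- int N..int N}"
    have nn: "n \<notin> {- int N..int N}" using n by auto
    have "(\<Sum>m\<in>?I. ?w m) = - v + (\<Sum>m = - int N..int N. ?w m)" using nn by simp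
    also have "(\<Sum>m = - int N..int N. ?w m) = v"
      unfolding w(2) by (rule sum.cong) (use nn in auto)
    finally have "(\<Sum>m\<in>?I. ?w m) = 0" by (simp only: add.left_inverse)
    then have "\<forall>m\<in>?I. ?w m = 0"
      by (intro wt_indep) (use w(1) v cs.subspace_neg[OF wt_subspace[of n]] in auto)
    then show ?thesis by auto
  qed
  then show ?thesis unfolding weight_bound_def by blast
qed

lemma weight_bound_mono: "\<lbrakk>weight_bound M; M \<le> N\<rbrakk> \<Longrightarrow> weight_bound N"
  by (auto simp: weight_bound_def)

lemma sl2_space: "weight_bound N \<Longrightarrow> sl2_space q E F wt N"
  by (intro sl2_space.intro generic_q_axioms sl2_space_axioms.intro; (rule lin_op wt_E wt_F
    wt_subspace E_F)?)
    (auto intro: wt_indep[rule_format] simp: weight_bound_def)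

section \<open>Highest weight vectors and the maps between their spaces\<close>

definition hw :: "nat \<Rightarrow> coords set" where
  "hw n = {v. wt (int n) v \<and> E v = 0}"

lemma hw_wt: "v \<in> hw n \<Longrightarrow> wt (int n) v" and hw_S: "v \<in> hw n \<Longrightarrow> v \<in> S" and hw_E: "v \<in> hw n \<Longrightarrow> E v = 0"
  by (auto simp: hw_def wt_def)

lemma hw_subspace: "cs.subspace (hw n)"
  using wt_subspace[of "int n"] by (auto simp: hw_def cs.subspace_def op_zero op_add op_scale)

lemma fd_hw: "fd_space (hw n)"
  using fd_S hw_subspace[of n] hw_S unfolding fd_space_def by blast

lemma hw_Fpow_zero: "v \<in> hw n \<Longrightarrow> n < k \<Longrightarrow> (F ^^ k) v = 0"
proof -
  assume v: "v \<in> hw n" "n < k"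
  obtain N where "weight_bound N" using weight_bound_exists by blast
  then interpret sl2: sl2_space q E F wt N by (rule sl2_space)
  show ?thesis using sl2.Fpow_zero[of "int n" v k] v by (simp add: hw_def sl2.hw_def)
qed

lemma hw_0_F: "v \<in> hw 0 \<Longrightarrow> F v = 0"
  using hw_Fpow_zero[of v 0 1] by simp

text \<open>The coefficients are chosen such that \<open>b\<close> maps highest weight vectors to highest weight
  vectors and \<open>b a = a b\<close> holds without any scalar.\<close>

definition a :: "coords \<Rightarrow> coords" where
  "a v = XX v"

definition b :: "nat \<Rightarrow> coords \<Rightarrow> coords" where
  "b n v = scl (qn (int n + 1)) (YY v) - scl (inverse q) (XX (F v))"

lemma lin_b: "lin (b n)"
  by (rule linI) (simp_all add: b_def op_add op_scale cs.scale_right_distrib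
    cs.scale_right_diff_distrib mult.commute)

lemma a_hw: "v \<in> hw n \<Longrightarrow> a v \<in> hw (Suc n)"
  using wt_X[of "int n" v] hw_S[of v n]
  by (simp add: hw_def a_def relations op_zero add.commute)

text \<open>E Y v = X v, and E X F v = q X E F v = q [n + 1] X v, so the two terms of
  \<open>b\<close> cancel under E.\<close>

lemma b_hw:
  assumes v: "v \<in> hw (Suc n)"
  shows "b n v \<in> hw n"
proof -
  have vS: "v \<in> S" and w: "wt (int n + 1) v" and Ev: "E v = 0"
    using v by (auto simp: hw_def wt_def add.commute)
  have "wt (int n) (YY v)" using wt_Y[OF w] by simp
  moreover have "wt (int n) (XX (F v))" using wt_X[OF wt_F[OF w]] by simp
  ultimately have "wt (int n) (b n v)"
    using cs.subspace_diff[OF wt_subspace[of "int n"]] cs.subspace_scale[OF wt_subspace[of "int n"]]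
    by (simp add: b_def)
  moreover have "E (XX (F v)) = scl (q * qn (int n + 1)) (XX v)"
    using vS op_closed E_F[OF w] Ev by (simp add: relations op_zero op_scale)
  moreover have "E (YY v) = XX v" using vS Ev by (simp add: relations op_zero)
  ultimately show ?thesis
    using q_nonzero by (simp add: hw_def b_def op_diff op_scale)
qed

lemma Y_X_hw:
  assumes v: "v \<in> hw n"
  shows "F (XX v) = scl (q powi (- int n)) (YY v) + XX (F v)"
  using relations(11)[OF hw_S[OF v]] wt_K'[OF hw_wt[OF v]] by (simp add: op_scale)

text \<open>X Y = q Y X rewrites Y X v and \<open>Y_X_hw\<close> rewrites F X v; together they lower
  the bracket from [n + 1] to [n]. The result is X applied to the formula of \<open>b\<close> with
  index n - 1, which gives \<open>b_a_Suc\<close>, while [0] = 0 and F v = 0 give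
  \<open>b_a_0\<close>.\<close>

lemma b_a_hw:
  assumes v: "v \<in> hw n"
  shows "b n (a v) = scl (qn (int n)) (XX (YY v)) - scl (inverse q) (XX (XX (F v)))"
proof -
  have YX: "YY (XX v) = scl (inverse q) (XX (YY v))"
    using q_nonzero by (simp add: relations(8)[OF hw_S[OF v]])
  have "b n (a v) = scl (qn (int n + 1) * inverse q) (XX (YY v)) - scl (inverse q * q powi (- int
    n)) (XX (YY v))
      - scl (inverse q) (XX (XX (F v)))"
    by (simp add: b_def a_def YX Y_X_hw[OF v] op_add op_scale cs.scale_right_distrib algebra_simps)
  also have "scl (qn (int n + 1) * inverse q) (XX (YY v)) - scl (inverse q * q powi (- int n)) (XX
    (YY v)) =
      scl (qn (int n)) (XX (YY v))"
  proof -
    have "qn (int n + 1) * inverse q - inverse q * q powi (- int n) = qn (int n)"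
      using q_nonzero unfolding qn_plus_1 by (simp add: ring_distribs)
    then show ?thesis by (simp only: cs.scale_left_diff_distrib[symmetric])
  qed
  finally show ?thesis .
qed

lemma b_a_0: "v \<in> hw 0 \<Longrightarrow> b 0 (a v) = 0"
  by (simp add: b_a_hw hw_0_F op_zero)

lemma b_a_Suc:
  assumes v: "v \<in> hw (Suc n)"
  shows "a (b n v) = b (Suc n) (a v)"
  unfolding b_a_hw[OF v] by (simp add: a_def b_def op_diff op_scale add.commute)

lemma Y_hw_0: "v \<in> hw 0 \<Longrightarrow> YY v = F (a v)"
  using Y_X_hw[of v 0] by (simp add: a_def hw_0_F op_zero)

text \<open>Eliminating X F v between the definition of \<open>b\<close> and \<open>Y_X_hw\<close>
  leaves Y v with the coefficient q [n + 1] + q^(-n-1) = [n + 2]. Thus Y on highest weight vectors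
  is determined by \<open>a\<close>, \<open>b\<close> and F.\<close>

lemma Y_hw_Suc:
  assumes v: "v \<in> hw (Suc n)"
  shows "YY v = scl (1 / qn (int n + 2)) (scl q (b n v) + F (a v))"
proof -
  have 1: "qn (int n + 2) = q * qn (int n + 1) + q powi (- (int n + 1))"
    using qn_plus_1[of "int n + 1"] by (simp add: algebra_simps)
  have "scl q (b n v) + F (a v) = scl (q * qn (int n + 1)) (YY v) + scl (q powi (- (int n + 1)))
    (YY v)"
    using Y_X_hw[OF v] q_nonzero by (simp add: b_def a_def cs.scale_right_diff_distrib add.commute)
  also have "\<dots> = scl (qn (int n + 2)) (YY v)"
    unfolding 1 cs.scale_left_distrib ..
  finally have "scl q (b n v) + F (a v) = scl (qn (int n + 2)) (YY v)" .
  moreover have "qn (int n + 2) \<noteq> 0" by (simp add: qn_eq_0_iff)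
  ultimately show ?thesis by simp
qed

lemma Fpow_S: "v \<in> S \<Longrightarrow> (F ^^ k) v \<in> S"
  by (induction k) (auto simp: op_closed)

lemma S_span: "S = cs.span {(F ^^ k) v |n k v. v \<in> hw n}"
proof
  obtain N where N: "S \<subseteq> weight_decomposable q K S N" using decomposition_bound by blast
  obtain M where "weight_bound M" using weight_bound_exists by blast
  then interpret sl2: sl2_space q E F wt M by (rule sl2_space)
  have hw_span: "sl2.hw_span \<subseteq> cs.span {(F ^^ k) v |n k v. v \<in> hw n}"
    unfolding sl2.hw_span_def
  proof (rule cs.span_minimal, safe)
    fix n k v assume v: "sl2.hw n v"
    show "(F ^^ k) v \<in> cs.span {(F ^^ k) v |n k v. v \<in> hw n}"
      using v
    proof (cases rule: sl2.hw_Fpow_cases[where k = k])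
      case 1 then show ?thesis by (simp add: cs.span_zero)
    next
      case (2 n')
      then have "v \<in> hw n'" using v by (simp add: hw_def sl2.hw_def)
      then show ?thesis by (intro cs.span_base) blast
    qed
  qed
  show "S \<subseteq> cs.span {(F ^^ k) v |n k v. v \<in> hw n}"
  proof
    fix v assume "v \<in> S"
    then obtain w where w: "\<And>n. wt n (w n)" "v = (\<Sum>n = - int N..int N. w n)"
      using N by (auto simp: weight_decomposable_def wt_def)
    show "v \<in> cs.span {(F ^^ k) v |n k v. v \<in> hw n}"
      unfolding w(2) by (rule cs.span_sum) (use sl2.wt_hw_span[OF w(1)] hw_span in auto)
  qed
  show "cs.span {(F ^^ k) v |n k v. v \<in> hw n} \<subseteq> S"
    using hw_S Fpow_S by (intro cs.span_minimal sub_S) blast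
qed

lemma S_induct [consumes 1, case_names hw zero add scale]:
  assumes "v \<in> S" and "\<And>n k v. v \<in> hw n \<Longrightarrow> P ((F ^^ k) v)"
    and "P 0" "\<And>u v. \<lbrakk>u \<in> S; v \<in> S; P u; P v\<rbrakk> \<Longrightarrow> P (u + v)" "\<And>c v. \<lbrakk>v \<in> S; P v\<rbrakk> \<Longrightarrow> P (scl c v)"
  shows "P v"
proof -
  have "cs.span {(F ^^ k) v |n k v. v \<in> hw n} \<subseteq> {v \<in> S. P v}"
  proof (rule cs.span_minimal)
    show "cs.subspace {v \<in> S. P v}"
      using assms(3-) sub_S by (auto simp: cs.subspace_def)
    show "{(F ^^ k) v |n k v. v \<in> hw n} \<subseteq> {v \<in> S. P v}"
      using assms(2) Fpow_S hw_S by blast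
  qed
  then show ?thesis using assms(1) S_span by blast
qed

definition hw_quiver :: quiver_model where
  "hw_quiver = \<lparr>qsp = hw, qa = (\<lambda>i. a), qb = b\<rparr>"

text \<open>Almost all vertex spaces vanish because the weights of the module are bounded.\<close>

lemma is_quiver_model_hw: "is_quiver_model hw_quiver"
proof -
  obtain N where N: "weight_bound N" using weight_bound_exists by blast
  have "hw i = {0}" if "i \<ge> Suc N" for i
  proof -
    have "v = 0" if "v \<in> hw i" for v
      using N hw_wt[OF that] \<open>i \<ge> Suc N\<close> unfolding weight_bound_def by fastforce
    then show ?thesis using cs.subspace_0[OF hw_subspace[of i]] by blast
  qed
  then show ?thesis
    unfolding is_quiver_model_def hw_quiver_def quiver_model.simps
    using fd_hw lin_b lin_op a_hw b_hw b_a_0 b_a_Suc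
    by (auto simp: a_def[abs_def])
qed

end

section \<open>The functor of highest weight vectors\<close>

definition hw_functor :: "complex \<Rightarrow>
    (sch_model, coords \<Rightarrow> coords, quiver_model, nat \<Rightarrow> coords \<Rightarrow> coords) cat_map" where
  "hw_functor q = \<lparr>omap = sch_object.hw_quiver q, mmap =
    (\<lambda>A B f i. restrict f (sch_object.hw q A i))\<rparr>"

lemma lin_maps_add: "\<lbrakk>f \<in> lin_maps S T; x \<in> S; y \<in> S\<rbrakk> \<Longrightarrow> f (x + y) = f x + f y"
  and lin_maps_scale: "\<lbrakk>f \<in> lin_maps S T; x \<in> S\<rbrakk> \<Longrightarrow> f (scl c x) = scl c (f x)"
  by (auto simp: lin_maps_def)

lemma lin_maps_zero: "\<lbrakk>f \<in> lin_maps S T; cs.subspace S\<rbrakk> \<Longrightarrow> f 0 = 0"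
  using lin_maps_scale[of f S T 0 0] cs.subspace_0[of S] by simp

lemma lin_maps_diff: "\<lbrakk>f \<in> lin_maps S T; cs.subspace S; x \<in> S; y \<in> S\<rbrakk> \<Longrightarrow> f (x - y) = f x - f y"
  using lin_maps_add[of f S T x "scl (- 1) y"] lin_maps_scale[of f S T y "- 1"]
    cs.subspace_scale[of S y "- 1"] by simp

lemma lin_mapsI:
  assumes "\<And>x. x \<in> S \<Longrightarrow> f x \<in> T" "\<And>x y. \<lbrakk>x \<in> S; y \<in> S\<rbrakk> \<Longrightarrow> f (x + y) = f x + f y"
    and "\<And>c x. x \<in> S \<Longrightarrow> f (scl c x) = scl c (f x)" "cs.subspace S"
  shows "restrict f S \<in> lin_maps S T"
  using assms by (auto simp: lin_maps_def cs.subspace_add cs.subspace_scale)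

locale sch_pair = A: sch_object q A + B: sch_object q B for q A B
begin

lemma Mor_iff:
  "f \<in> Mor (sch_model_cat q) A B \<longleftrightarrow>
    f \<in> lin_maps A.S B.S \<and> (\<forall>g. \<forall>v\<in>A.S. f (op A g v) = op B g (f v))"
  by (simp add: sch_model_cat_def)

lemma hw_Mor_iff:
  "\<phi> \<in> Mor quiver_model_cat A.hw_quiver B.hw_quiver \<longleftrightarrow>
    (\<forall>i. \<phi> i \<in> lin_maps (A.hw i) (B.hw i) \<and> (\<forall>v\<in>A.hw i. \<phi> (Suc i) (A.a v) = B.a (\<phi> i v)) \<and>
      (\<forall>v\<in>A.hw (Suc i). \<phi> i (A.b i v) = B.b i (\<phi> (Suc i) v)))"
  by (simp add: quiver_model_cat_def A.hw_quiver_def B.hw_quiver_def)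

lemma Mor_hw:
  assumes "f \<in> Mor (sch_model_cat q) A B" "v \<in> A.hw n"
  shows "f v \<in> B.hw n"
proof -
  have f: "f \<in> lin_maps A.S B.S" "\<And>g v. v \<in> A.S \<Longrightarrow> op B g (f v) = f (op A g v)"
    using assms(1) by (auto simp: Mor_iff)
  note vS = A.hw_S[OF assms(2)]
  show ?thesis
    using assms(2) lin_maps_mem[OF f(1) vS] lin_maps_zero[OF f(1) A.sub_S] lin_maps_scale[OF f(1)
      vS]
    by (simp add: A.hw_def B.hw_def A.wt_def B.wt_def f(2)[OF vS])
qed

lemma hw_functor_Mor:
  assumes f: "f \<in> Mor (sch_model_cat q) A B"
  shows "(\<lambda>i. restrict f (A.hw i)) \<in> Mor quiver_model_cat A.hw_quiver B.hw_quiver"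
  unfolding hw_Mor_iff
proof (intro allI conjI ballI)
  have fl: "f \<in> lin_maps A.S B.S" and fo: "\<And>g v. v \<in> A.S \<Longrightarrow> f (op A g v) = op B g (f v)"
    using f by (auto simp: Mor_iff)
  fix i
  show "restrict f (A.hw i) \<in> lin_maps (A.hw i) (B.hw i)"
    by (rule lin_mapsI)
      (use Mor_hw[OF f] lin_maps_add[OF fl] lin_maps_scale[OF fl] A.hw_S A.hw_subspace in auto)
  show "restrict f (A.hw (Suc i)) (A.a v) = B.a (restrict f (A.hw i) v)" if "v \<in> A.hw i" for v
    using that A.a_hw[OF that] A.hw_S[OF that] by (simp add: fo A.a_def B.a_def)
  show "restrict f (A.hw i) (A.b i v) = B.b i (restrict f (A.hw (Suc i)) v)"
    if "v \<in> A.hw (Suc i)" for v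
    using that A.b_hw[OF that] A.hw_S[OF that]
    by (simp add: A.b_def B.b_def fo A.op_closed lin_maps_diff[OF fl A.sub_S]
      lin_maps_scale[OF fl] cs.subspace_scale[OF A.sub_S])
qed

text \<open>The vectors F^k v span the module, and a morphism sends F^k v to F^k applied to its
  value at v.\<close>

lemma hw_functor_faithful:
  assumes f: "f \<in> Mor (sch_model_cat q) A B" and g: "g \<in> Mor (sch_model_cat q) A B"
    and eq: "\<And>i. restrict f (A.hw i) = restrict g (A.hw i)"
  shows "f = g"
proof (rule lin_maps_ext[of f A.S B.S])
  have l: "f \<in> lin_maps A.S B.S" "g \<in> lin_maps A.S B.S"
    and o: "\<And>h v. v \<in> A.S \<Longrightarrow> f (op A h v) = op B h (f v)" "\<And>h v. v \<in> A.S
      \<Longrightarrow> g (op A h v) = op B h (g v)"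
    using f g by (auto simp: Mor_iff)
  then show "f \<in> lin_maps A.S B.S" "g \<in> lin_maps A.S B.S" by auto
  fix v assume "v \<in> A.S"
  then show "f v = g v"
  proof (induction v rule: A.S_induct)
    case (hw n k v)
    have "f v = g v" using eq[of n] hw by (metis restrict_apply')
    then show ?case
      using A.hw_S[OF hw] by (induction k) (auto simp: o A.Fpow_S)
  qed (auto simp: lin_maps_add[OF l(1)] lin_maps_add[OF l(2)] lin_maps_scale[OF l(1)]
    lin_maps_scale[OF l(2)]
      lin_maps_zero[OF l(1) A.sub_S] lin_maps_zero[OF l(2) A.sub_S])
qed

text \<open>The extension must send F^k v to F^k applied to the image of v; uniqueness of the normal
  form makes this well defined and linear. Commutation with K follows from the weights, with E by
  induction on k, and with X and Y first at k = 0 through \<open>a\<close> and \<open>b\<close> and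
  then for all k through their relations with F.\<close>

lemma hw_functor_full:
  assumes \<phi>: "\<phi> \<in> Mor quiver_model_cat A.hw_quiver B.hw_quiver"
  shows "\<exists>f\<in>Mor (sch_model_cat q) A B. (\<lambda>i. restrict f (A.hw i)) = \<phi>"
proof -
  have \<phi>l: "\<And>n. \<phi> n \<in> lin_maps (A.hw n) (B.hw n)"
    and \<phi>a: "\<And>n v. v \<in> A.hw n \<Longrightarrow> \<phi> (Suc n) (A.a v) = B.a (\<phi> n v)"
    and \<phi>b: "\<And>n v. v \<in> A.hw (Suc n) \<Longrightarrow> \<phi> n (A.b n v) = B.b n (\<phi> (Suc n) v)"
    using \<phi> by (auto simp: hw_Mor_iff)
  note \<phi>m = lin_maps_mem[OF \<phi>l] and \<phi>add = lin_maps_add[OF \<phi>l] and \<phi>scale = lin_maps_scale[OF \<phi>l]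
    and \<phi>0 = lin_maps_zero[OF \<phi>l A.hw_subspace]
  obtain NA NB where "A.weight_bound NA" "B.weight_bound NB"
    using A.weight_bound_exists B.weight_bound_exists by blast
  \<comment> \<open>One bound for both modules lets their normal forms run over the same
    indices.\<close>
  then obtain N where NA: "A.weight_bound N" and NB: "B.weight_bound N"
    using A.weight_bound_mono[of NA "max NA NB"] B.weight_bound_mono[of NB "max NA NB"] by auto
  interpret sa: sl2_space q A.E A.F A.wt N by (rule A.sl2_space[OF NA])
  interpret sb: sl2_space q B.E B.F B.wt N by (rule B.sl2_space[OF NB])
  have sa_hw: "sa.hw (int n) v \<longleftrightarrow> v \<in> A.hw n" and sb_hw: "sb.hw (int n) v \<longleftrightarrow> v \<in> B.hw n" for n v
    by (simp_all add: sa.hw_def sb.hw_def A.hw_def B.hw_def)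
  have S_hw_span: "A.S = sa.hw_span"
  proof -
    have "A.S \<subseteq> sa.hw_span"
      unfolding sa.hw_span_def by (subst A.S_span) (intro cs.span_mono, use sa_hw in blast)
    moreover have "sa.hw_span \<subseteq> A.S"
      unfolding sa.hw_span_def
      by (rule cs.span_minimal[OF _ A.sub_S]) (auto simp: sa.hw_def A.wt_def intro: A.Fpow_S)
    ultimately show ?thesis by blast
  qed
  define push where "push c = (\<lambda>n k. \<phi> n (c n k))" for c :: "nat \<Rightarrow> nat \<Rightarrow> coords"
  have ca: "c n k \<in> A.hw n" if "sa.admissible c" for c n k
    using that by (simp add: sa.admissible_def sa_hw)
  have push: "sb.admissible (push c)" if "sa.admissible c" for c
    using that \<phi>m \<phi>0 by (auto simp: sb.admissible_def sa.admissible_def push_def sa_hw sb_hw)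
  define co where "co v = (SOME c. sa.admissible c \<and> v = sa.comb c)" for v
  have co: "sa.admissible (co v)" "v = sa.comb (co v)" if "v \<in> A.S" for v
    using someI_ex[OF sa.comb_exists[of v]] that unfolding S_hw_span co_def by auto
  have co_eq: "co v = c" if "v \<in> A.S" "sa.admissible c" "v = sa.comb c" for v c
    using sa.comb_unique[of "co v" c] co[OF that(1)] that by simp
  define f where "f = restrict (\<lambda>v. sb.comb (push (co v))) A.S"
  have f_comb: "f v = sb.comb (push c)" if "v \<in> A.S" "sa.admissible c" "v = sa.comb c" for v c
    using co_eq[OF that] that(1) by (simp add: f_def)
  have f_add: "f (u + v) = f u + f v" if "u \<in> A.S" "v \<in> A.S" for u v
  proof -
    have "f (u + v) = sb.comb (push (\<lambda>n k. co u n k + co v n k))"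
      by (rule f_comb)
        (use that co cs.subspace_add[OF A.sub_S] sa.admissible_add in \<open>simp_all add: sa.comb_add\<close>)
    also have "push (\<lambda>n k. co u n k + co v n k) = (\<lambda>n k. push (co u) n k + push (co v) n k)"
      using ca[OF co(1)[OF that(1)]] ca[OF co(1)[OF that(2)]] by (simp add: push_def \<phi>add)
    finally show ?thesis using that by (simp add: sb.comb_add f_def)
  qed
  have f_scale: "f (scl c v) = scl c (f v)" if "v \<in> A.S" for c v
  proof -
    have "f (scl c v) = sb.comb (push (\<lambda>n k. scl c (co v n k)))"
      by (rule f_comb)
        (use that co cs.subspace_scale[OF A.sub_S] sa.admissible_scale in \<open>simp_all add:
          sa.comb_scale\<close>)
    also have "push (\<lambda>n k. scl c (co v n k)) = (\<lambda>n k. scl c (push (co v) n k))"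
      using ca[OF co(1)[OF that]] by (simp add: push_def \<phi>scale)
    finally show ?thesis using that by (simp add: sb.comb_scale f_def)
  qed
  have f_0: "f 0 = 0" using f_scale[of 0 0] cs.subspace_0[OF A.sub_S] by simp
  have f_Fpow: "f ((A.F ^^ k) v) = (B.F ^^ k) (\<phi> n v)" if v: "v \<in> A.hw n" for n k v
  proof -
    note vS = A.Fpow_S[OF A.hw_S[OF v]]
    consider "k \<le> n" "n \<le> N" | "k > n" | "n > N" by linarith
    then show ?thesis
    proof cases
      case 1
      let ?c = "\<lambda>n' k'. if n' = n \<and> k' = k then v else 0"
      let ?d = "\<lambda>n' k'. if n' = n \<and> k' = k then \<phi> n v else 0"
      have "f ((A.F ^^ k) v) = sb.comb (push ?c)"
        by (rule f_comb) (use vS sa.admissible_single[of n v k] 1 v sa_hw in auto)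
      also have "push ?c = ?d" by (auto simp: push_def \<phi>0 fun_eq_iff)
      also have "sb.comb ?d = (B.F ^^ k) (\<phi> n v)"
        by (rule sb.admissible_single(2)) (use 1 v \<phi>m sb_hw in auto)
      finally show ?thesis .
    next
      case 2
      then show ?thesis
        using A.hw_Fpow_zero[OF v] B.hw_Fpow_zero[OF \<phi>m[OF v]] f_0 by simp
    next
      case 3
      then have "v = 0" using sa.wt_bound[OF A.hw_wt[OF v]] by simp
      then show ?thesis by (simp add: \<phi>0 f_0 lin_zero[OF sa.lin_Fpow] lin_zero[OF sb.lin_Fpow])
    qed
  qed
  have f_S: "f v \<in> B.S" if "v \<in> A.S" for v
    using that
  proof (induction v rule: A.S_induct)
    case (hw n k v)
    then show ?case using f_Fpow[OF hw] B.Fpow_S[OF B.hw_S[OF \<phi>m[OF hw]]] by simp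
  qed (use f_add f_scale f_0 B.sub_S in \<open>auto simp: cs.subspace_def\<close>)
  have f_hw: "f v = \<phi> n v" if "v \<in> A.hw n" for n v
    using f_Fpow[OF that, of 0] by simp
  have commute: "f (op A g v) = op B g (f v)"
    if v: "v \<in> A.S" and gen: "\<And>n k v. v \<in> A.hw n \<Longrightarrow>
      f (op A g ((A.F ^^ k) v)) = op B g ((B.F ^^ k) (\<phi> n v))" for g v
    using v
  proof (induction v rule: A.S_induct)
    case (hw n k v)
    then show ?case using gen f_Fpow by simp
  qed (auto simp: f_add f_scale f_0 A.op_add B.op_add A.op_scale B.op_scale A.op_zero B.op_zero
    A.op_closed)
  have cF: "f (A.F v) = B.F (f v)" if "v \<in> A.S" for v
  proof (rule commute[OF that])
    fix n k v assume "v \<in> A.hw n"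
    then show "f (A.F ((A.F ^^ k) v)) = B.F ((B.F ^^ k) (\<phi> n v))"
      using f_Fpow[of v n "Suc k"] by simp
  qed
  have wA: "A.wt (int n - 2 * int k) ((A.F ^^ k) v)"
    and wB: "B.wt (int n - 2 * int k) ((B.F ^^ k) (\<phi> n v))" if "v \<in> A.hw n" for n k v
    using sa.wt_Fpow[OF A.hw_wt[OF that]] sb.wt_Fpow[OF B.hw_wt[OF \<phi>m[OF that]]] by auto
  have cK: "f (A.K v) = B.K (f v)" if "v \<in> A.S" for v
    by (rule commute[OF that])
      (use wA wB f_Fpow in \<open>simp add: A.wt_def B.wt_def f_scale\<close>)
  have cK': "f (A.K' v) = B.K' (f v)" if "v \<in> A.S" for v
    by (rule commute[OF that])
      (simp add: A.wt_K'[OF wA] B.wt_K'[OF wB] f_scale A.Fpow_S A.hw_S f_Fpow)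
  have cE: "f (A.E v) = B.E (f v)" if "v \<in> A.S" for v
  proof (rule commute[OF that])
    fix n k v assume v: "v \<in> A.hw n"
    show "f (A.E ((A.F ^^ k) v)) = B.E ((B.F ^^ k) (\<phi> n v))"
    proof (induction k)
      case 0
      then show ?case using A.hw_E[OF v] B.hw_E[OF \<phi>m[OF v]] f_0 by simp
    next
      case (Suc k)
      note vS = A.Fpow_S[OF A.hw_S[OF v], of k]
      show ?case
        using A.E_F[OF wA[OF v, of k]] B.E_F[OF wB[OF v, of k]] vS Suc f_Fpow[OF v, of k]
        by (simp add: f_add f_scale cF A.op_closed cs.subspace_scale[OF A.sub_S])
    qed
  qed
  have cX0: "f (A.XX v) = B.XX (\<phi> n v)" if v: "v \<in> A.hw n" for n v
    using f_hw[OF A.a_hw[OF v]] \<phi>a[OF v] by (simp add: A.a_def B.a_def)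
  \<comment> \<open>\<open>Y_hw_0\<close> and \<open>Y_hw_Suc\<close> express Y through
    \<open>a\<close>, \<open>b\<close> and F, with which \<open>f\<close> is already known to be
    compatible.\<close>
  have cY0: "f (A.YY v) = B.YY (\<phi> n v)" if v: "v \<in> A.hw n" for n v
  proof (cases n)
    case 0
    then show ?thesis
      using A.Y_hw_0[of v] B.Y_hw_0[of "\<phi> 0 v"] v \<phi>m[OF v] cX0[OF v] cF[of "A.a v"]
      by (simp add: A.a_def B.a_def A.op_closed A.hw_S)
  next
    case (Suc m)
    have vS: "v \<in> A.hw (Suc m)" using v Suc by simp
    have bS: "A.b m v \<in> A.S" "A.F (A.a v) \<in> A.S"
      using A.b_hw[OF vS] A.a_hw[OF vS] A.hw_S A.op_closed by auto
    have "f (A.YY v) = scl (1 / A.qn (int m + 2)) (scl q (\<phi> m (A.b m v)) + B.F (\<phi> (Suc (Suc m))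
      (A.a v)))"
      unfolding A.Y_hw_Suc[OF vS] using bS f_hw[OF A.b_hw[OF vS]] f_hw[OF A.a_hw[OF vS]] A.hw_S[OF
        A.a_hw[OF vS]]
      by (simp add: f_scale f_add cF cs.subspace_scale[OF A.sub_S] cs.subspace_add[OF A.sub_S])
    also have "\<dots> = B.YY (\<phi> (Suc m) v)"
      unfolding B.Y_hw_Suc[OF \<phi>m[OF vS]] \<phi>a[OF vS] \<phi>b[OF vS] ..
    finally show ?thesis using Suc by simp
  qed
  have cY: "f (A.YY v) = B.YY (f v)" if "v \<in> A.S" for v
  proof (rule commute[OF that])
    fix n k v assume v: "v \<in> A.hw n"
    show "f (A.YY ((A.F ^^ k) v)) = B.YY ((B.F ^^ k) (\<phi> n v))"
    proof (induction k)
      case 0 show ?case using cY0[OF v] by simp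
    next
      case (Suc k)
      then show ?case
        using A.Fpow_S[OF A.hw_S[OF v], of k] B.Fpow_S[OF B.hw_S[OF \<phi>m[OF v]], of k]
        by (simp add: A.relations(12)[symmetric] B.relations(12)[symmetric] cF A.op_closed)
    qed
  qed
  \<comment> \<open>Y has to be settled before X: the power k + 1 is reduced to k by X F u = F X u -
    Y K' u.\<close>
  have cX: "f (A.XX v) = B.XX (f v)" if "v \<in> A.S" for v
  proof (rule commute[OF that])
    fix n k v assume v: "v \<in> A.hw n"
    show "f (A.XX ((A.F ^^ k) v)) = B.XX ((B.F ^^ k) (\<phi> n v))"
    proof (induction k)
      case 0 show ?case using cX0[OF v] by simp
    next
      case (Suc k)
      let ?u = "(A.F ^^ k) v" and ?w = "(B.F ^^ k) (\<phi> n v)"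
      have uS: "?u \<in> A.S" "?w \<in> B.S"
        using A.Fpow_S[OF A.hw_S[OF v]] B.Fpow_S[OF B.hw_S[OF \<phi>m[OF v]]] by auto
      have "f (A.F (A.XX ?u)) = f (A.YY (A.K' ?u)) + f (A.XX (A.F ?u))"
        unfolding A.relations(11)[OF uS(1)] by (rule f_add) (use uS A.op_closed in auto)
      moreover have "f (A.F (A.XX ?u)) = B.F (B.XX ?w)"
        using Suc uS by (simp add: cF A.op_closed)
      moreover have "f (A.YY (A.K' ?u)) = B.YY (B.K' ?w)"
        using uS f_Fpow[OF v] by (simp add: cY cK' A.op_closed)
      ultimately show ?case using B.relations(11)[OF uS(2)] by simp
    qed
  qed
  have "f (op A g v) = op B g (f v)" if "v \<in> A.S" for g v
    by (cases g) (use that cE cF cK cK' cX cY A.op_Z B.op_Z f_0 f_S in auto)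
  moreover have "f \<in> lin_maps A.S B.S"
    using f_S f_add f_scale by (auto simp: lin_maps_def f_def)
  ultimately have "f \<in> Mor (sch_model_cat q) A B" by (simp add: Mor_iff)
  moreover have "restrict f (A.hw n) = \<phi> n" for n
    using f_hw \<phi>l[of n] by (auto simp: lin_maps_def fun_eq_iff PiE_iff extensional_def)
  ultimately show ?thesis by (intro bexI[of _ f]) auto
qed

end

section \<open>The module of a quiver representation\<close>

text \<open>Pairing of natural numbers packs a doubly indexed family of coordinate vectors into one
  vector, so that the module built from a representation stays in the same ambient space.\<close>

definition slice :: "coords \<Rightarrow> nat \<Rightarrow> nat \<Rightarrow> coords" where
  "slice f n k = (\<lambda>j. f (prod_encode (n, prod_encode (k, j))))"

definition assemble :: "(nat \<Rightarrow> nat \<Rightarrow> coords) \<Rightarrow> coords" where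
  "assemble g = (\<lambda>m. g (fst (prod_decode m)) (fst (prod_decode (snd (prod_decode m))))
     (snd (prod_decode (snd (prod_decode m)))))"

lemma slice_assemble [simp]: "slice (assemble g) n k = g n k"
  by (simp add: slice_def assemble_def)

lemma slice_eqI: "(\<And>n k. slice f n k = slice g n k) \<Longrightarrow> f = g"
proof
  fix m assume "\<And>n k. slice f n k = slice g n k"
  then have "slice f (fst (prod_decode m)) (fst (prod_decode (snd (prod_decode m))))
      (snd (prod_decode (snd (prod_decode m)))) =
    slice g (fst (prod_decode m)) (fst (prod_decode (snd (prod_decode m))))
      (snd (prod_decode (snd (prod_decode m))))" by simp
  then show "f m = g m" by (simp add: slice_def)
qed

lemma slice_simps [simp]:
  "slice (f + g) n k = slice f n k + slice g n k" "slice (scl c f) n k = scl c (slice f n k)"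
  "slice 0 n k = 0" "slice (f - g) n k = slice f n k - slice g n k"
  by (simp_all add: slice_def fun_eq_iff coords_apply)

lemma slice_sum: "slice (sum f I) n k = (\<Sum>i\<in>I. slice (f i) n k)"
  by (induction I rule: infinite_finite_induct) auto

text \<open>This is the mirror image of \<open>qn_plus_1\<close> under exchange of q and its
  inverse. It follows from that lemma at -(n + 1), since \<open>qn\<close> is odd.\<close>

lemma (in generic_q) qn_plus_1': "qn (n + 1) = inverse q * qn n + q powi n"
proof -
  have e: "- (n + 1) + 1 = - n" "- (- (n + 1)) = n + 1" by simp_all
  have *: "- qn n = - q * qn (n + 1) + q powi (n + 1)"
    using qn_plus_1[of "- (n + 1)"] unfolding e qn_minus by simp
  have "q * qn (n + 1) = q powi (n + 1) - (- q * qn (n + 1) + q powi (n + 1))" by simp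
  also have "\<dots> = qn n + q powi (n + 1)" unfolding *[symmetric] by simp
  finally have "q * qn (n + 1) = qn n + q powi n * q" using q_nonzero by (simp add: power_int_add)
  then have "inverse q * (q * qn (n + 1)) = inverse q * (qn n + q powi n * q)" by simp
  moreover have "inverse q * (p * q) = p" "inverse q * (q * p) = p" for p
    using q_nonzero by (simp_all add: mult.commute[of p] mult.assoc[symmetric])
  ultimately show ?thesis by (simp only: distrib_left)
qed

text \<open>This is the scalar content of X Y = q Y X on the terms with one \<open>a\<close> and one
  \<open>b\<close>, after clearing denominators. The brackets contribute the same factor
  \<open>t * t\<close> everywhere, and what remains is an identity of Laurent polynomials.\<close>

lemma (in generic_q) qn_exchange:
  "q powi (k + 1) * qn (n - k) * qn (n + 2) - q powi (k - n) * qn (k + 1) * qn n =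
   q powi (k + 2) * qn (n + 1 - k) * qn n - q powi (k - n + 1) * qn k * qn (n + 2)"
proof -
  define a b a' b' where "a = q powi n" "b = q powi k" "a' = q powi (- n)" "b' = q powi (- k)"
  define t q' where "t = inverse (q - inverse q)" "q' = inverse q"
  have h: "a * a' = 1" "b * b' = 1" "q * q' = 1"
    using q_nonzero by (simp_all add: a_b_a'_b'_def t_q'_def power_int_minus)
  have qn: "qn m = t * (q powi m - q powi (- m))" for m
    by (simp add: qn_def t_q'_def divide_inverse)
  have p: "q powi (k + 1) = b * q" "q powi (- (k + 1)) = b' * q'" "q powi (n - k) = a * b'"
    "q powi (- (n - k)) = a' * b" "q powi (k - n) = b * a'" "q powi (n + 2) = a * q * q"
    "q powi (- (n + 2)) = a' * q' * q'" "q powi (k + 2) = b * q * q" "q powi (n + 1 - k) =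
      a * b' * q"
    "q powi (- (n + 1 - k)) = a' * b * q'" "q powi (k - n + 1) = b * a' * q"
    using q_nonzero
    by (simp_all add: a_b_a'_b'_def t_q'_def power_int_add power_int_diff power_int_minus
      divide_inverse power2_eq_square)
  have "b * q * (t * (a * b' - a' * b)) * (t * (a * q * q - a' * q' * q'))
      - b * a' * (t * (b * q - b' * q')) * (t * (a - a')) =
    b * q * q * (t * (a * b' * q - a' * b * q')) * (t * (a - a'))
      - b * a' * q * (t * (b - b')) * (t * (a * q * q - a' * q' * q'))"
  proof -
    have "b * q * (a * b' - a' * b) * (a * q * q - a' * q' * q') - b * a' * (b * q - b' * q') * (a
      - a') =
      b * q * q * (a * b' * q - a' * b * q') * (a - a') - b * a' * q * (b - b') * (a * q * q - a'
        * q' * q')"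
    proof -
      have h': "a * (a' * x) = x" "b * (b' * x) = x" "q * (q' * x) = x" for x
        using h by (simp_all add: mult.assoc[symmetric])
      show ?thesis by (simp add: algebra_simps h h')
    qed
    then have "(t * t) * (b * q * (a * b' - a' * b) * (a * q * q - a' * q' * q') - b * a' * (b * q
      - b' * q') * (a - a')) =
      (t * t) * (b * q * q * (a * b' * q - a' * b * q') * (a - a') - b * a' * q * (b - b') * (a *
        q * q - a' * q' * q'))"
      by simp
    then show ?thesis by (simp add: algebra_simps)
  qed
  then show ?thesis
    by (simp only: qn p) (simp only: a_b_a'_b'_def[symmetric])
qed

locale quiver_object = generic_q +
  fixes W :: quiver_model
  assumes model: "is_quiver_model W"
begin

abbreviation "a \<equiv> qa W"
abbreviation "b \<equiv> qb W"

lemma lin_a: "lin (a i)" and lin_b: "lin (b i)" and fd_W: "fd_space (qsp W i)"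
  and sub_W: "cs.subspace (qsp W i)"
  and a_closed: "v \<in> qsp W i \<Longrightarrow> a i v \<in> qsp W (Suc i)"
  and b_closed: "v \<in> qsp W (Suc i) \<Longrightarrow> b i v \<in> qsp W i"
  and b_a_0: "v \<in> qsp W 0 \<Longrightarrow> b 0 (a 0 v) = 0"
  and a_b: "v \<in> qsp W (Suc i) \<Longrightarrow> a i (b i v) = b (Suc i) (a (Suc i) v)"
  using model by (auto simp: is_quiver_model_def fd_space_def)

lemmas ab_add = lin_add[OF lin_a] lin_add[OF lin_b]
  and ab_scale = lin_scale[OF lin_a] lin_scale[OF lin_b]
  and ab_zero = lin_zero[OF lin_a] lin_zero[OF lin_b]

text \<open>This models the direct sum over n of L(n) tensor V_n, where L(n) is the simple module of
  dimension n + 1 with a basis indexed by the powers F^0, ..., F^n.\<close>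

definition C :: "coords set" where
  "C = {f. (\<forall>n k. slice f n k \<in> qsp W n) \<and> (\<forall>n k. n < k \<longrightarrow> slice f n k = 0)}"

text \<open>
  The component \<open>slice f n k\<close> is the coefficient of \<open>F\<^sup>k\<close>, a vector of \<open>V\<^sub>n\<close>; the constants
  below are the matrix coefficients of the generators.  At \<open>n = 0\<close> the values of \<open>cXu\<close> and \<open>cYu\<close>
  are junk (division by \<open>[0]\<close>) and do not occur.
\<close>

definition cE :: "nat \<Rightarrow> nat \<Rightarrow> complex" where
  "cE n k = qn (int k + 1) * qn (int n - int k)"

definition cK :: "nat \<Rightarrow> nat \<Rightarrow> complex" where
  "cK n k = q powi (int n - 2 * int k)"

definition cK' :: "nat \<Rightarrow> nat \<Rightarrow> complex" where
  "cK' n k = q powi (2 * int k - int n)"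

text \<open>The indices name the target of a term, whereas the formulas for X and Y on F^k v name
  its source. The letter u marks the terms with \<open>a\<close>, whose source has index n - 1, and
  d marks those with \<open>b\<close>, whose source has index n + 1.\<close>

definition cXu :: "nat \<Rightarrow> nat \<Rightarrow> complex" where
  "cXu n k = q powi int k * qn (int n - int k) / qn (int n)"

definition cXd :: "nat \<Rightarrow> nat \<Rightarrow> complex" where
  "cXd n k = - (q powi (int k - int n) * qn (int k + 1) / qn (int n + 2))"

definition cYu :: "nat \<Rightarrow> complex" where
  "cYu n = 1 / qn (int n)"

definition cYd :: "nat \<Rightarrow> complex" where
  "cYd n = q / qn (int n + 2)"

section \<open>Scalar identities behind the relations\<close>

lemma cK_cK': "cK n k * cK' n k = 1" "cK' n k * cK n k = 1"
  "cK n k * cK' n (Suc k) = q ^ 2" "cK n (Suc k) * cK' n k = inverse (q ^ 2)"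
  "cK (Suc n) k * cK' n k = q" "cK n k * cK' (Suc n) (Suc k) = q"
  "cK (Suc n) (Suc k) * cK' n k = inverse q" "cK n k * cK' (Suc n) k = inverse q"
  using q_nonzero
  by (simp_all add: cK_def cK'_def power_int_add[symmetric] power_int_minus[symmetric]
    power_int_minus)

lemma cK_qn: "1 / (q - inverse q) * (cK n k - cK' n k) = qn (int n - 2 * int k)"
  by (simp add: cK_def cK'_def qn_def)

text \<open>The zeros at k = n make the truncation of the strings after F^n compatible with E and
  X.\<close>

lemma cE_edge: "cE n n = 0" "cXu n n = 0" "cE n 0 = qn (int n)" "cXu (Suc n) 0 = 1"
  by (simp_all add: cE_def cXu_def qn_eq_0_iff)

lemma cE_comm: "cE n (Suc k) = cE n k + qn (int n - 2 * int (Suc k))"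
  using qn_commutator[of "int (Suc k)" "int n"] by (simp add: cE_def algebra_simps)

text \<open>This identity and those below compare, for one relation of the algebra, the coefficients
  of one kind of term at a fixed target.\<close>

lemma cE_cXu: "cE (Suc m) k * cXu (Suc m) (Suc k) = q * (cXu (Suc m) k * cE m k)"
  using q_nonzero by (simp add: cE_def cXu_def power_int_add algebra_simps)

lemma cE_cXd: "cE n k * cXd n (Suc k) = q * (cXd n k * cE (Suc n) (Suc k))"
  using q_nonzero by (simp add: cE_def cXd_def power_int_add power_int_diff algebra_simps)

lemma cE_cYu: "cE (Suc m) (Suc l) * cYu (Suc m) = cXu (Suc m) (Suc l) + inverse q * (cYu (Suc m) *
  cE m l)"
  using qn_plus_1'[of "int l + 1"]
  by (simp add: cE_def cYu_def cXu_def add_divide_distrib ring_distribs add.commute)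

lemma cE_cYd: "cE n k * cYd n = cXd n k + inverse q * (cYd n * cE (Suc n) k)"
proof -
  have 1: "qn (int (Suc n) - int k) = q * qn (int n - int k) + q powi (int k - int n)"
    using qn_plus_1[of "int n - int k"] by (simp add: algebra_simps)
  show ?thesis
    unfolding cE_def cYd_def cXd_def 1 using q_nonzero qn_eq_0_iff[of "int n + 2"]
    by (simp add: field_simps)
qed

lemma cYd_cK': "cYd n * cK' (Suc n) 0 + cXd n 0 = 0"
  using q_nonzero by (simp add: cYd_def cK'_def cXd_def power_int_diff power_int_add
    power_int_minus field_simps)

lemma cXd_Suc: "cXd n l = cYd n * cK' (Suc n) (Suc l) + cXd n (Suc l)"
proof -
  define R P N2 where "R = q powi (int l - int n)" "P = q powi int l" "N2 = qn (int n + 2)"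
  have 1: "qn (int (Suc l) + 1) = inverse q * qn (int l + 1) + P * q"
    using qn_plus_1'[of "int l + 1"] q_nonzero by (simp add: R_P_N2_def power_int_add add.commute)
  have 2: "q powi (int (Suc l) - int n) = R * q" "q powi (2 * int (Suc l) - int (Suc n)) =
    R * P * q"
  proof -
    have e: "int (Suc l) - int n = (int l - int n) + 1" "2 * int (Suc l) - int (Suc n) =
      (int l - int n) + int l + 1"
      by simp_all
    show "q powi (int (Suc l) - int n) = R * q" "q powi (2 * int (Suc l) - int (Suc n)) = R * P * q"
      unfolding e R_P_N2_def power_int_add[OF disjI1[OF q_nonzero]] power_int_1_right
        by (rule refl)+
  qed
  show ?thesis
    unfolding cXd_def cYd_def cK'_def 1 2 R_P_N2_def(1,3)[symmetric] using q_nonzero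
    by (simp add: ring_distribs add_divide_distrib)
qed

lemma cXu_Suc: "cXu (Suc m) l = cYu (Suc m) * cK' m l + cXu (Suc m) (Suc l)"
proof -
  define R P where "R = q powi (int l - int m)" "P = q powi int l"
  have 1: "qn (int (Suc m) - int l) = q * qn (int (Suc m) - int (Suc l)) + R"
    using qn_plus_1[of "int m - int l"] by (simp add: R_P_def algebra_simps)
  have 2: "q powi int (Suc l) = P * q" "q powi (2 * int l - int m) = P * R"
  proof -
    have e: "int (Suc l) = int l + 1" "2 * int l - int m = int l + (int l - int m)" by simp_all
    show "q powi int (Suc l) = P * q" "q powi (2 * int l - int m) = P * R"
      unfolding e R_P_def power_int_add[OF disjI1[OF q_nonzero]] power_int_1_right by (rule refl)+
  qed
  show ?thesis
    unfolding cXu_def cYu_def cK'_def 1 2 R_P_def(2)[symmetric]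
    by (simp add: ring_distribs add_divide_distrib)
qed

lemma cXd_cYd: "cXd n k * cYd (Suc n) = q * (cYd n * cXd (Suc n) k)"
  using q_nonzero by (simp add: cXd_def cYd_def power_int_diff power_int_add algebra_simps)

lemma cXu_cYu: "cXu (Suc (Suc p)) (Suc l) * cYu (Suc p) = q * (cYu (Suc (Suc p)) * cXu (Suc p) l)"
  using q_nonzero by (simp add: cXu_def cYu_def power_int_add algebra_simps)

text \<open>It collects the terms with one \<open>a\<close> and one \<open>b\<close> in X Y = q Y X.
  The last summand is written with [k] instead of \<open>cXd m (k - 1)\<close>, so that one proof
  serves k = 0, where it is zero, and k > 0, where it is that coefficient up to sign.\<close>

lemma cX_cY_exchange:
  "cXd (Suc m) k * cYu (Suc (Suc m)) + cXu (Suc m) k * cYd m =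
   q * (cYd (Suc m) * cXu (Suc (Suc m)) k) - q * (cYu (Suc m) * (q powi (int k - int (Suc m)) * qn
     (int k) / qn (int (Suc (Suc m)))))"
proof -
  define n where "n = int (Suc m)"
  define N0 N1 N2 where "N0 = qn n" "N1 = qn (n + 1)" "N2 = qn (n + 2)"
  have nz: "N0 \<noteq> 0" "N1 \<noteq> 0" "N2 \<noteq> 0" by (simp_all add: N0_N1_N2_def qn_eq_0_iff n_def)
  define P R where "P = q powi int k" "R = q powi (int k - n)"
  have "q powi (int k + 1) = P * q" "q powi (int k + 2) = P * q * q" "q powi (int k - n + 1) =
    R * q"
    using q_nonzero by (simp_all add: P_R_def power_int_add power2_eq_square)
  then have ex: "P * q * qn (n - int k) * N2 - R * qn (int k + 1) * N0 =
      P * q * q * qn (n + 1 - int k) * N0 - R * q * qn (int k) * N2"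
    using qn_exchange[of "int k" n] by (simp only: N0_N1_N2_def P_R_def)
  have i: "int (Suc m) = n" "int (Suc (Suc m)) = n + 1" "int m + 2 = n + 1" by (simp_all add: n_def)
  have "- (R * qn (int k + 1) / N2) * (1 / N1) + P * qn (n - int k) / N0 * (q / N1) =
      (P * q * qn (n - int k) * N2 - R * qn (int k + 1) * N0) / (N0 * N1 * N2)"
    using nz by (simp add: field_simps)
  also have "\<dots> = q * (q / N2 * (P * qn (n + 1 - int k) / N1)) - q * (1 / N0 * (R * qn (int k) /
    N1))"
    unfolding ex using nz by (simp add: field_simps)
  finally show ?thesis
    unfolding cXd_def cYu_def cXu_def cYd_def i N0_N1_N2_def P_R_def .
qed

lemma cX_cY_0: "cXd (Suc m) 0 * cYu (Suc (Suc m)) + cXu (Suc m) 0 * cYd m =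
  q * (cYd (Suc m) * cXu (Suc (Suc m)) 0)"
  using cX_cY_exchange[of m 0] by simp

lemma cX_cY_Suc: "cXd (Suc m) (Suc l) * cYu (Suc (Suc m)) + cXu (Suc m) (Suc l) * cYd m =
    q * (cYd (Suc m) * cXu (Suc (Suc m)) (Suc l)) + q * (cYu (Suc m) * cXd m l)"
  using cX_cY_exchange[of m "Suc l"] by (simp add: cXd_def add.commute)

section \<open>The operators of the generators and the verification of the relations\<close>

definition E :: "coords \<Rightarrow> coords" where
  "E f = assemble (\<lambda>n k. scl (cE n k) (slice f n (Suc k)))"

definition F :: "coords \<Rightarrow> coords" where
  "F f = assemble (\<lambda>n k. case k of 0 \<Rightarrow> 0 | Suc l \<Rightarrow> if k \<le> n then slice f n l else 0)"

definition K :: "coords \<Rightarrow> coords" where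
  "K f = assemble (\<lambda>n k. scl (cK n k) (slice f n k))"

definition K' :: "coords \<Rightarrow> coords" where
  "K' f = assemble (\<lambda>n k. scl (cK' n k) (slice f n k))"

definition Y_up :: "coords \<Rightarrow> nat \<Rightarrow> nat \<Rightarrow> coords" where
  "Y_up f n k = (case n of 0 \<Rightarrow> 0 | Suc m \<Rightarrow> (case k of 0 \<Rightarrow> 0 | Suc l \<Rightarrow>
     scl (cYu n) (a m (slice f m l))))"

text \<open>The source (n + 1, n + 1) contributes nothing here, because F^(n+1) is zero on V_n; the
  test k <= n expresses this.\<close>

definition Y_down :: "coords \<Rightarrow> nat \<Rightarrow> nat \<Rightarrow> coords" where
  "Y_down f n k = (if k \<le> n then scl (cYd n) (b n (slice f (Suc n) k)) else 0)"

definition YY :: "coords \<Rightarrow> coords" where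
  "YY f = assemble (\<lambda>n k. Y_up f n k + Y_down f n k)"

definition X_up :: "coords \<Rightarrow> nat \<Rightarrow> nat \<Rightarrow> coords" where
  "X_up f n k = (case n of 0 \<Rightarrow> 0 | Suc m \<Rightarrow> scl (cXu n k) (a m (slice f m k)))"

definition X_down :: "coords \<Rightarrow> nat \<Rightarrow> nat \<Rightarrow> coords" where
  "X_down f n k = (if k \<le> n then scl (cXd n k) (b n (slice f (Suc n) (Suc k))) else 0)"

definition XX :: "coords \<Rightarrow> coords" where
  "XX f = assemble (\<lambda>n k. X_up f n k + X_down f n k)"

lemma slice_op:
  "slice (E f) n k = scl (cE n k) (slice f n (Suc k))"
  "slice (F f) n 0 = 0" "slice (F f) n (Suc l) = (if Suc l \<le> n then slice f n l else 0)"
  "slice (K f) n k = scl (cK n k) (slice f n k)"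
  "slice (K' f) n k = scl (cK' n k) (slice f n k)"
  "slice (XX f) n k = X_up f n k + X_down f n k"
  "slice (YY f) n k = Y_up f n k + Y_down f n k"
  by (simp_all add: E_def F_def K_def K'_def XX_def YY_def)

lemma X_up_simps [simp]: "X_up f 0 k = 0" "X_up f (Suc m) k =
  scl (cXu (Suc m) k) (a m (slice f m k))"
  and Y_up_simps [simp]: "Y_up f 0 k = 0" "Y_up f n 0 = 0"
    "Y_up f (Suc m) (Suc l) = scl (cYu (Suc m)) (a m (slice f m l))"
  by (simp_all add: X_up_def Y_up_def split: nat.split)

lemma lin_ops: "lin E" "lin F" "lin K" "lin K'" "lin XX" "lin YY"
proof -
  have F: "slice (F f) n k = (case k of 0 \<Rightarrow> 0 | Suc l \<Rightarrow> if k \<le> n then slice f n l else 0)" for f n k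
    by (simp add: F_def)
  show "lin E" "lin K" "lin K'"
    by (rule linI; rule slice_eqI; simp add: slice_op cs.scale_right_distrib mult.commute)+
  show "lin F"
    by (rule linI; rule slice_eqI; simp add: F split: nat.split)
  show "lin XX"
    by (rule linI; rule slice_eqI; simp add: slice_op X_up_def X_down_def ab_add ab_scale
      cs.scale_right_distrib mult.commute split: nat.split)
  show "lin YY"
    by (rule linI; rule slice_eqI; simp add: slice_op Y_up_def Y_down_def ab_add ab_scale
      cs.scale_right_distrib mult.commute split: nat.split)
qed

lemma C_W: "f \<in> C \<Longrightarrow> slice f n k \<in> qsp W n" and C_0: "f \<in> C \<Longrightarrow> n < k \<Longrightarrow> slice f n k = 0"
  by (auto simp: C_def)

lemma CI: "\<lbrakk>\<And>n k. slice f n k \<in> qsp W n; \<And>n k. n < k \<Longrightarrow> slice f n k = 0\<rbrakk> \<Longrightarrow> f \<in> C"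
  by (auto simp: C_def)

lemmas W_closed = cs.subspace_0[OF sub_W] cs.subspace_add[OF sub_W] cs.subspace_scale[OF sub_W]
  cs.subspace_diff[OF sub_W]

lemma C_subspace: "cs.subspace C"
  by (auto simp: cs.subspace_def C_def W_closed)

lemma C_closed:
  assumes f: "f \<in> C"
  shows "E f \<in> C" "F f \<in> C" "K f \<in> C" "K' f \<in> C" "XX f \<in> C" "YY f \<in> C"
proof -
  note fW = C_W[OF f] and f0 = C_0[OF f]
  show "E f \<in> C" "K f \<in> C" "K' f \<in> C"
    by (rule CI; simp add: slice_op W_closed fW f0)+
  have "slice (F f) n k = (case k of 0 \<Rightarrow> 0 | Suc l \<Rightarrow> if k \<le> n then slice f n l else 0)" for n k
    by (simp add: F_def)
  then show "F f \<in> C"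
    by (intro CI) (simp_all add: W_closed fW split: nat.split)
  have "X_up f n k \<in> qsp W n" "X_down f n k \<in> qsp W n" "Y_up f n k \<in> qsp W n" "Y_down f n k \<in> qsp
    W n" for n k
    using fW by (auto simp: X_up_def X_down_def Y_up_def Y_down_def W_closed a_closed b_closed
      split: nat.split)
  moreover have "X_up f n k = 0" "X_down f n k = 0" "Y_up f n k = 0" "Y_down f n k = 0"
    if "n < k" for n k
    using that f0 by (auto simp: X_up_def X_down_def Y_up_def Y_down_def ab_zero split: nat.split)
  ultimately show "XX f \<in> C" "YY f \<in> C"
    by (auto intro!: CI simp: slice_op W_closed)
qed

lemma K_K': "K (K' f) = f" "K' (K f) = f"
  by (rule slice_eqI; simp add: slice_op cK_cK')+

lemma K_conj:
  "K (E (K' f)) = scl (q^2) (E f)" "K (F (K' f)) = scl (inverse (q^2)) (F f)"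
  "K (XX (K' f)) = scl q (XX f)" "K (YY (K' f)) = scl (inverse q) (YY f)"
proof -
  have c: "cK n k * (c * cK' n' k') = (cK n k * cK' n' k') * c" for n k c n' k'
    by (simp add: mult_ac)
  show "K (E (K' f)) = scl (q^2) (E f)"
    by (rule slice_eqI) (simp add: slice_op c cK_cK')
  show "K (F (K' f)) = scl (inverse (q^2)) (F f)"
  proof (rule slice_eqI)
    fix n k show "slice (K (F (K' f))) n k = slice (scl (inverse (q^2)) (F f)) n k"
      by (cases k) (simp_all add: slice_op cK_cK')
  qed
  show "K (XX (K' f)) = scl q (XX f)"
  proof (rule slice_eqI)
    fix n k show "slice (K (XX (K' f))) n k = slice (scl q (XX f)) n k"
      by (cases n) (simp_all add: slice_op X_down_def ab_scale cs.scale_right_distrib c cK_cK')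
  qed
  show "K (YY (K' f)) = scl (inverse q) (YY f)"
  proof (rule slice_eqI)
    fix n k show "slice (K (YY (K' f))) n k = slice (scl (inverse q) (YY f)) n k"
      by (cases n; cases k) (simp_all add: slice_op Y_down_def ab_scale cs.scale_right_distrib c
        cK_cK')
  qed
qed

lemma E_F_comm:
  assumes f: "f \<in> C"
  shows "E (F f) - F (E f) = scl (1 / (q - inverse q)) (K f - K' f)"
proof (rule slice_eqI)
  fix n k
  have R: "slice (scl (1 / (q - inverse q)) (K f - K' f)) n k =
    scl (qn (int n - 2 * int k)) (slice f n k)"
    by (simp only: slice_simps slice_op cs.scale_left_diff_distrib[symmetric] cs.scale_scale cK_qn)
  show "slice (E (F f) - F (E f)) n k = slice (scl (1 / (q - inverse q)) (K f - K' f)) n k"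
    unfolding R
  proof (cases "k \<le> n")
    case False
    then show "slice (E (F f) - F (E f)) n k = scl (qn (int n - 2 * int k)) (slice f n k)"
      using C_0[OF f, of n k] by (cases k) (simp_all add: slice_op)
  next
    case True
    \<comment> \<open>At k = n the truncation in F drops a term, in agreement with the coefficient
      \<open>cE n n\<close> being zero.\<close>
    have EF: "slice (E (F f)) n k = scl (cE n k) (slice f n k)"
      using True by (cases "k = n") (simp_all add: slice_op cE_edge)
    show "slice (E (F f) - F (E f)) n k = scl (qn (int n - 2 * int k)) (slice f n k)"
    proof (cases k)
      case 0
      then show ?thesis using EF by (simp add: slice_op cE_edge)
    next
      case (Suc l)
      then have "slice (F (E f)) n k = scl (cE n l) (slice f n k)"
        using True by (simp add: slice_op)
      then show ?thesis using EF cE_comm[of n l] Suc by (simp add: cs.scale_left_distrib)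
    qed
  qed
qed

lemma E_X: "E (XX f) = scl q (XX (E f))"
proof (rule slice_eqI)
  fix n k
  have up: "scl (cE n k) (X_up f n (Suc k)) = scl q (X_up (E f) n k)"
    by (cases n) (simp_all add: slice_op ab_scale cE_cXu)
  have down: "scl (cE n k) (X_down f n (Suc k)) = scl q (X_down (E f) n k)"
  proof (cases "Suc k \<le> n")
    case True
    then show ?thesis by (simp add: X_down_def slice_op ab_scale cE_cXd)
  next
    case False
    then have "k = n \<or> n < k" by auto
    then show ?thesis by (auto simp: X_down_def slice_op ab_scale cE_edge)
  qed
  show "slice (E (XX f)) n k = slice (scl q (XX (E f))) n k"
    by (simp only: slice_op slice_simps cs.scale_right_distrib up down)
qed

lemma E_Y: "E (YY f) = XX f + scl (inverse q) (YY (E f))"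
proof (rule slice_eqI)
  fix n k
  have up: "scl (cE n k) (Y_up f n (Suc k)) = X_up f n k + scl (inverse q) (Y_up (E f) n k)"
  proof (cases n)
    case (Suc m)
    show ?thesis
    proof (cases k)
      \<comment> \<open>Here \<open>Y_up (E f) n 0\<close> is zero, and the other two sides carry
        the coefficients [n] / [n] and \<open>cXu n 0\<close>, both equal to 1.\<close>
      case 0
      then show ?thesis using Suc cE_edge[of "Suc m"]
        by (simp add: cYu_def qn_eq_0_iff cE_edge)
    next
      case k: (Suc l)
      show ?thesis unfolding Suc k
        by (simp add: slice_op ab_scale cE_cYu cs.scale_left_distrib)
    qed
  qed simp
  have down: "scl (cE n k) (Y_down f n (Suc k)) = X_down f n k + scl (inverse q) (Y_down (E f) n k)"
  proof (cases "k \<le> n")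
    case False then show ?thesis by (simp add: X_down_def Y_down_def)
  next
    case True
    have "scl (cE n k) (Y_down f n (Suc k)) = scl (cE n k * cYd n) (b n (slice f (Suc n) (Suc k)))"
      using True by (cases "k = n") (simp_all add: Y_down_def cE_edge)
    then show ?thesis
      using True by (simp add: X_down_def Y_down_def slice_op ab_scale cE_cYd cs.scale_left_distrib)
  qed
  have "slice (E (YY f)) n k = (X_up f n k + scl (inverse q) (Y_up (E f) n k)) +
    (X_down f n k + scl (inverse q) (Y_down (E f) n k))"
    by (simp only: slice_op cs.scale_right_distrib up down)
  also have "\<dots> = slice (XX f + scl (inverse q) (YY (E f))) n k"
    by (simp add: slice_op cs.scale_right_distrib add_ac)
  finally show "slice (E (YY f)) n k = slice (XX f + scl (inverse q) (YY (E f))) n k" .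
qed

lemma F_Y:
  assumes f: "f \<in> C"
  shows "F (YY f) = YY (F f)"
proof (rule slice_eqI)
  fix n k
  note f0 = C_0[OF f]
  show "slice (F (YY f)) n k = slice (YY (F f)) n k"
  proof (cases k)
    case 0
    then show ?thesis by (simp add: slice_op Y_down_def ab_zero)
  next
    case (Suc l)
    show ?thesis unfolding Suc by (cases n; cases l) (simp_all add: slice_op Y_down_def ab_zero f0)
  qed
qed

lemma F_X:
  assumes f: "f \<in> C"
  shows "F (XX f) = YY (K' f) + XX (F f)"
proof (rule slice_eqI)
  fix n k
  note f0 = C_0[OF f]
  show "slice (F (XX f)) n k = slice (YY (K' f) + XX (F f)) n k"
  proof (cases k)
    case 0
    \<comment> \<open>F puts nothing into a slice with k = 0, so the two terms with \<open>b\<close>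
      on the other side have to cancel.\<close>
    have "Y_down (K' f) n 0 + X_down (F f) n 0 = scl (cYd n * cK' (Suc n) 0 + cXd n 0) (b n (slice
      f (Suc n) 0))"
      by (simp add: Y_down_def X_down_def slice_op ab_scale cs.scale_left_distrib)
    also have "\<dots> = 0" unfolding cYd_cK' by simp
    finally show ?thesis using 0 by (cases n) (simp_all add: slice_op ab_zero)
  next
    case (Suc l)
    show ?thesis
    proof (cases "k \<le> n")
      case False
      then show ?thesis
        using Suc f0 by (cases n) (auto simp: slice_op Y_down_def X_down_def ab_zero)
    next
      case True
      obtain m where n: "n = Suc m" using True Suc by (cases n) auto
      have lm: "l \<le> m" using True Suc n by simp
      have down: "X_down f n l = Y_down (K' f) n k + X_down (F f) n k"
      proof -
        have "Y_down (K' f) n k + X_down (F f) n k =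
          scl (cYd n * cK' (Suc n) (Suc l) + cXd n (Suc l)) (b n (slice f (Suc n) k))"
          using True Suc by (simp add: Y_down_def X_down_def slice_op ab_scale
            cs.scale_left_distrib)
        then show ?thesis
          using True Suc unfolding cXd_Suc[symmetric] by (simp add: X_down_def)
      qed
      have up: "X_up f n l = Y_up (K' f) n k + X_up (F f) n k"
      proof -
        \<comment> \<open>For l = m the slice of \<open>F f\<close> is cut off, in agreement with
          \<open>cXu (Suc m) (Suc m)\<close> being zero.\<close>
        have "X_up (F f) n k = scl (cXu (Suc m) (Suc l)) (a m (slice f m l))"
          using n Suc lm by (cases "l = m") (auto simp: slice_op cE_edge)
        then have "Y_up (K' f) n k + X_up (F f) n k =
          scl (cYu (Suc m) * cK' m l + cXu (Suc m) (Suc l)) (a m (slice f m l))"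
          using n Suc by (simp add: slice_op ab_scale cs.scale_left_distrib)
        then show ?thesis using n unfolding cXu_Suc[symmetric] by simp
      qed
      have "slice (F (XX f)) n k = X_up f n l + X_down f n l"
        using True Suc by (simp add: slice_op)
      also have "\<dots> = slice (YY (K' f) + XX (F f)) n k"
        unfolding up down by (simp add: slice_op add_ac)
      finally show ?thesis .
    qed
  qed
qed

text \<open>Every term passes through \<open>a\<close> twice, through \<open>b\<close> twice, or
  once through each. The first two kinds agree coefficient by coefficient. The mixed terms can be
  compared only by the relations of the quiver: a b = b a for n > 0, and b a = 0 for n = 0.\<close>

lemma X_Y:
  assumes f: "f \<in> C"
  shows "XX (YY f) = scl q (YY (XX f))"
proof (rule slice_eqI)
  fix n k
  show "slice (XX (YY f)) n k = slice (scl q (YY (XX f))) n k"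
  proof (cases "k \<le> n")
    case False
    then show ?thesis
      using C_0[OF C_closed(5)[OF C_closed(6)[OF f]]] C_0[OF C_closed(6)[OF C_closed(5)[OF f]]] by
        simp
  next
    case True
    define bb where "bb = b n (b (Suc n) (slice f (Suc (Suc n)) (Suc k)))"
    define ba where "ba = b n (a n (slice f n k))"
    have 1: "X_down (YY f) n k = scl (cXd n k * cYu (Suc n)) ba + scl (cXd n k * cYd (Suc n)) bb"
      using True by (simp add: X_down_def slice_op Y_down_def ab_add ab_scale cs.scale_right_distrib
          bb_def ba_def)
    have 2: "scl q (Y_down (XX f) n k) = scl (q * (cYd n * cXu (Suc n) k)) ba + scl (cXd n k * cYd
      (Suc n)) bb"
      unfolding cXd_cYd
      using True by (simp add: Y_down_def slice_op X_down_def ab_add ab_scale cs.scale_right_distrib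
          bb_def ba_def)
    show ?thesis
    proof (cases n)
      case 0
      then have "ba = 0" using b_a_0 C_W[OF f] by (simp add: ba_def)
      moreover have "slice (XX (YY f)) n k = X_down (YY f) n k"
        "slice (scl q (YY (XX f))) n k = scl q (Y_down (XX f) n k)"
          using 0 by (simp_all add: slice_op)
      ultimately show ?thesis using 1 2 by simp
    next
      case (Suc m)
      have ab: "a m (b m (slice f n k)) = ba"
        unfolding ba_def using a_b[of "slice f n k" m] C_W[OF f, of n k] Suc by simp
      define aa where "aa = a m (Y_up f m k)"
      have 3: "X_up (YY f) n k = scl (cXu n k) aa + scl (cXu n k * cYd m) ba"
      proof (cases "k \<le> m")
        case True
        then show ?thesis using ab Suc
          by (simp add: slice_op Y_down_def ab_add ab_scale cs.scale_right_distrib aa_def)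
      next
        \<comment> \<open>At k = n both sides vanish because \<open>cXu n n\<close> is zero.\<close>
        case False
        then have "k = n" using \<open>k \<le> n\<close> Suc by simp
        then show ?thesis using Suc by (simp add: cE_edge)
      qed
      have swap: "scl c u + scl d v + (scl e v + w) = scl c u + scl (e + d) v + w" for c d e u v w
        by (simp add: cs.scale_left_distrib add_ac)
      have L: "slice (XX (YY f)) n k = scl (cXu n k) aa +
          scl (cXd n k * cYu (Suc n) + cXu n k * cYd m) ba + scl (cXd n k * cYd (Suc n)) bb"
        unfolding slice_op 1 3 by (rule swap)
      show ?thesis
      proof (cases k)
        case 0
        have R: "slice (scl q (YY (XX f))) n k = scl q (Y_down (XX f) n k)"
          using 0 by (simp add: slice_op)
        have "aa = 0" using 0 by (simp add: aa_def ab_zero)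
        then show ?thesis unfolding R L 2 using cX_cY_0[of m] 0 Suc by simp
      next
        case k: (Suc l)
        have l: "l \<le> m" using k \<open>k \<le> n\<close> Suc by simp
        have aa: "scl q (scl (cYu n) (a m (X_up f m l))) = scl (cXu n k) aa"
          using k Suc by (cases m) (simp_all add: aa_def ab_zero ab_scale cXu_cYu)
        have "scl q (Y_up (XX f) n k) = scl q (scl (cYu n) (a m (X_up f m l))) +
            scl (q * (cYu n * cXd m l)) ba"
          using Suc k l ab by (simp add: slice_op ab_add ab_scale X_down_def cs.scale_right_distrib)
        then have "slice (scl q (YY (XX f))) n k = scl (cXu n k) aa +
          scl (q * (cYd n * cXu (Suc n) k) + q * (cYu n * cXd m l)) ba + scl (cXd n k * cYd (Suc
            n)) bb"
          unfolding slice_simps slice_op cs.scale_right_distrib 2 aa by (simp only: swap)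
        then show ?thesis unfolding L using cX_cY_Suc[of m l] Suc k by simp
      qed
    qed
  qed
qed

end

section \<open>Bijective morphisms are isomorphisms\<close>

lemma lin_maps_inverse:
  assumes f: "f \<in> lin_maps S T" and bij: "bij_betw f S T" and S: "cs.subspace S"
    and T: "cs.subspace T"
  shows "restrict (inv_into S f) T \<in> lin_maps T S"
proof (rule lin_mapsI[OF _ _ _ T])
  have inj: "inj_on f S" and im: "f ` S = T" using bij by (auto simp: bij_betw_def)
  have inv: "\<And>y. y \<in> T \<Longrightarrow> inv_into S f y \<in> S" "\<And>y. y \<in> T \<Longrightarrow> f (inv_into S f y) = y"
    using im by (auto simp: inv_into_into f_inv_into_f)
  show "inv_into S f y \<in> S" if "y \<in> T" for y using inv that by blast
  show "inv_into S f (y + z) = inv_into S f y + inv_into S f z" if "y \<in> T" "z \<in> T" for y z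
  proof (rule inj_onD[OF inj])
    show "f (inv_into S f (y + z)) = f (inv_into S f y + inv_into S f z)"
      using that inv cs.subspace_add[OF T] by (simp add: lin_maps_add[OF f])
  qed (use that inv cs.subspace_add[OF T] cs.subspace_add[OF S] in auto)
  show "inv_into S f (scl c y) = scl c (inv_into S f y)" if "y \<in> T" for c y
  proof (rule inj_onD[OF inj])
    show "f (inv_into S f (scl c y)) = f (scl c (inv_into S f y))"
      using that inv cs.subspace_scale[OF T] by (simp add: lin_maps_scale[OF f])
  qed (use that inv cs.subspace_scale[OF T] cs.subspace_scale[OF S] in auto)
qed

lemma compose_inverse:
  assumes "bij_betw f S T"
  shows "compose S (restrict (inv_into S f) T) f = (\<lambda>x\<in>S. x)"
    "compose T f (restrict (inv_into S f) T) = (\<lambda>y\<in>T. y)"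
  using assms by (auto simp: compose_def fun_eq_iff bij_betw_def f_inv_into_f inv_into_into)

lemma quiver_model_isomorphism:
  assumes A: "A \<in> Obj quiver_model_cat" and B: "B \<in> Obj quiver_model_cat"
    and f: "f \<in> Mor quiver_model_cat A B" and bij: "\<And>i. bij_betw (f i) (qsp A i) (qsp B i)"
  shows "is_isomorphism quiver_model_cat A B f"
proof -
  define g where "g i = restrict (inv_into (qsp A i) (f i)) (qsp B i)" for i
  have sub: "cs.subspace (qsp A i)" "cs.subspace (qsp B i)" for i
    using A B by (auto simp: quiver_model_cat_def is_quiver_model_def fd_space_def)
  have cl: "\<And>i v. v \<in> qsp B i \<Longrightarrow> qa B i v \<in> qsp B (Suc i)" "\<And>i v. v \<in> qsp B (Suc i)
    \<Longrightarrow> qb B i v \<in> qsp B i"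
    "\<And>i v. v \<in> qsp A i \<Longrightarrow> qa A i v \<in> qsp A (Suc i)" "\<And>i v. v \<in> qsp A (Suc i) \<Longrightarrow> qb A i v \<in> qsp A i"
    using A B by (auto simp: quiver_model_cat_def is_quiver_model_def)
  have fl: "\<And>i. f i \<in> lin_maps (qsp A i) (qsp B i)"
    and fa: "\<And>i v. v \<in> qsp A i \<Longrightarrow> f (Suc i) (qa A i v) = qa B i (f i v)"
    and fb: "\<And>i v. v \<in> qsp A (Suc i) \<Longrightarrow> f i (qb A i v) = qb B i (f (Suc i) v)"
    using f by (auto simp: quiver_model_cat_def)
  have gl: "g i \<in> lin_maps (qsp B i) (qsp A i)" for i
    unfolding g_def by (rule lin_maps_inverse[OF fl bij sub])
  have fg: "f i (g i y) = y" "g i y \<in> qsp A i" if "y \<in> qsp B i" for i y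
    using bij[of i] that by (auto simp: g_def bij_betw_def f_inv_into_f inv_into_into)
  have gf: "g i (f i x) = x" if "x \<in> qsp A i" for i x
    using bij[of i] that by (auto simp: g_def bij_betw_def)
  have "g (Suc i) (qa B i v) = qa A i (g i v)" if "v \<in> qsp B i" for i v
    using gf[of "qa A i (g i v)" "Suc i"] fa[of "g i v" i] fg[OF that] cl by simp
  moreover have "g i (qb B i v) = qb A i (g (Suc i) v)" if "v \<in> qsp B (Suc i)" for i v
    using gf[of "qb A i (g (Suc i) v)" i] fb[of "g (Suc i) v" i] fg[OF that] cl by simp
  ultimately have "g \<in> Mor quiver_model_cat B A"
    using gl by (simp add: quiver_model_cat_def)
  moreover have "(\<lambda>i. compose (qsp A i) (g i) (f i)) = (\<lambda>i. \<lambda>x\<in>qsp A i. x)"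
    "(\<lambda>i. compose (qsp B i) (f i) (g i)) = (\<lambda>i. \<lambda>x\<in>qsp B i. x)"
    unfolding g_def using compose_inverse[OF bij] by auto
  ultimately show ?thesis
    using f unfolding is_isomorphism_def by (auto simp: quiver_model_cat_def intro!: bexI[of _ g])
qed

lemma sch_model_isomorphism:
  assumes A: "A \<in> Obj (sch_model_cat q)" and B: "B \<in> Obj (sch_model_cat q)"
    and f: "f \<in> Mor (sch_model_cat q) A B" and bij: "bij_betw f (sp A) (sp B)"
  shows "is_isomorphism (sch_model_cat q) A B f"
proof -
  define g where "g = restrict (inv_into (sp A) f) (sp B)"
  have sub: "cs.subspace (sp A)" "cs.subspace (sp B)"
    and cl: "\<And>g v. v \<in> sp A \<Longrightarrow> op A g v \<in> sp A" "\<And>g v. v \<in> sp B \<Longrightarrow> op B g v \<in> sp B"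
    using A B by (auto simp: sch_model_cat_def is_sch_model_def fd_space_def)
  have fl: "f \<in> lin_maps (sp A) (sp B)" and fo: "\<And>h v. v \<in> sp A \<Longrightarrow> f (op A h v) = op B h (f v)"
    using f by (auto simp: sch_model_cat_def)
  have gl: "g \<in> lin_maps (sp B) (sp A)"
    unfolding g_def by (rule lin_maps_inverse[OF fl bij sub])
  have fg: "f (g y) = y" "g y \<in> sp A" if "y \<in> sp B" for y
    using bij that by (auto simp: g_def bij_betw_def f_inv_into_f inv_into_into)
  have gf: "g (f x) = x" if "x \<in> sp A" for x
    using bij that by (auto simp: g_def bij_betw_def)
  have "g (op B h v) = op A h (g v)" if "v \<in> sp B" for h v
    using gf[of "op A h (g v)"] fo[of "g v" h] fg[OF that] cl by simp
  then have "g \<in> Mor (sch_model_cat q) B A"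
    using gl by (simp add: sch_model_cat_def)
  then show ?thesis
    using f compose_inverse[OF bij] unfolding is_isomorphism_def g_def
    by (auto simp: sch_model_cat_def intro!: bexI[of _ g])
qed

section \<open>The constructed module as a model, and its highest weight vectors\<close>

context quiver_object
begin

definition sch :: sch_model where
  "sch = \<lparr>sp = C, op = (\<lambda>g. case g of Gen_E \<Rightarrow> E | Gen_F \<Rightarrow> F | Gen_K \<Rightarrow> K | Gen_Kinv \<Rightarrow> K'
     | Gen_X \<Rightarrow> XX | Gen_Y \<Rightarrow> YY | Gen_Z \<Rightarrow> (\<lambda>_. 0))\<rparr>"

lemma sch_simps [simp]:
  "sp sch = C" "op sch Gen_E = E" "op sch Gen_F = F" "op sch Gen_K = K" "op sch Gen_Kinv = K'"
  "op sch Gen_X = XX" "op sch Gen_Y = YY" "op sch Gen_Z = (\<lambda>_. 0)"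
  by (simp_all add: sch_def)

lemma lin_sch: "lin (op sch g)"
  using lin_ops by (cases g) (auto intro!: linI)

lemma sch_closed: "f \<in> C \<Longrightarrow> op sch g f \<in> C"
  using C_closed[of f] cs.subspace_0[OF C_subspace] by (cases g) auto

lemma sch_relations:
  assumes r: "r \<in> uq_relations q" and f: "f \<in> C"
  shows "act (op sch) r f = 0"
proof -
  note m = act_mult[of "op sch", OF lin_sch]
  have z: "act (op sch) (gen Gen_Z * gen g - gen g * gen Gen_Z) f = 0" for g
    by (simp add: m lin_zero[OF lin_sch])
  have "act (op sch) (gen Gen_K * gen Gen_Kinv - 1) f = 0"
    "act (op sch) (gen Gen_Kinv * gen Gen_K - 1) f = 0"
    by (simp_all add: m K_K')
  moreover have "act (op sch) ((gen Gen_E * gen Gen_F - gen Gen_F * gen Gen_E) -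
      const (1 / (q - inverse q)) * (gen Gen_K - gen Gen_Kinv)) f = 0"
    using E_F_comm[OF f] by (simp only: act_diff act_const act_gen m sch_simps) simp
  moreover have "act (op sch) (gen Gen_K * gen Gen_E * gen Gen_Kinv - const (q^2) * gen Gen_E) f =
    0"
    "act (op sch) (gen Gen_K * gen Gen_F * gen Gen_Kinv - const (inverse (q^2)) * gen Gen_F) f = 0"
    "act (op sch) (gen Gen_K * gen Gen_X * gen Gen_Kinv - const q * gen Gen_X) f = 0"
    "act (op sch) (gen Gen_K * gen Gen_Y * gen Gen_Kinv - const (inverse q) * gen Gen_Y) f = 0"
    by (simp_all only: act_diff act_const act_gen m sch_simps K_conj diff_self)
  moreover have "act (op sch) ((const q * gen Gen_Y * gen Gen_X - gen Gen_X * gen Gen_Y) - gen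
    Gen_Z) f = 0"
    using X_Y[OF f] by (simp add: m)
  moreover have "act (op sch) (gen Gen_E * gen Gen_X - const q * gen Gen_X * gen Gen_E) f = 0"
    "act (op sch) (gen Gen_E * gen Gen_Y - (gen Gen_X + const (inverse q) * gen Gen_Y * gen
      Gen_E)) f = 0"
    by (simp_all only: act_diff act_add act_const act_gen m sch_simps E_X E_Y diff_self)
  moreover have "act (op sch) (gen Gen_F * gen Gen_X - (gen Gen_Y * gen Gen_Kinv + gen Gen_X * gen
    Gen_F)) f = 0"
    "act (op sch) (gen Gen_F * gen Gen_Y - gen Gen_Y * gen Gen_F) f = 0"
    by (simp_all only: act_diff act_add act_gen m sch_simps F_X[OF f] F_Y[OF f] diff_self)
  ultimately show ?thesis
    using r z unfolding uq_relations_def Let_def by auto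
qed

lemma bound: "\<exists>N. \<forall>f\<in>C. \<forall>n\<ge>N. \<forall>k. slice f n k = 0"
proof -
  obtain N where "\<forall>i\<ge>N. qsp W i = {0}" using model by (auto simp: is_quiver_model_def)
  then have "\<forall>f\<in>C. \<forall>n\<ge>N. \<forall>k. slice f n k = 0" using C_W by blast
  then show ?thesis by blast
qed

text \<open>A coordinate of a vector in \<open>C\<close> is indexed by a triple (n, k, j). Only
  finitely many triples can carry nonzero entries: n is bounded, k is at most n, and j is bounded
  for each of the finitely many n.\<close>

lemma fd_C: "fd_space C"
proof -
  obtain N where N: "\<forall>f\<in>C. \<forall>n\<ge>N. \<forall>k. slice f n k = 0" using bound by blast
  have "\<forall>n. \<exists>d. qsp W n \<subseteq> coord_space d" using fd_W by (auto simp: fd_space_def)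
  then obtain d where d: "\<And>n. qsp W n \<subseteq> coord_space (d n)" by metis
  define D where "D = (\<Sum>n<N. d n)"
  let ?I = "prod_encode ` ({..N} \<times> prod_encode ` ({..N} \<times> {..D}))"
  have fin: "finite ?I" by simp
  have "f m = 0" if f: "f \<in> C" and m: "m \<notin> ?I" for f m
  proof -
    obtain n k j where mm: "m = prod_encode (n, prod_encode (k, j))"
      by (metis prod_decode_inverse prod.collapse)
    have fm: "f m = slice f n k j" by (simp add: slice_def mm)
    have "n > N \<or> k > N \<or> j > D" using m unfolding mm by force
    then consider "n \<ge> N" | "n < N" "n < k" | "n < N" "j > D" by linarith
    then show ?thesis
    proof cases
      case 1 then show ?thesis using N f fm by (simp add: zero_fun_apply)
    next
      case 2 then show ?thesis using C_0[OF f, of n k] fm by (simp add: zero_fun_apply)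
    next
      case 3
      have "d n \<le> D" unfolding D_def using 3 by (simp add: member_le_sum)
      then show ?thesis using C_W[OF f, of n k] d[of n] 3 fm by (auto simp: coord_space_def)
    qed
  qed
  then have *: "m \<in> ?I" if "f \<in> C" "f m \<noteq> 0" for f m using that by blast
  obtain B where B: "\<forall>m\<in>?I. m < B" using fin unfolding finite_nat_set_iff_bounded by blast
  have "C \<subseteq> coord_space B"
  proof
    fix f assume f: "f \<in> C"
    have "f m = 0" if "m \<ge> B" for m
      using *[OF f, of m] bspec[OF B, of m] that by linarith
    then show "f \<in> coord_space B" by (simp add: coord_space_def)
  qed
  then show ?thesis using C_subspace unfolding fd_space_def by blast
qed

lemma sch_decomposable:
  assumes f: "f \<in> C"
  shows "\<exists>N. f \<in> weight_decomposable q K C N"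
proof -
  obtain N where N: "\<forall>f\<in>C. \<forall>n\<ge>N. \<forall>k. slice f n k = 0" using bound by blast
  \<comment> \<open>Slice (n, k) has weight n - 2k, so the component of weight \<open>m\<close>
    collects the slices with n - 2k = m. The interval suffices because k <= n < N for nonzero
    slices.\<close>
  define w where "w m = assemble (\<lambda>n k. if int n - 2 * int k = m then slice f n k else 0)" for m
  have "w m \<in> C" for m
    by (rule CI) (use C_W[OF f] C_0[OF f] cs.subspace_0[OF sub_W] in \<open>auto simp: w_def\<close>)
  moreover have "K (w m) = scl (q powi m) (w m)" for m
    by (rule slice_eqI) (auto simp: slice_op w_def cK_def)
  moreover have "f = (\<Sum>m = - int N..int N. w m)"
  proof (rule slice_eqI)
    fix n k
    have "slice (\<Sum>m = - int N..int N. w m) n k =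
        (if int n - 2 * int k \<in> {- int N..int N} then slice f n k else 0)"
      by (simp add: slice_sum w_def)
    moreover have "slice f n k = 0" if "int n - 2 * int k \<notin> {- int N..int N}"
      using that N f C_0[OF f, of n k] by (cases "n \<ge> N"; cases "n < k") auto
    ultimately show "slice f n k = slice (\<Sum>m = - int N..int N. w m) n k" by auto
  qed
  ultimately show ?thesis unfolding weight_decomposable_def by blast
qed

lemma is_sch_model_sch: "is_sch_model q sch"
  unfolding is_sch_model_def
  using fd_C lin_sch sch_closed sch_relations sch_decomposable by simp

text \<open>A highest weight vector of weight i lives in slice (i, 0) alone. Its weight excludes the
  slices (n, 0) with n different from i; for 0 < k <= n the coefficient \<open>cE n (k - 1)\<close>
  is nonzero, so being killed by E excludes the rest. Reading off this slice is the
  isomorphism.\<close>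

lemma hw_functor_preimage:
  "\<exists>f. is_isomorphism quiver_model_cat (sch_object.hw_quiver q sch) W f"
proof -
  interpret M: sch_object q sch
    by (intro sch_object.intro generic_q_axioms sch_object_axioms.intro is_sch_model_sch)
  have hw_slice: "slice f n k = 0" if "f \<in> M.hw i" "n \<noteq> i \<or> k \<noteq> 0" for f i n k
  proof (cases k)
    case 0
    have "slice (K f) n 0 = slice (scl (q powi int i) f) n 0"
      using that(1) by (simp add: M.hw_def M.wt_def)
    then have "scl (q powi int n - q powi int i) (slice f n 0) = 0"
      by (simp add: slice_op cK_def cs.scale_left_diff_distrib)
    moreover have "q powi int n - q powi int i \<noteq> 0"
      using that 0 powi_eq_iff[of "int n" "int i"] by simp
    ultimately show ?thesis using 0 cs.scale_eq_0_iff by blast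
  next
    case (Suc l)
    have f: "f \<in> C" using M.hw_S[OF that(1)] by simp
    have "slice (E f) n l = 0" using M.hw_E[OF that(1)] by simp
    then have "scl (cE n l) (slice f n k) = 0" by (simp add: slice_op Suc)
    then show ?thesis
      using Suc C_0[OF f, of n k] by (cases "n < k") (auto simp: cE_def qn_eq_0_iff)
  qed
  define emb where "emb i v = assemble (\<lambda>n k. if n = i \<and> k = 0 then v else 0)" for i v
  have emb: "emb i v \<in> M.hw i" if "v \<in> qsp W i" for i v
  proof -
    have "emb i v \<in> C"
      by (rule CI) (use that cs.subspace_0[OF sub_W] in \<open>auto simp: emb_def\<close>)
    moreover have "K (emb i v) = scl (q powi int i) (emb i v)"
      by (rule slice_eqI) (auto simp: slice_op emb_def cK_def)
    moreover have "E (emb i v) = 0"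
      by (rule slice_eqI) (auto simp: slice_op emb_def)
    ultimately show ?thesis by (simp add: M.hw_def M.wt_def)
  qed
  define g where "g i = restrict (\<lambda>f. slice f i 0) (M.hw i)" for i
  have "g \<in> Mor quiver_model_cat M.hw_quiver W"
    unfolding quiver_model_cat_def M.hw_quiver_def cat.simps quiver_model.simps mem_Collect_eq
  proof (intro allI conjI ballI)
    fix i
    show "g i \<in> lin_maps (M.hw i) (qsp W i)"
      unfolding g_def using M.hw_S M.hw_subspace C_W by (intro lin_mapsI) auto
    \<comment> \<open>Slice (i + 1, 0) of X f could also receive a term from slice (i + 2, 1)
      through \<open>b\<close>, but that slice of f is zero; the remaining coefficient
      \<open>cXu (Suc i) 0\<close> is 1.\<close>
    show "g (Suc i) (M.a f) = a i (g i f)" if f: "f \<in> M.hw i" for f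
      using f M.a_hw[OF f] hw_slice[OF f, of "Suc (Suc i)" 1]
      by (simp add: g_def M.a_def slice_op X_down_def ab_zero cE_edge)
    show "g i (M.b i f) = b i (g (Suc i) f)" if f: "f \<in> M.hw (Suc i)" for f
    proof -
      have F1: "slice (F f) (Suc i) (Suc 0) = slice f (Suc i) 0" by (simp add: slice_op)
      have "X_up (F f) i 0 = 0" by (cases i) (simp_all add: slice_op ab_zero)
      then have "g i (M.b i f) = scl (qn (int i + 1) * cYd i - inverse q * cXd i 0) (b i (slice f
        (Suc i) 0))"
        using M.b_hw[OF f]
        by (simp add: g_def M.b_def slice_op X_down_def Y_down_def F1 cs.scale_left_diff_distrib)
      \<comment> \<open>Here the scaling of \<open>b\<close> is matched with the constants of X and
        Y: the numerators add up to [i + 2].\<close>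
      also have "qn (int i + 1) * cYd i - inverse q * cXd i 0 = 1"
      proof -
        have e: "int i + 2 = (int i + 1) + 1" "- (int i + 1) = - 1 + - int i" by simp_all
        have "qn (int i + 2) = q * qn (int i + 1) + q powi (- 1 + - int i)"
          by (simp only: e(1) qn_plus_1 e(2))
        also have "q powi (- 1 + - int i) = inverse q * q powi (- int i)"
          by (simp only: power_int_add[OF disjI1[OF q_nonzero]]) (simp add: power_int_minus)
        finally have "qn (int i + 2) = q * qn (int i + 1) + inverse q * q powi (- int i)" .
        moreover have "qn (int i + 2) \<noteq> 0" by (simp add: qn_eq_0_iff)
        moreover have "qn (int i + 1) * cYd i - inverse q * cXd i 0 =
            (q * qn (int i + 1) + inverse q * q powi (- int i)) / qn (int i + 2)"
          by (simp add: cYd_def cXd_def add_divide_distrib)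
        ultimately show ?thesis by simp
      qed
      finally show ?thesis using f by (simp add: g_def)
    qed
  qed
  moreover have "bij_betw (g i) (qsp M.hw_quiver i) (qsp W i)" for i
  proof (rule bij_betw_byWitness[where f' = "emb i"])
    show "\<forall>f\<in>qsp M.hw_quiver i. emb i (g i f) = f"
    proof
      fix f assume "f \<in> qsp M.hw_quiver i"
      then have f: "f \<in> M.hw i" by (simp add: M.hw_quiver_def)
      show "emb i (g i f) = f"
        by (rule slice_eqI) (use f hw_slice[OF f] in \<open>auto simp: emb_def g_def\<close>)
    qed
    show "\<forall>v\<in>qsp W i. g i (emb i v) = v" using emb by (simp add: g_def) (simp add: emb_def)
    show "g i ` qsp M.hw_quiver i \<subseteq> qsp W i"
      using C_W M.hw_S by (auto simp: g_def M.hw_quiver_def)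
    show "emb i ` qsp W i \<subseteq> qsp M.hw_quiver i" using emb by (auto simp: M.hw_quiver_def)
  qed
  moreover have "M.hw_quiver \<in> Obj quiver_model_cat" "W \<in> Obj quiver_model_cat"
    using M.is_quiver_model_hw model by (simp_all add: quiver_model_cat_def)
  ultimately have "is_isomorphism quiver_model_cat M.hw_quiver W g"
    by (intro quiver_model_isomorphism)
  then show ?thesis by blast
qed

end

lemma (in generic_q) hw_functor_weak_equivalence:
  "weak_equivalence (sch_model_cat q) quiver_model_cat (hw_functor q)"
proof (rule weak_equivalenceI)
  have sch: "sch_object q A" if "A \<in> Obj (sch_model_cat q)" for A
    using that generic_q_axioms by (simp add: sch_model_cat_def sch_object_def
      sch_object_axioms_def)
  have pair: "sch_pair q A B" if "A \<in> Obj (sch_model_cat q)" "B \<in> Obj (sch_model_cat q)" for A B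
    using sch that by (simp add: sch_pair_def)
  have o: "omap (hw_functor q) A = sch_object.hw_quiver q A" for A by (simp add: hw_functor_def)
  have m: "mmap (hw_functor q) A B f = (\<lambda>i. restrict f (sch_object.hw q A i))" for A B f
    by (simp add: hw_functor_def)
  show "category (sch_model_cat q)" by (rule category_sch_model_cat)
  show "category quiver_model_cat" by (rule category_quiver_model_cat)
  show "is_functor (sch_model_cat q) quiver_model_cat (hw_functor q)"
    unfolding is_functor_def o m
  proof (intro conjI ballI)
    fix A assume A: "A \<in> Obj (sch_model_cat q)"
    interpret A: sch_object q A by (rule sch[OF A])
    show "A.hw_quiver \<in> Obj quiver_model_cat"
      using A.is_quiver_model_hw by (simp add: quiver_model_cat_def)
    show "(\<lambda>i. restrict (Idn (sch_model_cat q) A) (A.hw i)) = Idn quiver_model_cat A.hw_quiver"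
      using A.hw_S by (auto simp: sch_model_cat_def quiver_model_cat_def A.hw_quiver_def fun_eq_iff)
  next
    fix A B f assume AB: "A \<in> Obj (sch_model_cat q)" "B \<in> Obj (sch_model_cat q)"
      and f: "f \<in> Mor (sch_model_cat q) A B"
    show "(\<lambda>i. restrict f (sch_object.hw q A i)) \<in>
      Mor quiver_model_cat (sch_object.hw_quiver q A) (sch_object.hw_quiver q B)"
      by (rule sch_pair.hw_functor_Mor[OF pair[OF AB] f])
  next
    fix A B D f g
    assume AB: "A \<in> Obj (sch_model_cat q)" "B \<in> Obj (sch_model_cat q)"
      and f: "f \<in> Mor (sch_model_cat q) A B"
    interpret AB: sch_pair q A B by (rule pair[OF AB])
    show "(\<lambda>i. restrict (Comp (sch_model_cat q) A B D g f) (AB.A.hw i)) =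
      Comp quiver_model_cat AB.A.hw_quiver AB.B.hw_quiver (sch_object.hw_quiver q D)
        (\<lambda>i. restrict g (AB.B.hw i)) (\<lambda>i. restrict f (AB.A.hw i))"
      using AB.A.hw_S AB.Mor_hw[OF f]
      by (auto simp: sch_model_cat_def quiver_model_cat_def AB.A.hw_quiver_def fun_eq_iff
        compose_def)
  qed
  show "inj_on (mmap (hw_functor q) A B) (Mor (sch_model_cat q) A B)"
    if AB: "A \<in> Obj (sch_model_cat q)" "B \<in> Obj (sch_model_cat q)" for A B
  proof (rule inj_onI)
    fix f g assume "f \<in> Mor (sch_model_cat q) A B" "g \<in> Mor (sch_model_cat q) A B"
      "mmap (hw_functor q) A B f = mmap (hw_functor q) A B g"
    then show "f = g"
      using sch_pair.hw_functor_faithful[OF pair[OF AB], of f g] unfolding m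
        by (metis (no_types, lifting))
  qed
  show "\<exists>f\<in>Mor (sch_model_cat q) A B. mmap (hw_functor q) A B f = g"
    if AB: "A \<in> Obj (sch_model_cat q)" "B \<in> Obj (sch_model_cat q)"
      and g: "g \<in> Mor quiver_model_cat (omap (hw_functor q) A) (omap (hw_functor q) B)" for A B g
    using sch_pair.hw_functor_full[OF pair[OF AB]] g unfolding o m by blast
  show "\<exists>A\<in>Obj (sch_model_cat q). \<exists>f. is_isomorphism quiver_model_cat (omap (hw_functor q) A) W f"
    if W: "W \<in> Obj quiver_model_cat" for W
  proof -
    have W': "quiver_object q W"
      using W generic_q_axioms by (simp add: quiver_model_cat_def quiver_object_def
        quiver_object_axioms_def)
    then show ?thesis
      using quiver_object.hw_functor_preimage[OF W'] quiver_object.is_sch_model_sch[OF W']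
        unfolding o
      by (intro bexI[of _ "quiver_object.sch q W"]) (simp_all add: sch_model_cat_def)
  qed
qed

section \<open>From coordinates to arbitrary carriers\<close>

lemma complex_module_facts:
  assumes "Module.module complex_field V"
  shows "abelian_group V" "\<zero>\<^bsub>V\<^esub> \<in> carrier V"
    "\<lbrakk>x \<in> carrier V; y \<in> carrier V\<rbrakk> \<Longrightarrow> x \<oplus>\<^bsub>V\<^esub> y \<in> carrier V"
    "x \<in> carrier V \<Longrightarrow> c \<odot>\<^bsub>V\<^esub> x \<in> carrier V"
proof -
  interpret V: Module.module complex_field V by (rule assms)
  show "abelian_group V" by (rule V.abelian_group_axioms)
  show "\<zero>\<^bsub>V\<^esub> \<in> carrier V" by simp
  show "x \<oplus>\<^bsub>V\<^esub> y \<in> carrier V" if "x \<in> carrier V" "y \<in> carrier V" using that by simp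
  show "c \<odot>\<^bsub>V\<^esub> x \<in> carrier V" if "x \<in> carrier V" using that by simp
qed

lemma module_homI:
  assumes "\<And>x. x \<in> carrier V \<Longrightarrow> f x \<in> carrier U"
    "\<And>x y. \<lbrakk>x \<in> carrier V; y \<in> carrier V\<rbrakk> \<Longrightarrow> x \<oplus>\<^bsub>V\<^esub> y \<in> carrier V"
    "\<And>a x. \<lbrakk>a \<in> carrier R; x \<in> carrier V\<rbrakk> \<Longrightarrow> a \<odot>\<^bsub>V\<^esub> x \<in> carrier V"
    "\<And>x y. \<lbrakk>x \<in> carrier V; y \<in> carrier V\<rbrakk> \<Longrightarrow> f (x \<oplus>\<^bsub>V\<^esub> y) = f x \<oplus>\<^bsub>U\<^esub> f y"
    "\<And>a x. \<lbrakk>a \<in> carrier R; x \<in> carrier V\<rbrakk> \<Longrightarrow> f (a \<odot>\<^bsub>V\<^esub> x) = a \<odot>\<^bsub>U\<^esub> f x"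
  shows "restrict f (carrier V) \<in> module_hom R V U"
  using assms by (simp add: module_hom_def)

lemma module_hom_simps:
  assumes "f \<in> module_hom R V U"
  shows "f \<in> carrier V \<rightarrow>\<^sub>E carrier U" "x \<in> carrier V \<Longrightarrow> f x \<in> carrier U"
    "\<lbrakk>x \<in> carrier V; y \<in> carrier V\<rbrakk> \<Longrightarrow> f (x \<oplus>\<^bsub>V\<^esub> y) = f x \<oplus>\<^bsub>U\<^esub> f y"
    "\<lbrakk>a \<in> carrier R; x \<in> carrier V\<rbrakk> \<Longrightarrow> f (a \<odot>\<^bsub>V\<^esub> x) = a \<odot>\<^bsub>U\<^esub> f x"
  using assms by (auto simp: module_hom_def)

lemma module_hom_compose:
  assumes "f \<in> module_hom R V U" "g \<in> module_hom R U T"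
    and "\<And>x y. \<lbrakk>x \<in> carrier V; y \<in> carrier V\<rbrakk> \<Longrightarrow> x \<oplus>\<^bsub>V\<^esub> y \<in> carrier V"
    "\<And>a x. \<lbrakk>a \<in> carrier R; x \<in> carrier V\<rbrakk> \<Longrightarrow> a \<odot>\<^bsub>V\<^esub> x \<in> carrier V"
  shows "compose (carrier V) g f \<in> module_hom R V T"
  unfolding compose_def
  by (rule module_homI) (use assms module_hom_simps[OF assms(1)] module_hom_simps[OF assms(2)] in
    auto)

lemma quiver_rep_module:
  assumes "V \<in> Obj quiver_rep_cat"
  shows "Module.module complex_field (space V i)"
  using assms by (simp add: quiver_rep_cat_def is_quiver_rep_def)

lemma category_quiver_rep_cat: "category (quiver_rep_cat :: ('b quiver_rep, nat \<Rightarrow> 'b \<Rightarrow> 'b) cat)"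
proof
  fix A :: "'b quiver_rep" assume A: "A \<in> Obj quiver_rep_cat"
  note m = complex_module_facts[OF quiver_rep_module[OF A]]
  have "(\<lambda>v\<in>carrier (space A i). v) \<in> module_hom complex_field (space A i) (space A i)" for i
    by (rule module_homI) (use m in auto)
  moreover have "v \<in> carrier (space A i) \<Longrightarrow> arr_a A i v \<in> carrier (space A (Suc i))"
    "v \<in> carrier (space A (Suc i)) \<Longrightarrow> arr_b A i v \<in> carrier (space A i)" for i v
    using A by (auto simp: quiver_rep_cat_def is_quiver_rep_def intro: module_hom_simps(2))
  ultimately show "Idn quiver_rep_cat A \<in> Mor quiver_rep_cat A A"
    by (simp add: quiver_rep_cat_def rep_hom_def)
next
  fix A B D :: "'b quiver_rep" and f g
  assume A: "A \<in> Obj quiver_rep_cat" and f: "f \<in> Mor quiver_rep_cat A B"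
    and g: "g \<in> Mor quiver_rep_cat B D"
  note m = complex_module_facts[OF quiver_rep_module[OF A]]
  have f: "\<And>i. f i \<in> module_hom complex_field (space A i) (space B i)"
    "\<And>i v. v \<in> carrier (space A i) \<Longrightarrow> f (Suc i) (arr_a A i v) = arr_a B i (f i v)"
    "\<And>i v. v \<in> carrier (space A (Suc i)) \<Longrightarrow> f i (arr_b A i v) = arr_b B i (f (Suc i) v)"
    and g: "\<And>i. g i \<in> module_hom complex_field (space B i) (space D i)"
    "\<And>i v. v \<in> carrier (space B i) \<Longrightarrow> g (Suc i) (arr_a B i v) = arr_a D i (g i v)"
    "\<And>i v. v \<in> carrier (space B (Suc i)) \<Longrightarrow> g i (arr_b B i v) = arr_b D i (g (Suc i) v)"
    using f g by (auto simp: quiver_rep_cat_def rep_hom_def)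
  have ab: "\<And>i v. v \<in> carrier (space A i) \<Longrightarrow> arr_a A i v \<in> carrier (space A (Suc i))"
    "\<And>i v. v \<in> carrier (space A (Suc i)) \<Longrightarrow> arr_b A i v \<in> carrier (space A i)"
    using A by (auto simp: quiver_rep_cat_def is_quiver_rep_def intro: module_hom_simps(2))
  have "compose (carrier (space A i)) (g i) (f i) \<in> module_hom complex_field (space A i) (space D
    i)" for i
    by (rule module_hom_compose[OF f(1) g(1)]) (use m in auto)
  then show "Comp quiver_rep_cat A B D g f \<in> Mor quiver_rep_cat A D"
    using f g ab module_hom_simps(2)[OF f(1)] by (simp add: quiver_rep_cat_def rep_hom_def
      compose_eq)
next
  fix A B D E :: "'b quiver_rep" and f g h
  assume "f \<in> Mor quiver_rep_cat A B"
  then have "f i \<in> carrier (space A i) \<rightarrow>\<^sub>E carrier (space B i)" for i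
    by (simp add: quiver_rep_cat_def rep_hom_def module_hom_def)
  then show "Comp quiver_rep_cat A D E h (Comp quiver_rep_cat A B D g f) =
    Comp quiver_rep_cat A B E (Comp quiver_rep_cat B D E h g) f"
    unfolding quiver_rep_cat_def cat.simps
    by (intro ext compose_assoc'[where T = "carrier (space B _)"])
next
  fix A B :: "'b quiver_rep" and f assume "f \<in> Mor quiver_rep_cat A B"
  then have *: "f i \<in> carrier (space A i) \<rightarrow>\<^sub>E carrier (space B i)" for i
    by (simp add: quiver_rep_cat_def rep_hom_def module_hom_def)
  show "Comp quiver_rep_cat A A B f (Idn quiver_rep_cat A) = f"
    "Comp quiver_rep_cat A B B (Idn quiver_rep_cat B) f = f"
    by (simp_all add: quiver_rep_cat_def compose_extensional_id[OF *])
qed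

lemma direct_sum_abelian_group:
  assumes V: "\<And>i :: nat. abelian_group (V i)"
  shows "abelian_group (direct_sum UNIV V)"
proof (rule abelian_groupI)
  interpret V: abelian_group "V i" for i by (rule V)
  fix f g k assume *: "f \<in> carrier (direct_sum UNIV V)" "g \<in> carrier (direct_sum UNIV V)" "k \<in>
    carrier (direct_sum UNIV V)"
  have fin: "finite {i. f i \<noteq> \<zero>\<^bsub>V i\<^esub>}" "finite {i. g i \<noteq> \<zero>\<^bsub>V i\<^esub>}"
    and cl: "\<And>i. f i \<in> carrier (V i)" "\<And>i. g i \<in> carrier (V i)" "\<And>i. k i \<in> carrier (V i)"
    using * by (auto simp: direct_sum_def)
  have "finite {i. f i \<oplus>\<^bsub>V i\<^esub> g i \<noteq> \<zero>\<^bsub>V i\<^esub>}"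
    by (rule finite_subset[OF _ finite_UnI[OF fin]]) auto
  then show "f \<oplus>\<^bsub>direct_sum UNIV V\<^esub> g \<in> carrier (direct_sum UNIV V)"
    using cl by (simp add: direct_sum_def)
  show "(f \<oplus>\<^bsub>direct_sum UNIV V\<^esub> g) \<oplus>\<^bsub>direct_sum UNIV V\<^esub> k =
    f \<oplus>\<^bsub>direct_sum UNIV V\<^esub> (g \<oplus>\<^bsub>direct_sum UNIV V\<^esub> k)"
    "f \<oplus>\<^bsub>direct_sum UNIV V\<^esub> g = g \<oplus>\<^bsub>direct_sum UNIV V\<^esub> f" "\<zero>\<^bsub>direct_sum UNIV V\<^esub> \<oplus>\<^bsub>direct_sum UNIV
      V\<^esub> f = f"
    using cl V.a_assoc V.a_comm by (auto simp: direct_sum_def fun_eq_iff)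
  have "finite {i. \<ominus>\<^bsub>V i\<^esub> f i \<noteq> \<zero>\<^bsub>V i\<^esub>}"
    by (rule finite_subset[OF _ fin(1)]) auto
  then show "\<exists>g\<in>carrier (direct_sum UNIV V). g \<oplus>\<^bsub>direct_sum UNIV V\<^esub> f = \<zero>\<^bsub>direct_sum UNIV V\<^esub>"
    using cl V.l_neg by (intro bexI[of _ "\<lambda>i. \<ominus>\<^bsub>V i\<^esub> f i"]) (auto simp: direct_sum_def)
next
  interpret V: abelian_group "V i" for i by (rule V)
  show "\<zero>\<^bsub>direct_sum UNIV V\<^esub> \<in> carrier (direct_sum UNIV V)" by (simp add: direct_sum_def)
qed

lemma finsum_additive:
  fixes A :: "('a, 'm) ring_scheme" and B :: "('b, 'n) ring_scheme"
  assumes "abelian_group A" "abelian_group B" and f: "f \<in> carrier A \<rightarrow> carrier B" "f \<zero>\<^bsub>A\<^esub> = \<zero>\<^bsub>B\<^esub>"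
      "\<And>x y. \<lbrakk>x \<in> carrier A; y \<in> carrier A\<rbrakk> \<Longrightarrow> f (x \<oplus>\<^bsub>A\<^esub> y) = f x \<oplus>\<^bsub>B\<^esub> f y"
    and "finite T" "g \<in> T \<rightarrow> carrier A"
  shows "f (finsum A g T) = finsum B (\<lambda>t. f (g t)) T"
  using assms(6,7)
proof (induction T rule: finite_induct)
  case empty
  interpret A: abelian_group A by fact
  interpret B: abelian_group B by fact
  show ?case by (simp add: f)
next
  case (insert t T)
  interpret A: abelian_group A by fact
  interpret B: abelian_group B by fact
  have g: "g t \<in> carrier A" "g \<in> T \<rightarrow> carrier A" using insert.prems by auto
  have "finsum B (\<lambda>t. f (g t)) (insert t T) = f (g t) \<oplus>\<^bsub>B\<^esub> finsum B (\<lambda>t. f (g t)) T"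
    by (rule B.finsum_insert) (use insert g f in auto)
  moreover have "finsum A g (insert t T) = g t \<oplus>\<^bsub>A\<^esub> finsum A g T"
    by (rule A.finsum_insert) (use insert g in auto)
  ultimately show ?case
    using insert.IH[OF g(2)] f(3)[OF g(1) A.finsum_closed[OF g(2)]] by simp
qed

lemma direct_sum_finsum:
  fixes V :: "nat \<Rightarrow> ('r, 'a) module"
  assumes V: "\<And>i. abelian_group (V i)" and "finite T" "g \<in> T \<rightarrow> carrier (direct_sum UNIV V)"
  shows "(finsum (direct_sum UNIV V) g T) i = finsum (V i) (\<lambda>t. g t i) T"
proof (rule finsum_additive[where f = "\<lambda>u. u i", OF direct_sum_abelian_group[OF V] V])
  show "(\<lambda>u. u i) \<in> carrier (direct_sum UNIV V) \<rightarrow> carrier (V i)"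
    by (auto simp: direct_sum_def)
qed (use assms(2,3) in \<open>auto simp: direct_sum_def\<close>)

section \<open>Representations on carriers of the given type\<close>

locale coords_embedding =
  fixes h :: "coords \<Rightarrow> 'b"
  assumes inj_h: "inj_on h bounded_coords"
begin

text \<open>\<open>h\<close> is injective on bounded vectors only, so this is an inverse on finite
  dimensional spaces; hence the assumptions \<open>fd_space\<close> in what follows.\<close>

definition h' :: "'b \<Rightarrow> coords" where
  "h' = inv_into bounded_coords h"

lemma h'_h: "x \<in> bounded_coords \<Longrightarrow> h' (h x) = x"
  using inj_h by (simp add: h'_def)

lemma h'_h_fd: "\<lbrakk>fd_space S; x \<in> S\<rbrakk> \<Longrightarrow> h' (h x) = x"
  using fd_space_bounded h'_h by blast

definition vec :: "coords set \<Rightarrow> (complex, 'b) module" where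
  "vec S = \<lparr>carrier = h ` S, monoid.mult = undefined, one = undefined, ring.zero = h 0,
     add = (\<lambda>x y. h (h' x + h' y)), module.smult = (\<lambda>c x. h (scl c (h' x)))\<rparr>"

lemma vec_simps [simp]:
  "carrier (vec S) = h ` S" "\<zero>\<^bsub>vec S\<^esub> = h 0" "x \<oplus>\<^bsub>vec S\<^esub> y = h (h' x + h' y)"
  "c \<odot>\<^bsub>vec S\<^esub> x = h (scl c (h' x))"
  by (simp_all add: vec_def)

lemma bij_h: "fd_space S \<Longrightarrow> bij_betw h S (h ` S)"
  using inj_on_subset[OF inj_h fd_space_bounded] by (simp add: bij_betw_def)

lemma vec_iso_vec: "fd_space S \<Longrightarrow> vec_iso S (vec S) h"
  using bij_h by (auto simp: vec_iso_def h'_h_fd)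

lemma vec_module: "fd_space S \<Longrightarrow> Module.module complex_field (vec S)"
  using vec_iso_module[OF _ vec_iso_vec] by (simp add: fd_space_def)

definition conj_map :: "coords set \<Rightarrow> (coords \<Rightarrow> coords) \<Rightarrow> 'b \<Rightarrow> 'b" where
  "conj_map S f = restrict (\<lambda>x. h (f (h' x))) (h ` S)"

lemma conj_map_h: "\<lbrakk>fd_space S; x \<in> S\<rbrakk> \<Longrightarrow> conj_map S f (h x) = h (f x)"
  by (simp add: conj_map_def h'_h_fd)

lemma conj_map_hom:
  assumes S: "fd_space S" and T: "fd_space T"
    and f: "\<And>x. x \<in> S \<Longrightarrow> f x \<in> T" "\<And>x y. \<lbrakk>x \<in> S; y \<in> S\<rbrakk> \<Longrightarrow> f (x + y) = f x + f y"
      "\<And>c x. x \<in> S \<Longrightarrow> f (scl c x) = scl c (f x)"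
  shows "conj_map S f \<in> module_hom complex_field (vec S) (vec T)"
proof -
  have S': "cs.subspace S" using S by (simp add: fd_space_def)
  have "restrict (\<lambda>x. h (f (h' x))) (carrier (vec S)) \<in> module_hom complex_field (vec S) (vec T)"
    by (rule module_homI)
      (use S T f cs.subspace_add[OF S'] cs.subspace_scale[OF S'] in \<open>auto simp: h'_h_fd\<close>)
  then show ?thesis by (simp add: conj_map_def)
qed

definition rep :: "quiver_model \<Rightarrow> 'b quiver_rep" where
  "rep W = \<lparr>space = (\<lambda>i. vec (qsp W i)), arr_a = (\<lambda>i. conj_map (qsp W i) (qa W i)),
     arr_b = (\<lambda>i. conj_map (qsp W (Suc i)) (qb W i))\<rparr>"

definition rep_functor :: "(quiver_model, nat \<Rightarrow> coords \<Rightarrow> coords, 'b quiver_rep, nat \<Rightarrow> 'b \<Rightarrow> 'b)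
  cat_map" where
  "rep_functor = \<lparr>omap = rep, mmap = (\<lambda>V W f i. conj_map (qsp V i) (f i))\<rparr>"

text \<open>The spaces are interleaved into one subspace \<open>T\<close> of the coordinate vectors
  by pairing vertex and position. \<open>T\<close> has bounded support because almost all of the
  spaces vanish, and it is isomorphic to the direct sum.\<close>

lemma finite_dim_direct_sum:
  fixes S :: "nat \<Rightarrow> coords set"
  assumes W: "\<And>i. fd_space (S i)" and N: "\<And>i. i \<ge> N \<Longrightarrow> S i = {0}"
  shows "finite_dim (direct_sum UNIV (\<lambda>i. vec (S i)))"
proof -
  define sl where "sl g n = (\<lambda>j. g (prod_encode (n, j)))" for g :: coords and n
  define T where "T = {g. \<forall>n. sl g n \<in> S n}"
  have sub: "cs.subspace (S n)" for n using W by (simp add: fd_space_def)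
  have sl: "sl (f + g) n = sl f n + sl g n" "sl (scl c f) n = scl c (sl f n)" "sl 0 n =
    0" for f g n c
    by (simp_all add: sl_def fun_eq_iff coords_apply)
  have subT: "cs.subspace T"
    using cs.subspace_0[OF sub] cs.subspace_add[OF sub] cs.subspace_scale[OF sub]
    by (auto simp: cs.subspace_def T_def sl)
  have "\<forall>n. \<exists>d. S n \<subseteq> coord_space d" using W by (auto simp: fd_space_def)
  then obtain d where d: "\<And>n. S n \<subseteq> coord_space (d n)" by metis
  define D where "D = (\<Sum>n<N. d n)"
  let ?I = "prod_encode ` ({..N} \<times> {..D})"
  have *: "m \<in> ?I" if g: "g \<in> T" and m: "g m \<noteq> 0" for g m
  proof (rule ccontr)
    assume mI: "m \<notin> ?I"
    obtain n j where mm: "m = prod_encode (n, j)" by (metis prod_decode_inverse prod.collapse)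
    have gm: "g m = sl g n j" by (simp add: sl_def mm)
    have gS: "sl g n \<in> S n" using g by (simp add: T_def)
    have "n > N \<or> j > D" using mI unfolding mm by force
    then consider "n \<ge> N" | "n < N" "j > D" by linarith
    then have "g m = 0"
    proof cases
      case 1 then show ?thesis using N gS gm by (simp add: zero_fun_apply)
    next
      case 2
      have "d n \<le> D" unfolding D_def using 2 by (simp add: member_le_sum)
      then show ?thesis using gS d[of n] 2 gm by (auto simp: coord_space_def)
    qed
    then show False using m by simp
  qed
  have "finite ?I" by simp
  then obtain B where B: "\<forall>m\<in>?I. m < B" unfolding finite_nat_set_iff_bounded by blast
  have "T \<subseteq> coord_space B"
  proof
    fix g assume g: "g \<in> T"
    have "g m = 0" if "m \<ge> B" for m
      using *[OF g, of m] bspec[OF B, of m] that by linarith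
    then show "g \<in> coord_space B" by (simp add: coord_space_def)
  qed
  then have fdT: "fd_space T" using subT by (auto simp: fd_space_def)
  let ?D = "direct_sum UNIV (\<lambda>i. vec (S i))"
  have "vec_iso T ?D (\<lambda>g n. h (sl g n))"
    unfolding vec_iso_def
  proof (intro conjI ballI allI)
    show "bij_betw (\<lambda>g n. h (sl g n)) T (carrier ?D)"
    proof (rule bij_betw_byWitness[where f' = "\<lambda>f m. h' (f (fst (prod_decode m))) (snd
      (prod_decode m))"])
      have sl': "sl (\<lambda>m. h' (f (fst (prod_decode m))) (snd (prod_decode m))) n = h' (f n)" for f n
        by (simp add: sl_def)
      show "\<forall>g\<in>T. (\<lambda>m. h' (h (sl g (fst (prod_decode m)))) (snd (prod_decode m))) = g"
      proof
        fix g assume "g \<in> T"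
        then have "h' (h (sl g n)) = sl g n" for n using h'_h_fd[OF W[of n]] by (simp add: T_def)
        then show "(\<lambda>m. h' (h (sl g (fst (prod_decode m)))) (snd (prod_decode m))) = g"
          by (simp add: sl_def)
      qed
      show "\<forall>f\<in>carrier ?D. (\<lambda>n. h (sl (\<lambda>m. h' (f (fst (prod_decode m))) (snd (prod_decode m))) n)) =
        f"
      proof
        fix f assume "f \<in> carrier ?D"
        then have "f n \<in> h ` S n" for n by (auto simp: direct_sum_def)
        then have "h (h' (f n)) = f n" for n using h'_h_fd[OF W[of n]] by force
        then show "(\<lambda>n. h (sl (\<lambda>m. h' (f (fst (prod_decode m))) (snd (prod_decode m))) n)) = f"
          by (simp add: sl')
      qed
      show "(\<lambda>g n. h (sl g n)) ` T \<subseteq> carrier ?D"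
      proof safe
        fix g assume g: "g \<in> T"
        have "{n. h (sl g n) \<noteq> h 0} \<subseteq> {..<N}"
        proof
          fix n assume "n \<in> {n. h (sl g n) \<noteq> h 0}"
          moreover have "sl g n \<in> S n" using g by (simp add: T_def)
          ultimately show "n \<in> {..<N}" using N[of n] by (cases "n \<ge> N") auto
        qed
        then have "finite {n. h (sl g n) \<noteq> h 0}" by (rule finite_subset) simp
        then show "(\<lambda>n. h (sl g n)) \<in> carrier ?D" using g by (auto simp: direct_sum_def T_def)
      qed
      show "(\<lambda>f m. h' (f (fst (prod_decode m))) (snd (prod_decode m))) ` carrier ?D \<subseteq> T"
      proof safe
        fix f assume "f \<in> carrier ?D"
        then have "f n \<in> h ` S n" for n by (auto simp: direct_sum_def)
        then have "h' (f n) \<in> S n" for n using h'_h_fd[OF W[of n]] by force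
        then show "(\<lambda>m. h' (f (fst (prod_decode m))) (snd (prod_decode m))) \<in> T"
          by (simp add: T_def sl')
      qed
    qed
    show "(\<lambda>n. h (sl 0 n)) = \<zero>\<^bsub>?D\<^esub>" by (simp add: direct_sum_def sl fun_eq_iff)
    show "(\<lambda>n. h (sl (f + g) n)) = (\<lambda>n. h (sl f n)) \<oplus>\<^bsub>?D\<^esub> (\<lambda>n. h (sl g n))"
      if "f \<in> T" "g \<in> T" for f g
    proof -
      have "h' (h (sl f n)) = sl f n" "h' (h (sl g n)) = sl g n" for n
        using that h'_h_fd[OF W[of n]] by (simp_all add: T_def)
      then show ?thesis by (intro ext) (simp add: direct_sum_def sl)
    qed
    show "(\<lambda>n. h (sl (scl c f) n)) = c \<odot>\<^bsub>?D\<^esub> (\<lambda>n. h (sl f n))" if "f \<in> T" for c f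
    proof -
      have "h' (h (sl f n)) = sl f n" for n using that h'_h_fd[OF W[of n]] by (simp add: T_def)
      then show ?thesis by (intro ext) (simp add: direct_sum_def sl)
    qed
  qed
  then show ?thesis by (rule vec_iso_finite_dim[OF fdT])
qed

lemma rep_Obj:
  assumes W: "W \<in> Obj quiver_model_cat"
  shows "rep W \<in> Obj quiver_rep_cat"
proof -
  have W: "is_quiver_model W" using W by (simp add: quiver_model_cat_def)
  have fd: "\<And>i. fd_space (qsp W i)" and l: "\<And>i. lin (qa W i)" "\<And>i. lin (qb W i)"
    and cl: "\<And>i v. v \<in> qsp W i \<Longrightarrow> qa W i v \<in> qsp W (Suc i)" "\<And>i v. v \<in> qsp W (Suc i)
      \<Longrightarrow> qb W i v \<in> qsp W i"
    and r: "\<And>v. v \<in> qsp W 0 \<Longrightarrow> qb W 0 (qa W 0 v) = 0"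
      "\<And>i v. v \<in> qsp W (Suc i) \<Longrightarrow> qa W i (qb W i v) = qb W (Suc i) (qa W (Suc i) v)"
    using W by (auto simp: is_quiver_model_def)
  obtain N where N: "\<And>i. i \<ge> N \<Longrightarrow> qsp W i = {0}" using W by (auto simp: is_quiver_model_def)
  have "is_quiver_rep (rep W)"
    unfolding is_quiver_rep_def rep_def quiver_rep.simps
    using vec_module[OF fd] conj_map_hom[OF fd fd cl(1)] conj_map_hom[OF fd fd cl(2)]
      lin_add[OF l(1)] lin_add[OF l(2)] lin_scale[OF l(1)] lin_scale[OF l(2)] by simp
  moreover have "satisfies_relations (rep W)"
    unfolding satisfies_relations_def rep_def quiver_rep.simps
    using cl r by (auto simp: conj_map_h[OF fd])
  moreover have "finite_dim (direct_sum UNIV (space (rep W)))"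
    using finite_dim_direct_sum[of "qsp W" N] fd N by (simp add: rep_def)
  ultimately show ?thesis by (simp add: quiver_rep_cat_def)
qed

lemma rep_functor_Mor:
  assumes "V \<in> Obj quiver_model_cat" "W \<in> Obj quiver_model_cat"
    and f: "f \<in> Mor quiver_model_cat V W"
  shows "(\<lambda>i. conj_map (qsp V i) (f i)) \<in> Mor quiver_rep_cat (rep V) (rep W)"
proof -
  have fd: "\<And>i. fd_space (qsp V i)" "\<And>i. fd_space (qsp W i)"
    and cl: "\<And>i v. v \<in> qsp V i \<Longrightarrow> qa V i v \<in> qsp V (Suc i)" "\<And>i v. v \<in> qsp V (Suc i)
      \<Longrightarrow> qb V i v \<in> qsp V i"
    using assms(1,2) by (auto simp: is_quiver_model_def quiver_model_cat_def)
  have fl: "\<And>i. f i \<in> lin_maps (qsp V i) (qsp W i)"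
    and fab: "\<And>i v. v \<in> qsp V i \<Longrightarrow> f (Suc i) (qa V i v) = qa W i (f i v)"
      "\<And>i v. v \<in> qsp V (Suc i) \<Longrightarrow> f i (qb V i v) = qb W i (f (Suc i) v)"
    using f by (auto simp: quiver_model_cat_def)
  have "conj_map (qsp V i) (f i) \<in> module_hom complex_field (vec (qsp V i)) (vec (qsp W i))" for i
    by (rule conj_map_hom[OF fd])
      (use lin_maps_mem[OF fl] lin_maps_add[OF fl] lin_maps_scale[OF fl] in auto)
  then show ?thesis
    unfolding quiver_rep_cat_def cat.simps rep_hom_def rep_def quiver_rep.simps
    using cl lin_maps_mem[OF fl] by (auto simp: conj_map_h[OF fd(1)] conj_map_h[OF fd(2)] fab)
qed

text \<open>\<open>h\<close> maps each space bijectively onto its carrier, so conjugation by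
  \<open>h\<close> is undone by conjugation by \<open>h'\<close>.\<close>

lemma rep_functor_full:
  assumes "V \<in> Obj quiver_model_cat" "W \<in> Obj quiver_model_cat"
    and g: "g \<in> Mor quiver_rep_cat (rep V) (rep W)"
  shows "\<exists>f\<in>Mor quiver_model_cat V W. (\<lambda>i. conj_map (qsp V i) (f i)) = g"
proof -
  have fd: "\<And>i. fd_space (qsp V i)" "\<And>i. fd_space (qsp W i)"
    and cl: "\<And>i v. v \<in> qsp V i \<Longrightarrow> qa V i v \<in> qsp V (Suc i)" "\<And>i v. v \<in> qsp V (Suc i)
      \<Longrightarrow> qb V i v \<in> qsp V i"
      "\<And>i v. v \<in> qsp W i \<Longrightarrow> qa W i v \<in> qsp W (Suc i)" "\<And>i v. v \<in> qsp W (Suc i) \<Longrightarrow> qb W i v \<in> qsp W i"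
    using assms(1,2) by (auto simp: is_quiver_model_def quiver_model_cat_def)
  have sub: "cs.subspace (qsp V i)" "cs.subspace (qsp W i)" for i
    using fd by (auto simp: fd_space_def)
  have gh: "\<And>i. g i \<in> module_hom complex_field (vec (qsp V i)) (vec (qsp W i))"
    and ga: "\<And>i v. v \<in> qsp V i \<Longrightarrow> g (Suc i) (h (qa V i v)) = conj_map (qsp W i) (qa W i) (g i (h v))"
    and gb: "\<And>i v. v \<in> qsp V (Suc i) \<Longrightarrow> g i (h (qb V i v)) =
      conj_map (qsp W (Suc i)) (qb W i) (g (Suc i) (h v))"
    using g by (auto simp: quiver_rep_cat_def rep_hom_def rep_def conj_map_h[OF fd(1)])
  define f where "f i = restrict (\<lambda>x. h' (g i (h x))) (qsp V i)" for i
  have hf: "h (f i x) = g i (h x)" "f i x \<in> qsp W i" if x: "x \<in> qsp V i" for i x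
  proof -
    obtain y where "y \<in> qsp W i" "g i (h x) = h y"
      using module_hom_simps(2)[OF gh, of "h x" i] x by auto
    then show "h (f i x) = g i (h x)" "f i x \<in> qsp W i"
      using x by (simp_all add: f_def h'_h_fd[OF fd(2)])
  qed
  have h_inj: "x = y" if "h x = h y" "x \<in> qsp W i" "y \<in> qsp W i" for x y i
    using that h'_h_fd[OF fd(2)] by metis
  have "f i \<in> lin_maps (qsp V i) (qsp W i)" for i
  proof -
    have "f i (x + y) = f i x + f i y" if xy: "x \<in> qsp V i" "y \<in> qsp V i" for x y
    proof (rule h_inj[of _ _ i])
      have "h (f i (x + y)) = g i (h (x + y))" by (rule hf(1))
        (use xy cs.subspace_add[OF sub(1)] in auto)
      also have "h (x + y) = h x \<oplus>\<^bsub>vec (qsp V i)\<^esub> h y"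
        using xy by (simp add: h'_h_fd[OF fd(1)[of i]])
      also have "g i \<dots> = g i (h x) \<oplus>\<^bsub>vec (qsp W i)\<^esub> g i (h y)"
        by (rule module_hom_simps(3)[OF gh]) (use xy in simp_all)
      also have "\<dots> = h (f i x + f i y)" using xy by (simp add: f_def)
      finally show "h (f i (x + y)) = h (f i x + f i y)" .
    qed (use xy hf(2) cs.subspace_add[OF sub(1)] cs.subspace_add[OF sub(2)] in auto)
    moreover have "f i (scl c x) = scl c (f i x)" if x: "x \<in> qsp V i" for c x
    proof (rule h_inj[of _ _ i])
      have "h (f i (scl c x)) = g i (h (scl c x))"
        by (rule hf(1)) (use x cs.subspace_scale[OF sub(1)] in auto)
      also have "h (scl c x) = c \<odot>\<^bsub>vec (qsp V i)\<^esub> h x"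
        using x by (simp add: h'_h_fd[OF fd(1)[of i]])
      also have "g i \<dots> = c \<odot>\<^bsub>vec (qsp W i)\<^esub> g i (h x)"
        by (rule module_hom_simps(4)[OF gh]) (use x in simp_all)
      also have "\<dots> = h (scl c (f i x))" using x by (simp add: f_def)
      finally show "h (f i (scl c x)) = h (scl c (f i x))" .
    qed (use x hf(2) cs.subspace_scale[OF sub(1)] cs.subspace_scale[OF sub(2)] in auto)
    ultimately show ?thesis using hf(2) by (auto simp: lin_maps_def f_def)
  qed
  moreover have "f (Suc i) (qa V i v) = qa W i (f i v)" if "v \<in> qsp V i" for i v
  proof (rule h_inj[of _ _ "Suc i"])
    have "h (f (Suc i) (qa V i v)) = g (Suc i) (h (qa V i v))" by (rule hf(1)) (use that cl in auto)
    also have "\<dots> = conj_map (qsp W i) (qa W i) (h (f i v))" unfolding ga[OF that] hf(1)[OF that] ..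
    also have "\<dots> = h (qa W i (f i v))" by (rule conj_map_h[OF fd(2) hf(2)[OF that]])
    finally show "h (f (Suc i) (qa V i v)) = h (qa W i (f i v))" .
  qed (use that hf(2) cl in auto)
  moreover have "f i (qb V i v) = qb W i (f (Suc i) v)" if "v \<in> qsp V (Suc i)" for i v
  proof (rule h_inj[of _ _ i])
    have "h (f i (qb V i v)) = g i (h (qb V i v))" by (rule hf(1)) (use that cl in auto)
    also have "\<dots> = conj_map (qsp W (Suc i)) (qb W i) (h (f (Suc i) v))"
      unfolding gb[OF that] hf(1)[OF that] ..
    also have "\<dots> = h (qb W i (f (Suc i) v))" by (rule conj_map_h[OF fd(2) hf(2)[OF that]])
    finally show "h (f i (qb V i v)) = h (qb W i (f (Suc i) v))" .
  qed (use that hf(2) cl in auto)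
  ultimately have "f \<in> Mor quiver_model_cat V W" by (simp add: quiver_model_cat_def)
  moreover have "conj_map (qsp V i) (f i) = g i" for i
  proof
    fix x show "conj_map (qsp V i) (f i) x = g i x"
    proof (cases "x \<in> h ` qsp V i")
      case True
      then obtain v where v: "v \<in> qsp V i" "x = h v" by blast
      show ?thesis unfolding v(2) conj_map_h[OF fd(1) v(1)] by (rule hf(1)[OF v(1)])
    next
      case False
      then show ?thesis using module_hom_simps(1)[OF gh[of i]]
        by (simp add: conj_map_def PiE_iff extensional_def)
    qed
  qed
  ultimately show ?thesis by blast
qed

end

lemma coordinates_simps:
  assumes "coordinates V d \<phi> \<psi>"
  shows "\<psi> x \<in> carrier V" "\<psi> (x + y) = \<psi> x \<oplus>\<^bsub>V\<^esub> \<psi> y" "\<psi> (scl c x) = c \<odot>\<^bsub>V\<^esub> \<psi> x"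
    "v \<in> carrier V \<Longrightarrow> \<phi> v \<in> coord_space d" "v \<in> carrier V \<Longrightarrow> \<psi> (\<phi> v) = v"
    "x \<in> coord_space d \<Longrightarrow> \<phi> (\<psi> x) = x"
  using assms by (auto simp: coordinates_def)

text \<open>The components at i of a finite spanning set of the direct sum span the space at i. Each
  member of this set has finite support, so beyond all these supports the spaces are zero.\<close>

lemma quiver_rep_coordinates:
  assumes V: "V \<in> Obj quiver_rep_cat"
  obtains d \<phi> \<psi> where "\<And>i. coordinates (space V i) (d i) (\<phi> i) (\<psi> i)"
    and "\<exists>N. \<forall>i\<ge>N. coord_space (d i) = {0}"
proof -
  let ?D = "direct_sum UNIV (space V)"
  have mod: "\<And>i. Module.module complex_field (space V i)" by (rule quiver_rep_module[OF V])
  have ab: "\<And>i. abelian_group (space V i)" using complex_module_facts(1)[OF mod] .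
  obtain T where T: "finite T" "T \<subseteq> carrier ?D" "\<And>v. v \<in> carrier ?D
    \<Longrightarrow> \<exists>c. v = finsum ?D (\<lambda>s. c s \<odot>\<^bsub>?D\<^esub> s) T"
    using V unfolding quiver_rep_cat_def finite_dim_def by auto
  have Ti: "s i \<in> carrier (space V i)" if "s \<in> T" for s i
    using T(2) that by (auto simp: direct_sum_def)
  have span: "\<exists>c. v = finsum (space V i) (\<lambda>s. c s \<odot>\<^bsub>space V i\<^esub> s i) T"
    if v: "v \<in> carrier (space V i)" for i v
  proof -
    \<comment> \<open>The vector is placed into the direct sum at vertex i, expanded there, and
      evaluated at i again.\<close>
    define u where "u = (\<lambda>j. if j = i then v else \<zero>\<^bsub>space V j\<^esub>)"
    have "{j. u j \<noteq> \<zero>\<^bsub>space V j\<^esub>} \<subseteq> {i}" by (auto simp: u_def)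
    then have "finite {j. u j \<noteq> \<zero>\<^bsub>space V j\<^esub>}" by (rule finite_subset) simp
    then have "u \<in> carrier ?D" using v complex_module_facts(2)[OF mod]
      by (auto simp: direct_sum_def u_def)
    then obtain c where c: "u = finsum ?D (\<lambda>s. c s \<odot>\<^bsub>?D\<^esub> s) T" using T(3) by blast
    have cs: "(\<lambda>s. c s \<odot>\<^bsub>?D\<^esub> s) \<in> T \<rightarrow> carrier ?D"
    proof
      fix s assume s: "s \<in> T"
      have "c s \<odot>\<^bsub>space V j\<^esub> s j = \<zero>\<^bsub>space V j\<^esub>" if "s j = \<zero>\<^bsub>space V j\<^esub>" for j
      proof -
        interpret Vj: Module.module complex_field "space V j" by (rule mod)
        show ?thesis using that Vj.smult_r_null[of "c s"] by simp
      qed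
      then have "{j. c s \<odot>\<^bsub>space V j\<^esub> s j \<noteq> \<zero>\<^bsub>space V j\<^esub>} \<subseteq> {j. s j \<noteq> \<zero>\<^bsub>space V j\<^esub>}" by auto
      moreover have "finite {j. s j \<noteq> \<zero>\<^bsub>space V j\<^esub>}" using T(2) s by (auto simp: direct_sum_def)
      ultimately have "finite {j. c s \<odot>\<^bsub>space V j\<^esub> s j \<noteq> \<zero>\<^bsub>space V j\<^esub>}" by (rule finite_subset)
      then show "c s \<odot>\<^bsub>?D\<^esub> s \<in> carrier ?D"
        using Ti[OF s] complex_module_facts(4)[OF mod] by (auto simp: direct_sum_def)
    qed
    have "v = u i" by (simp add: u_def)
    also have "\<dots> = finsum (space V i) (\<lambda>s. (c s \<odot>\<^bsub>?D\<^esub> s) i) T"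
      unfolding c by (rule direct_sum_finsum[OF ab T(1) cs])
    also have "(\<lambda>s. (c s \<odot>\<^bsub>?D\<^esub> s) i) = (\<lambda>s. c s \<odot>\<^bsub>space V i\<^esub> s i)" by (simp add: direct_sum_def)
    finally show ?thesis by blast
  qed
  have "\<exists>d \<phi> \<psi>. coordinates (space V i) d \<phi> \<psi>" for i
    by (rule coordinates_exist[OF mod T(1), where g = "\<lambda>s. s i"]) (use Ti span in auto)
  then obtain d \<phi> \<psi> where co: "\<And>i. coordinates (space V i) (d i) (\<phi> i) (\<psi> i)" by metis
  have "finite (\<Union>s\<in>T. {j. s j \<noteq> \<zero>\<^bsub>space V j\<^esub>})" using T by (auto simp: direct_sum_def)
  then obtain N where N: "\<forall>j\<in>(\<Union>s\<in>T. {j. s j \<noteq> \<zero>\<^bsub>space V j\<^esub>}). j < N"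
    unfolding finite_nat_set_iff_bounded by blast
  have "coord_space (d i) = {0}" if i: "i \<ge> N" for i
  proof -
    interpret Vi: Module.module complex_field "space V i" by (rule mod)
    have s0: "s i = \<zero>\<^bsub>space V i\<^esub>" if "s \<in> T" for s using N i that by fastforce
    have zero: "v = \<zero>\<^bsub>space V i\<^esub>" if v: "v \<in> carrier (space V i)" for v
    proof -
      obtain c where "v = finsum (space V i) (\<lambda>s. c s \<odot>\<^bsub>space V i\<^esub> s i) T" using span[OF v] by blast
      also have "\<dots> = finsum (space V i) (\<lambda>s. \<zero>\<^bsub>space V i\<^esub>) T"
      proof (rule Vi.finsum_cong')
        show "c s \<odot>\<^bsub>space V i\<^esub> s i = \<zero>\<^bsub>space V i\<^esub>" if "s \<in> T" for s
          using Vi.smult_r_null[of "c s"] s0[OF that] by simp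
      qed auto
      finally show ?thesis by simp
    qed
    have "x = 0" if "x \<in> coord_space (d i)" for x
    proof -
      have "\<psi> i x = \<psi> i 0" using zero coordinates_simps(1)[OF co] by metis
      then show ?thesis
        using that coordinates_simps(6)[OF co, of x i] coordinates_simps(6)[OF co, of 0 i]
          cs.subspace_0[OF subspace_coord_space] by simp
    qed
    then show ?thesis using cs.subspace_0[OF subspace_coord_space[of "d i"]] by blast
  qed
  then have "\<exists>N. \<forall>i\<ge>N. coord_space (d i) = {0}" by blast
  then show ?thesis using that co by blast
qed

text \<open>The arrows are carried to coordinates; then \<open>\<psi>\<close> after
  \<open>h'\<close> and \<open>h\<close> after \<open>\<phi>\<close> are mutually inverse
  morphisms.\<close>

lemma (in coords_embedding) rep_functor_preimage:
  assumes V: "V \<in> Obj quiver_rep_cat"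
  shows "\<exists>W\<in>Obj quiver_model_cat. \<exists>f. is_isomorphism quiver_rep_cat (rep W) V f"
proof -
  obtain d \<phi> \<psi> where co: "\<And>i. coordinates (space V i) (d i) (\<phi> i) (\<psi> i)"
    and bound: "\<exists>N. \<forall>i\<ge>N. coord_space (d i) = {0}"
    using quiver_rep_coordinates[OF V] by blast
  have mod: "\<And>i. Module.module complex_field (space V i)" by (rule quiver_rep_module[OF V])
  note c = coordinates_simps[OF co] and c_add = coordinates_add[OF co]
    and c_scale = coordinates_scale[OF co]
  have ha: "\<And>i. arr_a V i \<in> module_hom complex_field (space V i) (space V (Suc i))"
    and hb: "\<And>i. arr_b V i \<in> module_hom complex_field (space V (Suc i)) (space V i)"
    and rel0: "\<And>v. v \<in> carrier (space V 0) \<Longrightarrow> arr_b V 0 (arr_a V 0 v) = \<zero>\<^bsub>space V 0\<^esub>"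
    and rel: "\<And>i v. v \<in> carrier (space V (Suc i)) \<Longrightarrow> arr_a V i (arr_b V i v) =
      arr_b V (Suc i) (arr_a V (Suc i) v)"
    using V by (auto simp: quiver_rep_cat_def is_quiver_rep_def satisfies_relations_def)
  note a = module_hom_simps[OF ha] and b = module_hom_simps[OF hb]
  have \<phi>0: "\<phi> i \<zero>\<^bsub>space V i\<^esub> = 0" for i
    using coordinates_vec_iso[OF co mod, of i] c(6)[of 0 i] cs.subspace_0[OF subspace_coord_space]
    by (simp add: vec_iso_def)
  define W where "W = \<lparr>qsp = (\<lambda>i. coord_space (d i)), qa = (\<lambda>i x. \<phi> (Suc i) (arr_a V i (\<psi> i x))),
    qb = (\<lambda>i x. \<phi> i (arr_b V i (\<psi> (Suc i) x)))\<rparr>"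
  have la: "lin (\<lambda>x. \<phi> (Suc i) (arr_a V i (\<psi> i x)))" for i
    by (rule linI) (simp_all add: c a c_add c_scale)
  have lb: "lin (\<lambda>x. \<phi> i (arr_b V i (\<psi> (Suc i) x)))" for i
    by (rule linI) (simp_all add: c b c_add c_scale)
  have W: "W \<in> Obj quiver_model_cat"
    unfolding quiver_model_cat_def is_quiver_model_def W_def
    using bound la lb by (simp add: fd_coord_space c a b rel0 rel \<phi>0)
  have fd: "fd_space (qsp W i)" for i by (simp add: W_def fd_coord_space)
  have sub: "cs.subspace (coord_space (d i))" for i by (rule subspace_coord_space)
  have hh: "h' (h x) = x" if "x \<in> coord_space (d i)" for x i
    using h'_h_fd[OF fd_coord_space that] .
  have sp: "space (rep W) i = vec (coord_space (d i))" for i by (simp add: rep_def W_def)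
  have ca: "arr_a (rep W) i (h x) = h (\<phi> (Suc i) (arr_a V i (\<psi> i x)))"
    if "x \<in> coord_space (d i)" for i x
    using conj_map_h[OF fd, of x i] that by (simp add: rep_def W_def)
  have cb: "arr_b (rep W) i (h x) = h (\<phi> i (arr_b V i (\<psi> (Suc i) x)))"
    if "x \<in> coord_space (d (Suc i))" for i x
    using conj_map_h[OF fd, of x "Suc i"] that by (simp add: rep_def W_def)
  define f where "f i = restrict (\<lambda>x. \<psi> i (h' x)) (carrier (space (rep W) i))" for i
  define g where "g i = restrict (\<lambda>v. h (\<phi> i v)) (carrier (space V i))" for i
  have f_h: "f i (h x) = \<psi> i x" if "x \<in> coord_space (d i)" for i x
    using that by (simp add: f_def sp hh)
  have g_v: "g i v = h (\<phi> i v)" if "v \<in> carrier (space V i)" for i v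
    using that by (simp add: g_def)
  have "f i \<in> module_hom complex_field (space (rep W) i) (space V i)" for i
    unfolding f_def
    by (rule module_homI)
      (auto simp: sp hh[where i = i] c cs.subspace_add[OF sub] cs.subspace_scale[OF sub])
  moreover have "f (Suc i) (arr_a (rep W) i v) = arr_a V i (f i v)"
    if "v \<in> carrier (space (rep W) i)" for i v
    using that by (auto simp: sp ca f_h c a)
  moreover have "f i (arr_b (rep W) i v) = arr_b V i (f (Suc i) v)"
    if "v \<in> carrier (space (rep W) (Suc i))" for i v
    using that by (auto simp: sp cb f_h c b)
  ultimately have f: "f \<in> rep_hom (rep W) V" by (simp add: rep_hom_def)
  have "g i \<in> module_hom complex_field (space V i) (space (rep W) i)" for i
    unfolding g_def
    by (rule module_homI)
      (auto simp: sp c complex_module_facts[OF mod] c_add c_scale hh[OF c(4)])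
  moreover have "g (Suc i) (arr_a V i v) = arr_a (rep W) i (g i v)"
    if "v \<in> carrier (space V i)" for i v
    using that by (simp add: g_v a ca c)
  moreover have "g i (arr_b V i v) = arr_b (rep W) i (g (Suc i) v)"
    if "v \<in> carrier (space V (Suc i))" for i v
    using that by (simp add: g_v b cb c)
  ultimately have g: "g \<in> rep_hom V (rep W)" by (simp add: rep_hom_def)
  have "compose (carrier (space (rep W) i)) (g i) (f i) = (\<lambda>v\<in>carrier (space (rep W) i). v)" for i
    by (rule ext) (auto simp: compose_def sp f_h g_v c)
  moreover have "compose (carrier (space V i)) (f i) (g i) = (\<lambda>v\<in>carrier (space V i). v)" for i
    by (rule ext) (auto simp: compose_def f_h g_v c)
  ultimately have "is_isomorphism quiver_rep_cat (rep W) V f"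
    using f g unfolding is_isomorphism_def quiver_rep_cat_def by (auto intro!: bexI[of _ g])
  then show ?thesis using W by blast
qed

lemma (in coords_embedding) rep_functor_weak_equivalence:
  "weak_equivalence quiver_model_cat quiver_rep_cat rep_functor"
proof (rule weak_equivalenceI)
  show "category quiver_model_cat" by (rule category_quiver_model_cat)
  show "category quiver_rep_cat" by (rule category_quiver_rep_cat)
  have o: "omap rep_functor W = rep W" for W by (simp add: rep_functor_def)
  have m: "mmap rep_functor V W f = (\<lambda>i. conj_map (qsp V i) (f i))" for V W f
    by (simp add: rep_functor_def)
  have fd: "fd_space (qsp V i)" if "V \<in> Obj quiver_model_cat" for V i
    using that by (simp add: quiver_model_cat_def is_quiver_model_def)
  show "is_functor quiver_model_cat quiver_rep_cat rep_functor"
    unfolding is_functor_def o m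
  proof (intro conjI ballI)
    fix V assume V: "V \<in> Obj quiver_model_cat"
    show "rep V \<in> Obj quiver_rep_cat" by (rule rep_Obj[OF V])
    show "(\<lambda>i. conj_map (qsp V i) (Idn quiver_model_cat V i)) = Idn quiver_rep_cat (rep V)"
      by (intro ext) (auto simp: conj_map_def quiver_model_cat_def quiver_rep_cat_def rep_def
        h'_h_fd[OF fd[OF V]])
  next
    fix V W f assume "V \<in> Obj quiver_model_cat" "W \<in> Obj quiver_model_cat" "f \<in> Mor
      quiver_model_cat V W"
    then show "(\<lambda>i. conj_map (qsp V i) (f i)) \<in> Mor quiver_rep_cat (rep V) (rep W)"
      by (rule rep_functor_Mor)
  next
    fix V W U f g
    assume V: "V \<in> Obj quiver_model_cat" and W: "W \<in> Obj quiver_model_cat"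
      and f: "f \<in> Mor quiver_model_cat V W"
    have fW: "f i x \<in> qsp W i" if "x \<in> qsp V i" for i x
      using f that by (auto simp: quiver_model_cat_def intro: lin_maps_mem)
    then have hf: "h' (h (f i x)) = f i x" if "x \<in> qsp V i" for i x
      using that h'_h_fd[OF fd[OF W]] by blast
    show "(\<lambda>i. conj_map (qsp V i) (Comp quiver_model_cat V W U g f i)) =
      Comp quiver_rep_cat (rep V) (rep W) (rep U) (\<lambda>i. conj_map (qsp W i) (g i)) (\<lambda>i. conj_map
        (qsp V i) (f i))"
      using fW by (intro ext) (auto simp: conj_map_def quiver_model_cat_def quiver_rep_cat_def
        rep_def compose_def
          h'_h_fd[OF fd[OF V]] hf)
  qed
  show "inj_on (mmap rep_functor V W) (Mor quiver_model_cat V W)"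
    if V: "V \<in> Obj quiver_model_cat" and W: "W \<in> Obj quiver_model_cat" for V W
  proof (rule inj_onI)
    fix f g assume fg: "f \<in> Mor quiver_model_cat V W" "g \<in> Mor quiver_model_cat V W"
      and eq: "mmap rep_functor V W f = mmap rep_functor V W g"
    have l: "f i \<in> lin_maps (qsp V i) (qsp W i)" "g i \<in> lin_maps (qsp V i) (qsp W i)" for i
      using fg by (auto simp: quiver_model_cat_def)
    have "f i x = g i x" if x: "x \<in> qsp V i" for i x
    proof -
      have "h (f i x) = h (g i x)"
        using fun_cong[OF fun_cong[OF eq], of i "h x"] conj_map_h[OF fd[OF V] x] unfolding m by simp
      then have "h' (h (f i x)) = h' (h (g i x))" by (rule arg_cong)
      then show ?thesis
        by (simp only: h'_h_fd[OF fd[OF W] lin_maps_mem[OF l(1) x]] h'_h_fd[OF fd[OF W]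
          lin_maps_mem[OF l(2) x]])
    qed
    then show "f = g" using lin_maps_ext[OF l] by blast
  qed
  show "\<exists>f\<in>Mor quiver_model_cat V W. mmap rep_functor V W f = g"
    if "V \<in> Obj quiver_model_cat" "W \<in> Obj quiver_model_cat"
      "g \<in> Mor quiver_rep_cat (omap rep_functor V) (omap rep_functor W)" for V W g
    using rep_functor_full that unfolding o m by blast
  show "\<exists>W\<in>Obj quiver_model_cat. \<exists>f. is_isomorphism quiver_rep_cat (omap rep_functor W) V f"
    if "V \<in> Obj quiver_rep_cat" for V
    using rep_functor_preimage[OF that] unfolding o .
qed

section \<open>Modules over the algebra in coordinates\<close>

lemma const_simps: "const (c + d) = const c + const d" "const (c * d) =
  const c * const d" "const 1 = 1"
  by (simp_all add: const_def single_add mult_single)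

lemma underlying_simps [simp]:
  "carrier (underlying_space q M) = carrier M" "\<zero>\<^bsub>underlying_space q M\<^esub> = \<zero>\<^bsub>M\<^esub>"
  "x \<oplus>\<^bsub>underlying_space q M\<^esub> y = x \<oplus>\<^bsub>M\<^esub> y"
  "c \<odot>\<^bsub>underlying_space q M\<^esub> x = uq_class q (const c) \<odot>\<^bsub>M\<^esub> x"
  by (simp_all add: underlying_space_def restrict_scalars_def)

locale sch_module =
  fixes q :: complex and M :: "(uq_free set, 'a) module"
  assumes M_Obj: "M \<in> Obj (schroedinger_cat q)"
begin

lemma module: "left_module (Uq q) M" and finite_dim: "finite_dim (underlying_space q M)"
  and type_one: "type_one q M" and Z_zero: "v \<in> carrier M \<Longrightarrow> uq_class q (gen Gen_Z) \<odot>\<^bsub>M\<^esub> v = \<zero>\<^bsub>M\<^esub>"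
  using M_Obj by (auto simp: schroedinger_cat_def full_subcategory_def left_module_cat_def)

sublocale M: left_module "Uq q" M
  by (rule module)

definition ac :: "uq_free \<Rightarrow> 'a \<Rightarrow> 'a" where
  "ac p v = uq_class q p \<odot>\<^bsub>M\<^esub> v"

lemma ac_closed: "v \<in> carrier M \<Longrightarrow> ac p v \<in> carrier M"
  and ac_add: "v \<in> carrier M \<Longrightarrow> ac (p + p') v = ac p v \<oplus>\<^bsub>M\<^esub> ac p' v"
  and ac_mult: "v \<in> carrier M \<Longrightarrow> ac (p * p') v = ac p (ac p' v)"
  and ac_one: "v \<in> carrier M \<Longrightarrow> ac 1 v = v"
  and ac_plus: "\<lbrakk>v \<in> carrier M; w \<in> carrier M\<rbrakk> \<Longrightarrow> ac p (v \<oplus>\<^bsub>M\<^esub> w) = ac p v \<oplus>\<^bsub>M\<^esub> ac p w"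
  by (simp_all add: ac_def uq_class_simps M.smult_closed M.smult_l_distr M.smult_r_distr
    M.smult_assoc M.smult_one)

text \<open>Constants are central already in the free algebra, so every element acts by a complex
  linear map.\<close>

lemma ac_const_comm:
  assumes "v \<in> carrier M"
  shows "ac p (ac (const c) v) = ac (const c) (ac p v)"
proof -
  have "p * const c = const c * p" for p
  proof (induction p rule: uq_free_induct)
    case (gen g) then show ?case by (simp add: gen_def const_def mult_single)
  next
    case (const d) then show ?case by (simp add: const_def mult_single mult.commute)
  next
    case (mult p p')
    then show ?case by (metis mult.assoc)
  qed (simp add: algebra_simps)
  then show ?thesis using ac_mult[OF assms] by metis
qed

lemma underlying_module: "Module.module complex_field (underlying_space q M)"
proof (rule Module.moduleI)
  show "abelian_group (underlying_space q M)"
  proof (rule abelian_groupI)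
    fix x assume "x \<in> carrier (underlying_space q M)"
    then show "\<exists>y\<in>carrier (underlying_space q M). y \<oplus>\<^bsub>underlying_space q M\<^esub> x =
      \<zero>\<^bsub>underlying_space q M\<^esub>"
      using M.M.l_neg by (intro bexI[of _ "\<ominus>\<^bsub>M\<^esub> x"]) auto
  qed (simp_all add: M.M.a_assoc, auto simp: M.M.a_comm)
  show "cring complex_field" by (rule cring_from_type_algebra)
qed (use ac_closed ac_add ac_mult ac_one ac_plus in \<open>simp_all add: const_simps ac_def\<close>)

lemma coordinates_exist_M: "\<exists>d \<phi> \<psi>. coordinates (underlying_space q M) d \<phi> \<psi>"
proof -
  obtain T where T: "finite T" "T \<subseteq> carrier M"
    "\<And>v. v \<in> carrier M \<Longrightarrow> \<exists>c. v = finsum (underlying_space q M) (\<lambda>s. c s \<odot>\<^bsub>underlying_space q M\<^esub> s)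
      T"
    using finite_dim unfolding finite_dim_def by auto
  show ?thesis
    by (rule coordinates_exist[OF underlying_module T(1), of "\<lambda>s. s"]) (use T in auto)
qed

end

text \<open>A functor needs one fixed choice per module, and the dimension and both maps have to be
  chosen together to fit each other.\<close>

definition module_coordinates :: "complex \<Rightarrow> (uq_free set, 'a) module \<Rightarrow> nat \<times> ('a \<Rightarrow> coords) \<times>
  (coords \<Rightarrow> 'a)" where
  "module_coordinates q M =
     (SOME t. coordinates (underlying_space q M) (fst t) (fst (snd t)) (snd (snd t)))"

context sch_module
begin

definition d :: nat where "d = fst (module_coordinates q M)"

definition \<phi> :: "'a \<Rightarrow> coords" where "\<phi> = fst (snd (module_coordinates q M))"

definition \<psi> :: "coords \<Rightarrow> 'a" where "\<psi> = snd (snd (module_coordinates q M))"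

lemma co: "coordinates (underlying_space q M) d \<phi> \<psi>"
proof -
  obtain d' f g where "coordinates (underlying_space q M) d' f g" using coordinates_exist_M by blast
  then have "\<exists>t. coordinates (underlying_space q M) (fst t) (fst (snd t)) (snd (snd t))"
    by (intro exI[of _ "(d', f, g)"]) simp
  then show ?thesis unfolding d_def \<phi>_def \<psi>_def module_coordinates_def by (rule someI_ex)
qed

lemmas co_simps = coordinates_simps[OF co, unfolded underlying_simps, folded ac_def]
  and \<phi>_add = coordinates_add[OF co, unfolded underlying_simps]
  and \<phi>_scale = coordinates_scale[OF co, unfolded underlying_simps, folded ac_def]

lemma \<psi>_zero: "\<psi> 0 = \<zero>\<^bsub>M\<^esub>"
  using coordinates_vec_iso[OF co underlying_module] by (simp add: vec_iso_def)

lemma \<phi>_zero: "\<phi> \<zero>\<^bsub>M\<^esub> = 0"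
  using co_simps(6)[of 0] cs.subspace_0[OF subspace_coord_space] by (simp add: \<psi>_zero)

definition model :: sch_model where
  "model = \<lparr>sp = coord_space d, op = (\<lambda>g x. \<phi> (ac (gen g) (\<psi> x)))\<rparr>"

lemma sp_model [simp]: "sp model = coord_space d"
  by (simp add: model_def)

lemma op_model: "op model g x = \<phi> (ac (gen g) (\<psi> x))"
  by (simp add: model_def)

lemma lin_model: "lin (op model g)"
  by (rule linI) (simp_all add: op_model co_simps ac_plus ac_closed \<phi>_add ac_const_comm \<phi>_scale)

lemma \<phi>_ac: "x \<in> coord_space d \<Longrightarrow> \<phi> (ac p (\<psi> x)) = act (op model) p x"
proof (induction p arbitrary: x rule: uq_free_induct)
  case (const c)
  then show ?case by (simp add: co_simps \<phi>_scale)
next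
  case (gen g) then show ?case by (simp add: op_model)
next
  case (add p p')
  then show ?case by (simp add: ac_add co_simps \<phi>_add ac_closed)
next
  case (mult p p')
  let ?y = "act (op model) p' x"
  have y1: "?y = \<phi> (ac p' (\<psi> x))" by (rule mult.IH(2)[OF mult.prems, symmetric])
  have y2: "?y \<in> coord_space d" unfolding y1 by (intro co_simps(4) ac_closed co_simps(1))
  have "\<phi> (ac (p * p') (\<psi> x)) = \<phi> (ac p (\<psi> ?y))"
    by (simp add: ac_mult co_simps y1 ac_closed)
  also have "\<dots> = act (op model) p ?y" using mult.IH(1)[OF y2] .
  finally show ?case by (simp add: act_mult[of "op model", OF lin_model])
qed

text \<open>Type 1 makes the eigenvalues powers of q, and sorting the finitely many weight
  components by exponent gives the required sum over an interval.\<close>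

lemma is_sch_model: "is_sch_model q model"
  unfolding is_sch_model_def
proof (intro conjI allI ballI)
  show "fd_space (sp model)" by (simp add: fd_coord_space)
  show "lin (op model g)" for g by (rule lin_model)
  show "op model g v \<in> sp model" if "v \<in> sp model" for g v
    by (simp add: op_model co_simps ac_closed)
  show "act (op model) r v = 0" if r: "r \<in> uq_relations q" and v: "v \<in> sp model" for r v
  proof -
    have "ac r (\<psi> v) = ac 0 (\<psi> v)" unfolding ac_def uq_class_relation[OF r] ..
    then show ?thesis using \<phi>_ac[of v r] \<phi>_ac[of v 0] v by simp
  qed
  show "op model Gen_Z v = 0" if "v \<in> sp model" for v
    using Z_zero[OF co_simps(1)] \<phi>_zero by (simp add: op_model ac_def)
  fix v assume v: "v \<in> sp model"
  have v: "v \<in> coord_space d" using v by simp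
  have "\<forall>v\<in>carrier M. \<exists>!w. w \<in> (\<Pi>\<^sub>E \<mu>\<in>UNIV - {0}. weight_space q M \<mu>) \<and>
      finite {\<mu> \<in> UNIV - {0}. w \<mu> \<noteq> \<zero>\<^bsub>M\<^esub>} \<and> v = finsum M w {\<mu> \<in> UNIV - {0}. w \<mu> \<noteq> \<zero>\<^bsub>M\<^esub>}"
    using type_one unfolding type_one_def weight_module_def internal_direct_sum_def by (elim conjE)
  note ex1_implies_ex[OF bspec[OF this co_simps(1)[of v]]]
  then obtain w where w: "w \<in> (\<Pi>\<^sub>E \<mu>\<in>UNIV - {0}. weight_space q M \<mu>)"
    "finite {\<mu> \<in> UNIV - {0}. w \<mu> \<noteq> \<zero>\<^bsub>M\<^esub>}" "\<psi> v = finsum M w {\<mu> \<in> UNIV - {0}. w \<mu> \<noteq> \<zero>\<^bsub>M\<^esub>}"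
    by (elim exE conjE)
  define I where "I = {\<mu> \<in> UNIV - {0}. w \<mu> \<noteq> \<zero>\<^bsub>M\<^esub>}"
  have ws: "w \<mu> \<in> carrier M" "ac (gen Gen_K) (w \<mu>) = ac (const \<mu>) (w \<mu>)" if "\<mu> \<in> I" for \<mu>
    using w(1) that by (auto simp: I_def weight_space_def ac_def PiE_iff)
  have "\<forall>\<mu>\<in>I. \<exists>n :: int. \<mu> = q powi n"
  proof
    fix \<mu> assume "\<mu> \<in> I"
    then have "\<mu> \<noteq> 0" "w \<mu> \<in> weight_space q M \<mu>" "w \<mu> \<noteq> \<zero>\<^bsub>M\<^esub>"
      using w(1) by (auto simp: I_def PiE_iff)
    then have "\<mu> \<in> {\<mu>. \<mu> \<noteq> 0 \<and> weight_space q M \<mu> \<noteq> {\<zero>\<^bsub>M\<^esub>}}" by auto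
    then show "\<exists>n :: int. \<mu> = q powi n" using type_one unfolding type_one_def by auto
  qed
  \<comment> \<open>\<open>q\<close> is arbitrary in this locale, so exponents are chosen;
    \<open>e\<close> is injective because the eigenvalue is recovered from its exponent.\<close>
  then obtain e :: "complex \<Rightarrow> int" where e: "\<And>\<mu>. \<mu> \<in> I \<Longrightarrow> \<mu> = q powi e \<mu>" by metis
  have e_inj: "inj_on e I" using e by (metis inj_onI)
  have fin: "finite I" using w(2) by (simp add: I_def)
  have "finite (e ` I)" using fin by simp
  then have "finite ((\<lambda>n. nat \<bar>n\<bar>) ` e ` I)" by simp
  then obtain N where N: "\<forall>k\<in>(\<lambda>n. nat \<bar>n\<bar>) ` e ` I. k < N"
    unfolding finite_nat_set_iff_bounded by blast
  have eN: "e ` I \<subseteq> {- int N..int N}" using N by force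
  define u where "u n = (if n \<in> e ` I then \<phi> (w (q powi n)) else 0)" for n
  have "u n \<in> coord_space d \<and> op model Gen_K (u n) = scl (q powi n) (u n)" for n
  proof (cases "n \<in> e ` I")
    case True
    then obtain \<mu> where \<mu>: "\<mu> \<in> I" "n = e \<mu>" by blast
    then have n: "q powi n = \<mu>" using e by simp
    have un: "u n = \<phi> (w \<mu>)" using True n by (simp add: u_def)
    show ?thesis unfolding un n using ws[OF \<mu>(1)] by (simp add: op_model co_simps \<phi>_scale)
  next
    case False
    then show ?thesis
      using cs.subspace_0[OF subspace_coord_space] lin_zero[OF lin_model, of Gen_K]
        by (simp add: u_def)
  qed
  moreover have "v = (\<Sum>n = - int N..int N. u n)"
  proof -
    have "(\<Sum>n = - int N..int N. u n) = (\<Sum>n\<in>e ` I. u n)"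
      by (rule sum.mono_neutral_right) (use eN in \<open>auto simp: u_def\<close>)
    also have "\<dots> = (\<Sum>\<mu>\<in>I. u (e \<mu>))" by (rule sum.reindex_cong[OF e_inj]) auto
    also have "\<dots> = (\<Sum>\<mu>\<in>I. \<phi> (w \<mu>))"
      by (rule sum.cong) (use e in \<open>auto simp: u_def\<close>)
    finally have s: "(\<Sum>n = - int N..int N. u n) = (\<Sum>\<mu>\<in>I. \<phi> (w \<mu>))" .
    have in_d: "(\<Sum>\<mu>\<in>I. \<phi> (w \<mu>)) \<in> coord_space d"
      by (rule cs.subspace_sum[OF subspace_coord_space]) (use ws co_simps in auto)
    have "\<psi> (\<Sum>\<mu>\<in>I. \<phi> (w \<mu>)) = finsum M (\<lambda>\<mu>. \<psi> (\<phi> (w \<mu>))) I"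
      by (rule vec_iso_finsum[OF M.M.abelian_group_axioms subspace_coord_space[of d]])
        (use \<psi>_zero co_simps ws fin in auto)
    also have "\<dots> = finsum M w I"
      by (rule M.M.finsum_cong') (use co_simps ws in auto)
    also have "\<dots> = \<psi> v" using w(3) by (simp add: I_def)
    finally have "\<phi> (\<psi> (\<Sum>\<mu>\<in>I. \<phi> (w \<mu>))) = \<phi> (\<psi> v)" by simp
    then show ?thesis unfolding s using in_d v by (simp add: co_simps)
  qed
  ultimately show "\<exists>N. v \<in> weight_decomposable q (op model Gen_K) (sp model) N"
    unfolding weight_decomposable_def by auto
qed

end

definition model_functor :: "complex \<Rightarrow>
    ((uq_free set, 'a) module, 'a \<Rightarrow> 'a, sch_model, coords \<Rightarrow> coords) cat_map" where
  "model_functor q = \<lparr>omap = sch_module.model q,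
     mmap = (\<lambda>M N f. restrict (\<lambda>x. sch_module.\<phi> q N (f (sch_module.\<psi> q M x))) (coord_space
       (sch_module.d q M)))\<rparr>"

lemma category_schroedinger_cat: "category (schroedinger_cat q :: ((uq_free set, 'a) module, 'a \<Rightarrow>
  'a) cat)"
proof
  fix A :: "(uq_free set, 'a) module" assume A: "A \<in> Obj (schroedinger_cat q)"
  interpret A: sch_module q A by standard (rule A)
  have "(\<lambda>x\<in>carrier A. x) \<in> module_hom (Uq q) A A"
    by (rule module_homI) (auto simp: A.M.smult_closed)
  then show "Idn (schroedinger_cat q) A \<in> Mor (schroedinger_cat q) A A"
    by (simp add: schroedinger_cat_def full_subcategory_def left_module_cat_def)
next
  fix A B D :: "(uq_free set, 'a) module" and f g
  assume A: "A \<in> Obj (schroedinger_cat q)"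
    and fg: "f \<in> Mor (schroedinger_cat q) A B" "g \<in> Mor (schroedinger_cat q) B D"
  interpret A: sch_module q A by standard (rule A)
  have f: "f \<in> module_hom (Uq q) A B" and g: "g \<in> module_hom (Uq q) B D"
    using fg by (auto simp: schroedinger_cat_def full_subcategory_def left_module_cat_def)
  have "compose (carrier A) g f \<in> module_hom (Uq q) A D"
    by (rule module_hom_compose[OF f g]) (auto simp: A.M.smult_closed)
  then show "Comp (schroedinger_cat q) A B D g f \<in> Mor (schroedinger_cat q) A D"
    by (simp add: schroedinger_cat_def full_subcategory_def left_module_cat_def)
next
  fix A B D E :: "(uq_free set, 'a) module" and f g h
  assume "f \<in> Mor (schroedinger_cat q) A B"
  then have "f \<in> carrier A \<rightarrow>\<^sub>E carrier B"
    by (simp add: schroedinger_cat_def full_subcategory_def left_module_cat_def module_hom_def)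
  then show "Comp (schroedinger_cat q) A D E h (Comp (schroedinger_cat q) A B D g f) =
    Comp (schroedinger_cat q) A B E (Comp (schroedinger_cat q) B D E h g) f"
    by (simp add: schroedinger_cat_def full_subcategory_def left_module_cat_def compose_assoc')
next
  fix A B :: "(uq_free set, 'a) module" and f
  assume "f \<in> Mor (schroedinger_cat q) A B"
  then have *: "f \<in> carrier A \<rightarrow>\<^sub>E carrier B"
    by (simp add: schroedinger_cat_def full_subcategory_def left_module_cat_def module_hom_def)
  show "Comp (schroedinger_cat q) A A B f (Idn (schroedinger_cat q) A) = f"
    "Comp (schroedinger_cat q) A B B (Idn (schroedinger_cat q) B) f = f"
    by (simp_all add: schroedinger_cat_def full_subcategory_def left_module_cat_def
      compose_extensional_id[OF *])
qed

locale sch_module_pair = A: sch_module q A + B: sch_module q B for q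
  and A B :: "(uq_free set, 'a) module"
begin

lemma Mor_module: "Mor (schroedinger_cat q) A B = module_hom (Uq q) A B"
  by (simp add: schroedinger_cat_def full_subcategory_def left_module_cat_def)

lemma hom_simps:
  assumes "f \<in> Mor (schroedinger_cat q) A B"
  shows "v \<in> carrier A \<Longrightarrow> f v \<in> carrier B"
    "\<lbrakk>v \<in> carrier A; w \<in> carrier A\<rbrakk> \<Longrightarrow> f (v \<oplus>\<^bsub>A\<^esub> w) = f v \<oplus>\<^bsub>B\<^esub> f w"
    "v \<in> carrier A \<Longrightarrow> f (A.ac p v) = B.ac p (f v)"
  using module_hom_simps[OF assms[unfolded Mor_module]]
  by (simp_all add: A.ac_def B.ac_def uq_class_simps)

lemma model_Mor:
  assumes f: "f \<in> Mor (schroedinger_cat q) A B"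
  shows "restrict (\<lambda>x. B.\<phi> (f (A.\<psi> x))) (coord_space A.d) \<in> Mor (sch_model_cat q) A.model B.model"
proof -
  note h = hom_simps[OF f]
  have "restrict (\<lambda>x. B.\<phi> (f (A.\<psi> x))) (coord_space A.d) \<in> lin_maps (coord_space A.d) (coord_space
    B.d)"
    by (rule lin_mapsI[OF _ _ _ subspace_coord_space])
      (simp_all add: A.co_simps B.co_simps h B.\<phi>_add B.\<phi>_scale)
  moreover have "A.\<phi> (A.ac (gen g) (A.\<psi> v)) \<in> coord_space A.d" for g v
    by (simp add: A.co_simps A.ac_closed)
  ultimately show ?thesis
    by (simp add: sch_model_cat_def A.op_model B.op_model A.co_simps A.ac_closed B.co_simps h)
qed

lemma model_faithful:
  assumes f: "f \<in> Mor (schroedinger_cat q) A B" and g: "g \<in> Mor (schroedinger_cat q) A B"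
    and eq: "restrict (\<lambda>x. B.\<phi> (f (A.\<psi> x))) (coord_space A.d) =
      restrict (\<lambda>x. B.\<phi> (g (A.\<psi> x))) (coord_space A.d)"
  shows "f = g"
proof (rule PiE_ext)
  show "f \<in> carrier A \<rightarrow>\<^sub>E carrier B" "g \<in> carrier A \<rightarrow>\<^sub>E carrier B"
    using f g by (simp_all add: Mor_module module_hom_def)
  fix v assume v: "v \<in> carrier A"
  have "B.\<phi> (f v) = B.\<phi> (g v)"
    using fun_cong[OF eq, of "A.\<phi> v"] v by (simp add: A.co_simps)
  then have "B.\<psi> (B.\<phi> (f v)) = B.\<psi> (B.\<phi> (g v))" by (rule arg_cong)
  then show "f v = g v" by (simp only: B.co_simps(5)[OF hom_simps(1)[OF f v]] B.co_simps(5)[OF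
    hom_simps(1)[OF g v]])
qed

text \<open>Commuting with the generators extends to the free algebra by \<open>act_commute\<close>,
  and every scalar is the class of an element of the free algebra.\<close>

lemma model_full:
  assumes g: "g \<in> Mor (sch_model_cat q) A.model B.model"
  shows "\<exists>f\<in>Mor (schroedinger_cat q) A B. restrict (\<lambda>x. B.\<phi> (f (A.\<psi> x))) (coord_space A.d) = g"
proof -
  have gl: "g \<in> lin_maps (coord_space A.d) (coord_space B.d)"
    and go: "\<And>h x. x \<in> coord_space A.d \<Longrightarrow> g (op A.model h x) = op B.model h (g x)"
    using g by (simp_all add: sch_model_cat_def)
  have gp: "g (act (op A.model) p x) = act (op B.model) p (g x)" if "x \<in> coord_space A.d" for p x
    by (rule act_commute[OF subspace_coord_space _ A.lin_model B.lin_model that])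
      (use lin_maps_add[OF gl] lin_maps_scale[OF gl] go in \<open>auto
        simp: A.op_model A.co_simps A.ac_closed\<close>)
  define f where "f = restrict (\<lambda>v. B.\<psi> (g (A.\<phi> v))) (carrier A)"
  have "f \<in> module_hom (Uq q) A B"
    unfolding f_def
  proof (rule module_homI)
    fix a v assume a: "a \<in> carrier (Uq q)" and v: "v \<in> carrier A"
    obtain p where p: "a = uq_class q p" using uq_class_surj[OF a] by blast
    have \<phi>v: "A.\<phi> v \<in> coord_space A.d" using v by (simp add: A.co_simps)
    have "A.\<phi> (A.ac p v) = act (op A.model) p (A.\<phi> v)"
      using A.\<phi>_ac[OF \<phi>v, of p] v by (simp add: A.co_simps)
    then have "B.\<psi> (g (A.\<phi> (A.ac p v))) = B.\<psi> (act (op B.model) p (g (A.\<phi> v)))"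
      using gp[OF \<phi>v] by simp
    also have "\<dots> = B.\<psi> (B.\<phi> (B.ac p (B.\<psi> (g (A.\<phi> v)))))"
      using B.\<phi>_ac[OF lin_maps_mem[OF gl \<phi>v]] by simp
    also have "\<dots> = B.ac p (B.\<psi> (g (A.\<phi> v)))" by (simp add: B.co_simps B.ac_closed)
    finally show "B.\<psi> (g (A.\<phi> (a \<odot>\<^bsub>A\<^esub> v))) = a \<odot>\<^bsub>B\<^esub> B.\<psi> (g (A.\<phi> v))"
      by (simp add: p A.ac_def B.ac_def)
  qed (auto simp: A.co_simps B.co_simps A.\<phi>_add lin_maps_add[OF gl] A.M.smult_closed)
  moreover have "restrict (\<lambda>x. B.\<phi> (f (A.\<psi> x))) (coord_space A.d) = g"
  proof
    fix x show "restrict (\<lambda>x. B.\<phi> (f (A.\<psi> x))) (coord_space A.d) x = g x"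
      using lin_maps_mem[OF gl] lin_maps_extensional[OF gl]
      by (cases "x \<in> coord_space A.d") (auto simp: f_def A.co_simps B.co_simps PiE_iff
        extensional_def)
  qed
  ultimately show ?thesis unfolding Mor_module by blast
qed

end

section \<open>Realizing a model on a carrier of the given type\<close>

locale sch_realization = sch_object q A + coords_embedding h
  for q and A and h :: "coords \<Rightarrow> 'a"
begin

text \<open>A scalar is a coset, so its action goes through a chosen representative;
  \<open>smult_class\<close> shows that any other representative acts in the same way.\<close>

definition realization :: "(uq_free set, 'a) module" where
  "realization = \<lparr>carrier = h ` S, monoid.mult = undefined, one = undefined, ring.zero = h 0,
     add = (\<lambda>x y. h (h' x + h' y)),
     module.smult = (\<lambda>u x. h (act (op A) (SOME p. u = uq_class q p) (h' x)))\<rparr>"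

lemma realization_simps [simp]:
  "carrier realization = h ` S" "\<zero>\<^bsub>realization\<^esub> = h 0" "x \<oplus>\<^bsub>realization\<^esub> y = h (h' x + h' y)"
  by (simp_all add: realization_def)

lemma hh: "x \<in> S \<Longrightarrow> h' (h x) = x"
  by (rule h'_h_fd[OF fd_S])

lemma h_eq_iff: "\<lbrakk>x \<in> S; y \<in> S\<rbrakk> \<Longrightarrow> h x = h y \<longleftrightarrow> x = y"
  using hh by metis

text \<open>Two representatives of a coset differ by an element of the ideal, and this element kills
  \<open>S\<close> by \<open>uq_ideal_act\<close>.\<close>

lemma smult_class:
  assumes x: "x \<in> S"
  shows "uq_class q p \<odot>\<^bsub>realization\<^esub> h x = h (act (op A) p x)"
proof -
  define p' where "p' = (SOME p'. uq_class q p = uq_class q p')"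
  have "uq_class q p = uq_class q p'" unfolding p'_def by (rule someI[of _ p]) simp
  then have "act (op A) (p - p') x = 0"
    by (intro uq_ideal_act[OF sub_S op_closed lin_op relation _ x] uq_class_eq)
  then have "act (op A) p' x = act (op A) p x" by simp
  then show ?thesis by (simp add: realization_def p'_def[symmetric] hh[OF x])
qed

lemma act_S: "x \<in> S \<Longrightarrow> act (op A) p x \<in> S"
  by (rule act_closed[OF sub_S op_closed _ lin_op])

lemma underlying_vec_iso: "vec_iso S (underlying_space q realization) h"
  unfolding vec_iso_def using bij_h[OF fd_S] by (simp add: hh smult_class)

lemma realization_abelian_group: "abelian_group realization"
  by (rule abelian_group_transport[OF sub_S, of h]) (use bij_h[OF fd_S] in \<open>simp_all add: hh\<close>)

lemma realization_left_module: "left_module (Uq q) realization"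
proof (intro left_module.intro left_module_axioms.intro Uq_ring realization_abelian_group)
  note l = act_mult[of "op A", OF lin_op]
  have eq: "uq_class q p \<oplus>\<^bsub>Uq q\<^esub> uq_class q p' = uq_class q (p + p')"
    "uq_class q p \<otimes>\<^bsub>Uq q\<^esub> uq_class q p' = uq_class q (p * p')" "\<one>\<^bsub>Uq q\<^esub> = uq_class q 1" for p p'
    by (simp_all add: uq_class_simps)
  have rep: "\<exists>p. u = uq_class q p" if "u \<in> carrier (Uq q)" for u using uq_class_surj[OF that] .
  show "(u \<oplus>\<^bsub>Uq q\<^esub> u') \<odot>\<^bsub>realization\<^esub> x = u \<odot>\<^bsub>realization\<^esub> x \<oplus>\<^bsub>realization\<^esub> u' \<odot>\<^bsub>realization\<^esub> x"
    "(u \<otimes>\<^bsub>Uq q\<^esub> u') \<odot>\<^bsub>realization\<^esub> x = u \<odot>\<^bsub>realization\<^esub> (u' \<odot>\<^bsub>realization\<^esub> x)"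
    if "u \<in> carrier (Uq q)" "u' \<in> carrier (Uq q)" "x \<in> carrier realization" for u u' x
    using that rep[of u] rep[of u'] by (auto simp: eq smult_class hh act_S l)
  show "u \<odot>\<^bsub>realization\<^esub> x \<in> carrier realization"
    if "u \<in> carrier (Uq q)" "x \<in> carrier realization" for u x
    using that rep[of u] by (auto simp: smult_class act_S)
  show "\<one>\<^bsub>Uq q\<^esub> \<odot>\<^bsub>realization\<^esub> x = x" if "x \<in> carrier realization" for x
    using that by (auto simp: eq smult_class)
  show "u \<odot>\<^bsub>realization\<^esub> (x \<oplus>\<^bsub>realization\<^esub> y) = u \<odot>\<^bsub>realization\<^esub> x \<oplus>\<^bsub>realization\<^esub> u \<odot>\<^bsub>realization\<^esub>
    y"
    if "u \<in> carrier (Uq q)" "x \<in> carrier realization" "y \<in> carrier realization" for u x y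
    using that rep[of u] cs.subspace_add[OF sub_S]
    by (auto simp: smult_class hh act_S lin_add[OF lin_act[of "op A", OF lin_op]])
qed

text \<open>The index is the eigenvalue, as in \<open>weight_space\<close>, and not the exponent.
  Vanishing outside \<open>I\<close> lets families with different index sets be compared.\<close>

definition eigen_family :: "complex set \<Rightarrow> (complex \<Rightarrow> coords) \<Rightarrow> bool" where
  "eigen_family I u \<longleftrightarrow> finite I \<and> (\<forall>\<mu>. u \<mu> \<in> S \<and> K (u \<mu>) = scl \<mu> (u \<mu>)) \<and> (\<forall>\<mu>. \<mu> \<notin> I \<longrightarrow> u \<mu> = 0)"

lemma eigen_family_unique:
  assumes u: "eigen_family I u" and v: "eigen_family J v" and eq: "(\<Sum>\<mu>\<in>I. u \<mu>) = (\<Sum>\<mu>\<in>J. v \<mu>)"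
  shows "u = v"
proof -
  have fin: "finite (I \<union> J)" using u v by (simp add: eigen_family_def)
  have "(\<Sum>\<mu>\<in>I \<union> J. u \<mu>) = (\<Sum>\<mu>\<in>I. u \<mu>)" "(\<Sum>\<mu>\<in>I \<union> J. v \<mu>) = (\<Sum>\<mu>\<in>J. v \<mu>)"
    by (rule sum.mono_neutral_right; use u v in \<open>auto simp: eigen_family_def\<close>)+
  then have "(\<Sum>\<mu>\<in>I \<union> J. u \<mu> - v \<mu>) = 0" using eq by (simp add: sum_subtractf)
  then have "\<forall>\<mu>\<in>I \<union> J. u \<mu> - v \<mu> = 0"
    by (intro eigen_indep[OF lin_op[of Gen_K] fin, of "\<lambda>\<mu>. \<mu>"])
      (use u v in \<open>auto simp: eigen_family_def op_diff cs.scale_right_diff_distrib\<close>)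
  then have "u \<mu> = v \<mu>" for \<mu>
    using u v by (cases "\<mu> \<in> I \<union> J") (auto simp: eigen_family_def)
  then show ?thesis by blast
qed

lemma eigen_family_exists:
  assumes x: "x \<in> S"
  shows "\<exists>I u. eigen_family I u \<and> I \<subseteq> {q powi n |n :: int. True} \<and> x = (\<Sum>\<mu>\<in>I. u \<mu>)"
proof -
  obtain N w where w: "\<And>n. w n \<in> S \<and> K (w n) = scl (q powi n) (w n)" "x = (\<Sum>n =
    - int N..int N. w n)"
    using model x unfolding is_sch_model_def weight_decomposable_def by blast
  define I where "I = (\<lambda>n. q powi n) ` {- int N..int N}"
  \<comment> \<open>Distinct exponents give distinct powers of q, so \<open>THE\<close> recovers the
    exponent of an eigenvalue.\<close>
  define u where "u \<mu> = (if \<mu> \<in> I then w (THE n. \<mu> = q powi n) else 0)" for \<mu>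
  have the: "(THE m. q powi n = q powi m) = n" for n
    by (rule the_equality) (auto simp: powi_eq_iff)
  have u: "u (q powi n) = w n" if "n \<in> {- int N..int N}" for n
    using that by (simp add: u_def I_def the)
  have "eigen_family I u"
    unfolding eigen_family_def
  proof (intro conjI allI impI)
    show "finite I" by (simp add: I_def)
    fix \<mu>
    have "u \<mu> \<in> S \<and> K (u \<mu>) = scl \<mu> (u \<mu>)"
    proof (cases "\<mu> \<in> I")
      case True
      then obtain n where "n \<in> {- int N..int N}" "\<mu> = q powi n" by (auto simp: I_def)
      then show ?thesis using w(1)[of n] u[of n] by simp
    next
      case False
      then show ?thesis using cs.subspace_0[OF sub_S] by (simp add: u_def op_zero)
    qed
    then show "u \<mu> \<in> S" "K (u \<mu>) = scl \<mu> (u \<mu>)" by auto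
    show "u \<mu> = 0" if "\<mu> \<notin> I" using that by (simp add: u_def)
  qed
  moreover have "(\<Sum>\<mu>\<in>I. u \<mu>) = x"
    unfolding w(2) I_def
    by (subst sum.reindex) (auto simp: inj_on_def powi_eq_iff u)
  ultimately show ?thesis unfolding I_def by blast
qed

lemma weight_space_realization: "weight_space q realization \<mu> = h ` {v \<in> S. K v = scl \<mu> v}"
proof -
  have "uq_class q (gen Gen_K) \<odot>\<^bsub>realization\<^esub> h v = uq_class q (const \<mu>) \<odot>\<^bsub>realization\<^esub> h v \<longleftrightarrow> K v =
    scl \<mu> v"
    if "v \<in> S" for v
    using that by (simp add: smult_class h_eq_iff op_closed cs.subspace_scale[OF sub_S])
  then show ?thesis by (auto simp: weight_space_def)
qed

lemma finsum_realization:
  assumes "finite I" "\<And>i. i \<in> I \<Longrightarrow> f i \<in> S"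
  shows "finsum realization (\<lambda>i. h (f i)) I = h (\<Sum>i\<in>I. f i)"
  by (rule vec_iso_finsum[OF realization_abelian_group sub_S, symmetric])
    (use assms in \<open>auto simp: hh\<close>)

lemma realization_weight_module: "weight_module q realization"
  unfolding weight_module_def internal_direct_sum_def
proof (intro conjI ballI)
  show "weight_space q realization \<mu> \<subseteq> carrier realization" for \<mu>
    by (auto simp: weight_space_realization)
  fix y assume "y \<in> carrier realization"
  then obtain x where x: "x \<in> S" "y = h x" by auto
  obtain I u where u: "eigen_family I u" and I: "I \<subseteq> {q powi n |n :: int. True}"
    and xs: "x = (\<Sum>\<mu>\<in>I. u \<mu>)"
    using eigen_family_exists[OF x(1)] by blast
  \<comment> \<open>The direct sum runs over nonzero eigenvalues; powers of q are nonzero, so no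
    component is lost.\<close>
  have I0: "0 \<notin> I" using I q_nonzero by auto
  have uS: "u \<mu> \<in> S" "K (u \<mu>) = scl \<mu> (u \<mu>)" "\<mu> \<notin> I \<Longrightarrow> u \<mu> = 0" and finI: "finite I" for \<mu>
    using u by (auto simp: eigen_family_def)
  have S0: "0 \<in> S" by (rule cs.subspace_0[OF sub_S])
  let ?\<Lambda> = "UNIV - {0 :: complex}"
  let ?supp = "\<lambda>w. {\<mu> \<in> ?\<Lambda>. w \<mu> \<noteq> \<zero>\<^bsub>realization\<^esub>}"
  let ?P = "\<lambda>w. w \<in> (\<Pi>\<^sub>E \<mu>\<in>?\<Lambda>. weight_space q realization \<mu>) \<and> finite (?supp w)
    \<and> y = finsum realization w (?supp w)"
  define w where "w = restrict (\<lambda>\<mu>. h (u \<mu>)) ?\<Lambda>"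
  show "\<exists>!w. ?P w"
  proof (rule ex1I[of _ w])
    have supp: "?supp w \<subseteq> I"
    proof
      fix \<mu> assume "\<mu> \<in> ?supp w"
      then show "\<mu> \<in> I" using uS(3)[of \<mu>] by (cases "\<mu> \<in> I") (auto simp: w_def)
    qed
    have fin: "finite (?supp w)" by (rule finite_subset[OF supp finI])
    have "finsum realization w (?supp w) = finsum realization (\<lambda>\<mu>. h (u \<mu>)) (?supp w)"
      by (rule abelian_monoid.finsum_cong'[OF abelian_group.axioms(1)[OF
        realization_abelian_group]])
        (use uS in \<open>auto simp: w_def\<close>)
    also have "\<dots> = h (\<Sum>\<mu>\<in>?supp w. u \<mu>)" by (rule finsum_realization[OF fin uS(1)])
    also have "(\<Sum>\<mu>\<in>?supp w. u \<mu>) = x"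
      unfolding xs
      by (rule sum.mono_neutral_left[OF finI supp]) (use I0 uS S0 in \<open>auto simp: w_def h_eq_iff\<close>)
    finally have "y = finsum realization w (?supp w)" using x(2) by (simp only:)
    moreover have "w \<in> (\<Pi>\<^sub>E \<mu>\<in>?\<Lambda>. weight_space q realization \<mu>)"
      using uS by (auto simp: w_def weight_space_realization)
    ultimately show "?P w" using fin by blast
    fix w' assume w': "?P w'"
    \<comment> \<open>The value of the competing family at 0 lies outside its index set; zero is put
      there to obtain a family comparable with \<open>u\<close>.\<close>
    define v where "v \<mu> = (if \<mu> = 0 then 0 else h' (w' \<mu>))" for \<mu>
    have wv: "w' \<mu> = h (v \<mu>)" "v \<mu> \<in> S" "K (v \<mu>) = scl \<mu> (v \<mu>)" if "\<mu> \<noteq> 0" for \<mu>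
    proof -
      have "w' \<mu> \<in> h ` {v \<in> S. K v = scl \<mu> v}"
        using w' that unfolding weight_space_realization by (auto simp: PiE_iff)
      then show "w' \<mu> = h (v \<mu>)" "v \<mu> \<in> S" "K (v \<mu>) = scl \<mu> (v \<mu>)"
        using that by (auto simp: v_def hh)
    qed
    have v: "eigen_family (?supp w') v"
      unfolding eigen_family_def
    proof (intro conjI allI impI)
      show "finite (?supp w')" using w' by blast
      fix \<mu> show "v \<mu> \<in> S" using wv(2)[of \<mu>] S0 by (cases "\<mu> = 0") (simp_all add: v_def)
      show "K (v \<mu>) = scl \<mu> (v \<mu>)" using wv(3)[of \<mu>]
        by (cases "\<mu> = 0") (simp_all add: v_def op_zero)
      show "v \<mu> = 0" if "\<mu> \<notin> ?supp w'"
      proof (cases "\<mu> = 0")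
        case False
        then have "h (v \<mu>) = h 0" using that wv(1) by simp
        then show ?thesis using h_eq_iff[OF wv(2)[OF False] S0] by simp
      qed (simp add: v_def)
    qed
    have "h x = finsum realization w' (?supp w')" using w' x by simp
    also have "\<dots> = finsum realization (\<lambda>\<mu>. h (v \<mu>)) (?supp w')"
      by (rule abelian_monoid.finsum_cong'[OF abelian_group.axioms(1)[OF
        realization_abelian_group]])
        (use wv in auto)
    also have "\<dots> = h (\<Sum>\<mu>\<in>?supp w'. v \<mu>)"
      by (rule finsum_realization) (use w' wv in auto)
    finally have "x = (\<Sum>\<mu>\<in>?supp w'. v \<mu>)"
      using h_eq_iff x(1) cs.subspace_sum[OF sub_S, of "?supp w'" v] wv by auto
    then have "u = v" using eigen_family_unique[OF u v] xs by simp
    show "w' = w"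
    proof
      fix \<mu> show "w' \<mu> = w \<mu>"
        using wv(1)[of \<mu>] w' \<open>u = v\<close> by (cases "\<mu> = 0") (auto simp: w_def PiE_iff extensional_def)
    qed
  qed
qed

text \<open>A nonzero vector of weight \<open>\<mu>\<close> is a family with a single term.
  Uniqueness identifies it with its decomposition along powers of q, so \<open>\<mu>\<close> is one
  of these powers.\<close>

lemma realization_type_one: "type_one q realization"
  unfolding type_one_def
proof (intro conjI realization_weight_module subsetI)
  fix \<mu> assume "\<mu> \<in> {\<mu>. \<mu> \<noteq> 0 \<and> weight_space q realization \<mu> \<noteq> {\<zero>\<^bsub>realization\<^esub>}}"
  then have "h ` {v \<in> S. K v = scl \<mu> v} \<noteq> {h 0}" by (simp add: weight_space_realization)
  moreover have "h 0 \<in> h ` {v \<in> S. K v = scl \<mu> v}"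
    using cs.subspace_0[OF sub_S] by (auto simp: op_zero)
  ultimately obtain v where v: "v \<in> S" "K v = scl \<mu> v" "v \<noteq> 0" by blast
  obtain I u where u: "eigen_family I u" "I \<subseteq> {q powi n |n :: int. True}" "v = (\<Sum>\<mu>\<in>I. u \<mu>)"
    using eigen_family_exists[OF v(1)] by blast
  let ?u = "\<lambda>\<nu>. if \<nu> = \<mu> then v else 0"
  have "eigen_family {\<mu>} ?u"
    using v cs.subspace_0[OF sub_S] by (simp add: eigen_family_def op_zero)
  then have "?u = u" by (rule eigen_family_unique[OF _ u(1)]) (use u(3) in simp)
  then have "u \<mu> = v" by auto
  then have "\<mu> \<in> I" using u(1) v(3) by (auto simp: eigen_family_def)
  then show "\<mu> \<in> {q powi n |n :: int. True}" using u(2) by blast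
qed

lemma realization_Obj: "realization \<in> Obj (schroedinger_cat q)"
proof -
  have "finite_dim (underlying_space q realization)"
    by (rule vec_iso_finite_dim[OF fd_S underlying_vec_iso])
  moreover have "uq_class q (gen Gen_Z) \<odot>\<^bsub>realization\<^esub> v = \<zero>\<^bsub>realization\<^esub>"
    if "v \<in> carrier realization" for v
    using that by (auto simp: smult_class op_Z)
  ultimately show ?thesis
    using realization_left_module realization_type_one
    by (simp add: schroedinger_cat_def full_subcategory_def left_module_cat_def)
qed

text \<open>The functor chooses its own coordinates on the realization, unrelated to those of
  \<open>A\<close>. Hence \<open>A\<close> is recovered only up to isomorphism, by the map
  \<open>h'\<close> after \<open>R.\<psi>\<close>.\<close>

lemma realization_model_isomorphism:
  "\<exists>f. is_isomorphism (sch_model_cat q) (sch_module.model q realization) A f"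
proof -
  interpret R: sch_module q realization by standard (rule realization_Obj)
  have ac: "R.ac p (h x) = h (act (op A) p x)" if "x \<in> S" for p x
    using smult_class[OF that] by (simp add: R.ac_def)
  have \<psi>S: "h' (R.\<psi> x) \<in> S" "h (h' (R.\<psi> x)) = R.\<psi> x" for x
    using R.co_simps(1)[of x] by (auto simp: hh)
  define f where "f = restrict (\<lambda>x. h' (R.\<psi> x)) (coord_space R.d)"
  have f_add: "h' (R.\<psi> (x + y)) = h' (R.\<psi> x) + h' (R.\<psi> y)" for x y
    using R.co_simps(2)[of x y] \<psi>S(1) cs.subspace_add[OF sub_S] by (simp add: hh)
  have f_ac: "h' (R.ac p (R.\<psi> x)) = act (op A) p (h' (R.\<psi> x))" for p x
    using ac[OF \<psi>S(1), of p x] \<psi>S act_S by (simp add: hh)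
  have f_scale: "h' (R.\<psi> (scl c x)) = scl c (h' (R.\<psi> x))" for c x
    using f_ac[of "const c" x] by (simp add: R.co_simps(3))
  have cl: "R.ac p (R.\<psi> x) \<in> carrier realization" for p x by (rule R.ac_closed[OF R.co_simps(1)])
  have "f \<in> lin_maps (coord_space R.d) S"
    unfolding f_def by (rule lin_mapsI[OF _ _ _ subspace_coord_space]) (simp_all add: \<psi>S f_add
      f_scale)
  moreover have "f (op R.model g x) = op A g (f x)" if "x \<in> coord_space R.d" for g x
    using f_ac[of "gen g" x] that by (simp add: f_def R.op_model R.co_simps(4,5)[OF cl])
  ultimately have "f \<in> Mor (sch_model_cat q) R.model A" by (simp add: sch_model_cat_def)
  moreover have "bij_betw f (sp R.model) S"
    by (rule bij_betw_byWitness[where f' = "\<lambda>v. R.\<phi> (h v)"])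
      (auto simp: f_def \<psi>S hh R.co_simps)
  moreover have "R.model \<in> Obj (sch_model_cat q)" "A \<in> Obj (sch_model_cat q)"
    using R.is_sch_model model by (simp_all add: sch_model_cat_def)
  ultimately show ?thesis using sch_model_isomorphism by blast
qed

end

lemma (in generic_q) model_functor_weak_equivalence:
  assumes "\<exists>f :: complex \<Rightarrow> 'a. inj f"
  shows "weak_equivalence (schroedinger_cat q :: ((uq_free set, 'a) module, 'a \<Rightarrow> 'a) cat)
    (sch_model_cat q) (model_functor q)"
proof (rule weak_equivalenceI)
  let ?C = "schroedinger_cat q :: ((uq_free set, 'a) module, 'a \<Rightarrow> 'a) cat"
  show "category ?C" by (rule category_schroedinger_cat)
  show "category (sch_model_cat q)" by (rule category_sch_model_cat)
  have o: "omap (model_functor q) M = sch_module.model q M" for M :: "(uq_free set, 'a) module"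
    by (simp add: model_functor_def)
  have m: "mmap (model_functor q) M N f =
      restrict (\<lambda>x. sch_module.\<phi> q N (f (sch_module.\<psi> q M x))) (coord_space (sch_module.d q M))"
    for M N :: "(uq_free set, 'a) module" and f
    by (simp add: model_functor_def)
  have pair: "sch_module_pair q M N" if "M \<in> Obj ?C" "N \<in> Obj ?C" for M N
    using that by (simp add: sch_module_pair_def sch_module_def)
  show "is_functor ?C (sch_model_cat q) (model_functor q)"
    unfolding is_functor_def o m
  proof (intro conjI ballI)
    fix M assume M: "M \<in> Obj ?C"
    interpret M: sch_module q M by standard (rule M)
    show "M.model \<in> Obj (sch_model_cat q)" using M.is_sch_model by (simp add: sch_model_cat_def)
    show "restrict (\<lambda>x. M.\<phi> (Idn ?C M (M.\<psi> x))) (coord_space M.d) = Idn (sch_model_cat q) M.model"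
      by (intro ext) (simp add: sch_model_cat_def schroedinger_cat_def full_subcategory_def
        left_module_cat_def M.co_simps)
  next
    fix M N f assume "M \<in> Obj ?C" "N \<in> Obj ?C" "f \<in> Mor ?C M N"
    then show "restrict (\<lambda>x. sch_module.\<phi> q N (f (sch_module.\<psi> q M x))) (coord_space (sch_module.d
      q M)) \<in>
      Mor (sch_model_cat q) (sch_module.model q M) (sch_module.model q N)"
      using sch_module_pair.model_Mor[OF pair] by blast
  next
    fix M N L f g assume M: "M \<in> Obj ?C" "N \<in> Obj ?C" and f: "f \<in> Mor ?C M N"
    interpret MN: sch_module_pair q M N by (rule pair[OF M])
    note h = MN.hom_simps[OF f]
    show "restrict (\<lambda>x. sch_module.\<phi> q L (Comp ?C M N L g f (MN.A.\<psi> x))) (coord_space MN.A.d) =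
      Comp (sch_model_cat q) MN.A.model MN.B.model (sch_module.model q L)
        (restrict (\<lambda>x. sch_module.\<phi> q L (g (MN.B.\<psi> x))) (coord_space MN.B.d))
        (restrict (\<lambda>x. MN.B.\<phi> (f (MN.A.\<psi> x))) (coord_space MN.A.d))"
      by (intro ext) (simp add: sch_model_cat_def schroedinger_cat_def full_subcategory_def
        left_module_cat_def
          compose_def MN.A.co_simps MN.B.co_simps h)
  qed
  show "inj_on (mmap (model_functor q) M N) (Mor ?C M N)" if "M \<in> Obj ?C" "N \<in> Obj ?C" for M N
    using sch_module_pair.model_faithful[OF pair[OF that]] unfolding m by (intro inj_onI)
  show "\<exists>f\<in>Mor ?C M N. mmap (model_functor q) M N f = g"
    if "M \<in> Obj ?C" "N \<in> Obj ?C"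
      "g \<in> Mor (sch_model_cat q) (omap (model_functor q) M) (omap (model_functor q) N)" for M N g
    using sch_module_pair.model_full[OF pair[OF that(1,2)]] that(3) unfolding m o .
  show "\<exists>M\<in>Obj ?C. \<exists>f. is_isomorphism (sch_model_cat q) (omap (model_functor q) M) A f"
    if A: "A \<in> Obj (sch_model_cat q)" for A
  proof -
    obtain h :: "coords \<Rightarrow> 'a" where h: "inj_on h bounded_coords"
      by (rule coords_injection[OF assms])
    have "sch_realization q A h"
      using A h generic_q_axioms
      by (simp add: sch_realization_def sch_object_def sch_object_axioms_def coords_embedding_def
        sch_model_cat_def)
    then interpret sch_realization q A h .
    show ?thesis using realization_Obj realization_model_isomorphism unfolding o by blast
  qed
qed

theorem theorem17:
  fixes q :: complex
  assumes "q \<noteq> 0"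
    and "\<forall>n::nat. n > 0 \<longrightarrow> q ^ n \<noteq> 1"
    and "\<exists>f :: complex \<Rightarrow> 'a. inj f"
    and "\<exists>f :: complex \<Rightarrow> 'b. inj f"
  shows "equivalent_categories
    (schroedinger_cat q :: ((uq_free set, 'a) module, 'a \<Rightarrow> 'a) cat)
    (quiver_rep_cat :: ('b quiver_rep, nat \<Rightarrow> 'b \<Rightarrow> 'b) cat)"
proof -
  interpret generic_q q using assms(1,2) by unfold_locales
  obtain h :: "coords \<Rightarrow> 'b" where "inj_on h bounded_coords"
    by (rule coords_injection[OF assms(4)])
  then interpret coords_embedding h by unfold_locales
  show ?thesis
    by (rule weak_equivalence_imp_equivalent[OF weak_equivalence_comp[OF
          weak_equivalence_comp[OF model_functor_weak_equivalence[OF assms(3)]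
            hw_functor_weak_equivalence]
          rep_functor_weak_equivalence]])
qed

end
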